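(* The coordinate ring of the invariant commuting variety $\mathcal{C}om_4$ of pairs of $4\times4$ complex matrices is isomorphic to $\mathbb{C}[a_1,a_2]\otimes\mathbb{C}[a_3,\dots,a_{14}]/J$, where $J$ is the ideal generated by the following fifteen polynomials: \begin{align*} \tilde r_1={}&a_3(a_4^2-a_3a_5)-2(a_7^2-a_6a_8)+2(a_3a_{12}-2a_4a_{11}+a_5a_{10}),\\ \tilde r_2={}&-a_6(4a_4^2-a_3a_5)-3a_3(a_3a_8-2a_4a_7)+12(a_6a_{12}-2a_7a_{11}+a_8a_{10}),\\ \tilde r_3={}&-2a_4a_5a_6+3a_3a_5a_7-a_3^2a_9+4(2a_6a_{13}-3a_7a_{12}+a_9a_{10}),\\ \tilde r_4={}&-6a_{10}(a_4^2+a_3a_5)-3a_3^2(a_4^2-a_3a_5)+2a_6(a_3a_8-2a_4a_7+a_5a_6)\\ &-12a_3(a_3a_{12}-2a_4a_{11})+24(a_{10}a_{12}-a_{11}^2),\\ \tilde r_5={}&3a_4a_5(a_3a_5-a_4^2)+2(a_3a_8a_9-2a_4a_7a_9+a_5a_6a_9)\\ &-3a_4(a_5a_{12}-4a_4a_{13}+3a_3a_{14})+3a_5(a_3a_{13}-a_5a_{11})+12(a_{11}a_{14}-a_{12}a_{13}),\\ \tilde r_6={}&-3a_7(4a_4^2+a_3a_5)+4a_4a_5a_6+18a_3a_4a_8-7a_3^2a_9+12(a_9a_{10}-2a_8a_{11}+a_7a_{12}),\\ \tilde t_1={}&a_5(a_4^2-a_3a_5)-2(a_8^2-a_7a_9)+2(a_5a_{12}-2a_4a_{13}+a_3a_{14}),\\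 \tilde t_2={}&-a_9(4a_4^2-a_3a_5)-3a_5(a_5a_7-2a_4a_8)+12(a_9a_{12}-2a_8a_{13}+a_7a_{14}),\\ \tilde t_3={}&-2a_3a_4a_9+3a_3a_5a_8-a_5^2a_6+4(2a_9a_{11}-3a_8a_{12}+a_6a_{14}),\\ \tilde t_4={}&-6a_{14}(a_4^2+a_3a_5)-3a_5^2(a_4^2-a_3a_5)+2a_9(a_5a_7-2a_4a_8+a_3a_9)\\ &-12a_5(a_5a_{12}-2a_4a_{13})+24(a_{12}a_{14}-a_{13}^2),\\ \tilde t_5={}&3a_3a_4(a_3a_5-a_4^2)+2(a_5a_6a_7-2a_4a_6a_8+a_3a_6a_9)\\ &-3a_4(a_3a_{12}-4a_4a_{11}+3a_5a_{10})+3a_3(a_5a_{11}-a_3a_{13})+12(a_{10}a_{13}-a_{11}a_{12}),\\ \tilde t_6={}&-3a_8(4a_4^2+a_3a_5)+4a_3a_4a_9+18a_4a_5a_7-7a_5^2a_6+12(a_6a_{14}-2a_7a_{13}+a_8a_{12}),\\ \tilde s_1={}&a_4(a_4^2-a_3a_5)+(a_6a_9-a_7a_8)+2(a_3a_{13}-2a_4a_{12}+a_5a_{11}),\\ \tilde s_2={}&2a_4^2(a_3a_5-a_4^2)-a_3(a_3a_{14}-2a_5a_{12})+2(a_3a_7a_9-2a_4a_7a_8+a_5a_6a_8)\\ &-a_5(a_5a_{10}-2a_3a_{12})-2a_4(3a_3a_{13}-5a_4a_{12}+3a_5a_{11})+4(a_{10}a_{14}+2a_{11}a_{13}-3a_{12}^2),\\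 \tilde s_3={}&2a_{12}(2a_4^2+a_3a_5)+a_3(a_3a_{14}-4a_4a_{13})+a_5(a_5a_{10}-4a_4a_{11})\\ &-4(a_{10}a_{14}-4a_{11}a_{13}+3a_{12}^2). \end{align*}
   Context: Let $\mathcal{M}_4$ be the space of complex $4\times4$ matrices, with $\mathrm{GL}_4$ acting on $\mathcal{M}_4\times\mathcal{M}_4$ by simultaneous conjugation, and $\mathrm{Com}_4=\{(X,Y)\in\mathcal{M}_4\times\mathcal{M}_4:[X,Y]=0\}$. The invariant commuting variety is the affine quotient $\mathcal{C}om_4=\mathrm{Com}_4/\!/\mathrm{GL}_4$. Put $A=X-\frac14\mathrm{Tr}(X)I_4$, $B=Y-\frac14\mathrm{Tr}(Y)I_4$. The variables $a_i$ correspond to the following functions, known to generate $\mathbb{C}[\mathcal{C}om_4]$: $a_1=\mathrm{Tr}(X)$, $a_2=\mathrm{Tr}(Y)$, $a_3=\mathrm{Tr}(A^2)$, $a_4=\mathrm{Tr}(AB)$, $a_5=\mathrm{Tr}(B^2)$, $a_6=\mathrm{Tr}(A^3)$, $a_7=\mathrm{Tr}(A^2B)$, $a_8=\mathrm{Tr}(AB^2)$, $a_9=\mathrm{Tr}(B^3)$, $a_{10}=\mathrm{Tr}(A^4)$, $a_{11}=\mathrm{Tr}(A^3B)$, $a_{12}=\mathrm{Tr}(A^2B^2)$, $a_{13}=\mathrm{Tr}(AB^3)$, $a_{14}=\mathrm{Tr}(B^4)$. *)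

theory Defs
  imports
    "HOL-Analysis.Analysis"
    "HOL-Algebra.QuotRing"
    "HOL-Algebra.Module"
    "HOL-Library.Poly_Mapping"
begin

section \<open>Complex algebras\<close>

text \<open>A commutative complex algebra is given by a record of type \<open>(complex, 'a) module\<close>
  (HOL-Algebra), the scalars being the whole type \<open>complex\<close>.\<close>

definition alg_iso ::
  "(complex, 'a, 'm) module_scheme \<Rightarrow> (complex, 'b, 'n) module_scheme \<Rightarrow> ('a \<Rightarrow> 'b) set" where
  "alg_iso A B = {h \<in> ring_iso A B. \<forall>c. \<forall>x\<in>carrier A. h (c \<odot>\<^bsub>A\<^esub> x) = c \<odot>\<^bsub>B\<^esub> h x}"

text \<open>The library quotient ring, with scalar multiplication on cosets defined in the same style
  as the library's \<open>rcoset_mult\<close>; for an ideal \<open>I\<close> all members of the union coincide.\<close>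

definition alg_quot ::
  "(complex, 'a, 'm) module_scheme \<Rightarrow> 'a set \<Rightarrow> (complex, 'a set) module" where
  "alg_quot A I =
    \<lparr>carrier = carrier (A Quot I), mult = mult (A Quot I), one = one (A Quot I),
     zero = zero (A Quot I), add = add (A Quot I),
     smult = (\<lambda>c X. \<Union>x\<in>X. I +>\<^bsub>A\<^esub> (c \<odot>\<^bsub>A\<^esub> x))\<rparr>"

subsection \<open>Tensor products over the complex numbers\<close>

text \<open>The free vector space on \<open>carrier A \<times> carrier B\<close>, multiplied by bilinear extension of
  \<open>(x, y) (x', y') = (x x', y y')\<close>. The built-in product of \<open>poly_mapping\<close>
  is not used here: it is the convolution for the additive structure of the keys.\<close>

definition free_prod_alg ::
  "(complex, 'a, 'm) module_scheme \<Rightarrow> (complex, 'b, 'n) module_scheme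
    \<Rightarrow> (complex, ('a \<times> 'b) \<Rightarrow>\<^sub>0 complex) module" where
  "free_prod_alg A B =
    \<lparr>carrier = {f. Poly_Mapping.keys f \<subseteq> carrier A \<times> carrier B},
     mult = (\<lambda>f g. \<Sum>(x, y)\<in>Poly_Mapping.keys f. \<Sum>(x', y')\<in>Poly_Mapping.keys g.
       Poly_Mapping.single (x \<otimes>\<^bsub>A\<^esub> x', y \<otimes>\<^bsub>B\<^esub> y')
         (Poly_Mapping.lookup f (x, y) * Poly_Mapping.lookup g (x', y'))),
     one = Poly_Mapping.single (\<one>\<^bsub>A\<^esub>, \<one>\<^bsub>B\<^esub>) 1,
     zero = 0,
     add = (+),
     smult = (\<lambda>c. Poly_Mapping.map ((*) c))\<rparr>"

definition tensor_relators ::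
  "(complex, 'a, 'm) module_scheme \<Rightarrow> (complex, 'b, 'n) module_scheme
    \<Rightarrow> (('a \<times> 'b) \<Rightarrow>\<^sub>0 complex) set" where
  "tensor_relators A B =
    {Poly_Mapping.single (x \<oplus>\<^bsub>A\<^esub> x', y) 1
       - Poly_Mapping.single (x, y) 1 - Poly_Mapping.single (x', y) 1 | x x' y.
       x \<in> carrier A \<and> x' \<in> carrier A \<and> y \<in> carrier B}
    \<union> {Poly_Mapping.single (x, y \<oplus>\<^bsub>B\<^esub> y') 1
       - Poly_Mapping.single (x, y) 1 - Poly_Mapping.single (x, y') 1 | x y y'.
       x \<in> carrier A \<and> y \<in> carrier B \<and> y' \<in> carrier B}
    \<union> {Poly_Mapping.single (c \<odot>\<^bsub>A\<^esub> x, y) 1 - Poly_Mapping.single (x, y) c | c x y.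
       x \<in> carrier A \<and> y \<in> carrier B}
    \<union> {Poly_Mapping.single (x, c \<odot>\<^bsub>B\<^esub> y) 1 - Poly_Mapping.single (x, y) c | c x y.
       x \<in> carrier A \<and> y \<in> carrier B}"

text \<open>The relators are stable under multiplication by basis elements, so the ideal they generate
  is also their linear span, and the quotient below is the usual tensor product.\<close>

definition tensor_ideal ::
  "(complex, 'a, 'm) module_scheme \<Rightarrow> (complex, 'b, 'n) module_scheme
    \<Rightarrow> (('a \<times> 'b) \<Rightarrow>\<^sub>0 complex) set" where
  "tensor_ideal A B = genideal (free_prod_alg A B) (tensor_relators A B)"

definition alg_tensor ::
  "(complex, 'a, 'm) module_scheme \<Rightarrow> (complex, 'b, 'n) module_scheme
    \<Rightarrow> (complex, (('a \<times> 'b) \<Rightarrow>\<^sub>0 complex) set) module" where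
  "alg_tensor A B = alg_quot (free_prod_alg A B) (tensor_ideal A B)"

definition pure_tensor ::
  "(complex, 'a, 'm) module_scheme \<Rightarrow> (complex, 'b, 'n) module_scheme
    \<Rightarrow> 'a \<Rightarrow> 'b \<Rightarrow> (('a \<times> 'b) \<Rightarrow>\<^sub>0 complex) set" where
  "pure_tensor A B x y =
    tensor_ideal A B +>\<^bsub>free_prod_alg A B\<^esub> Poly_Mapping.single (x, y) 1"

section \<open>Polynomials in the variables \<open>a\<^sub>i\<close>\<close>

text \<open>A monomial is its exponent vector of type \<open>nat \<Rightarrow>\<^sub>0 nat\<close>, and the ring structure is
  the convolution product of \<open>poly_mapping\<close>.\<close>

type_synonym cpoly = "(nat \<Rightarrow>\<^sub>0 nat) \<Rightarrow>\<^sub>0 complex"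

definition var :: "nat \<Rightarrow> cpoly" where
  "var i = Poly_Mapping.single (Poly_Mapping.single i 1) 1"

definition poly_alg :: "nat set \<Rightarrow> (complex, cpoly) module" where
  "poly_alg I =
    \<lparr>carrier = {p. \<forall>m\<in>Poly_Mapping.keys p. Poly_Mapping.keys m \<subseteq> I},
     mult = (*), one = 1, zero = 0, add = (+),
     smult = (\<lambda>c. Poly_Mapping.map ((*) c))\<rparr>"

definition relations :: "(nat \<Rightarrow> 'r::comm_ring_1) \<Rightarrow> 'r set" where
  "relations a =
    (let
      r1 = a 3 * ((a 4)^2 - a 3 * a 5) - 2 * ((a 7)^2 - a 6 * a 8)
        + 2 * (a 3 * a 12 - 2 * a 4 * a 11 + a 5 * a 10);
      r2 = -a 6 * (4 * (a 4)^2 - a 3 * a 5) - 3 * a 3 * (a 3 * a 8 - 2 * a 4 * a 7)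
        + 12 * (a 6 * a 12 - 2 * a 7 * a 11 + a 8 * a 10);
      r3 = -2 * a 4 * a 5 * a 6 + 3 * a 3 * a 5 * a 7 - (a 3)^2 * a 9
        + 4 * (2 * a 6 * a 13 - 3 * a 7 * a 12 + a 9 * a 10);
      r4 = -6 * a 10 * ((a 4)^2 + a 3 * a 5) - 3 * (a 3)^2 * ((a 4)^2 - a 3 * a 5)
        + 2 * a 6 * (a 3 * a 8 - 2 * a 4 * a 7 + a 5 * a 6)
        - 12 * a 3 * (a 3 * a 12 - 2 * a 4 * a 11) + 24 * (a 10 * a 12 - (a 11)^2);
      r5 = 3 * a 4 * a 5 * (a 3 * a 5 - (a 4)^2)
        + 2 * (a 3 * a 8 * a 9 - 2 * a 4 * a 7 * a 9 + a 5 * a 6 * a 9)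
        - 3 * a 4 * (a 5 * a 12 - 4 * a 4 * a 13 + 3 * a 3 * a 14)
        + 3 * a 5 * (a 3 * a 13 - a 5 * a 11) + 12 * (a 11 * a 14 - a 12 * a 13);
      r6 = -3 * a 7 * (4 * (a 4)^2 + a 3 * a 5) + 4 * a 4 * a 5 * a 6 + 18 * a 3 * a 4 * a 8
        - 7 * (a 3)^2 * a 9 + 12 * (a 9 * a 10 - 2 * a 8 * a 11 + a 7 * a 12);
      t1 = a 5 * ((a 4)^2 - a 3 * a 5) - 2 * ((a 8)^2 - a 7 * a 9)
        + 2 * (a 5 * a 12 - 2 * a 4 * a 13 + a 3 * a 14);
      t2 = -a 9 * (4 * (a 4)^2 - a 3 * a 5) - 3 * a 5 * (a 5 * a 7 - 2 * a 4 * a 8)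
        + 12 * (a 9 * a 12 - 2 * a 8 * a 13 + a 7 * a 14);
      t3 = -2 * a 3 * a 4 * a 9 + 3 * a 3 * a 5 * a 8 - (a 5)^2 * a 6
        + 4 * (2 * a 9 * a 11 - 3 * a 8 * a 12 + a 6 * a 14);
      t4 = -6 * a 14 * ((a 4)^2 + a 3 * a 5) - 3 * (a 5)^2 * ((a 4)^2 - a 3 * a 5)
        + 2 * a 9 * (a 5 * a 7 - 2 * a 4 * a 8 + a 3 * a 9)
        - 12 * a 5 * (a 5 * a 12 - 2 * a 4 * a 13) + 24 * (a 12 * a 14 - (a 13)^2);
      t5 = 3 * a 3 * a 4 * (a 3 * a 5 - (a 4)^2)
        + 2 * (a 5 * a 6 * a 7 - 2 * a 4 * a 6 * a 8 + a 3 * a 6 * a 9)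
        - 3 * a 4 * (a 3 * a 12 - 4 * a 4 * a 11 + 3 * a 5 * a 10)
        + 3 * a 3 * (a 5 * a 11 - a 3 * a 13) + 12 * (a 10 * a 13 - a 11 * a 12);
      t6 = -3 * a 8 * (4 * (a 4)^2 + a 3 * a 5) + 4 * a 3 * a 4 * a 9 + 18 * a 4 * a 5 * a 7
        - 7 * (a 5)^2 * a 6 + 12 * (a 6 * a 14 - 2 * a 7 * a 13 + a 8 * a 12);
      s1 = a 4 * ((a 4)^2 - a 3 * a 5) + (a 6 * a 9 - a 7 * a 8)
        + 2 * (a 3 * a 13 - 2 * a 4 * a 12 + a 5 * a 11);
      s2 = 2 * (a 4)^2 * (a 3 * a 5 - (a 4)^2) - a 3 * (a 3 * a 14 - 2 * a 5 * a 12)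
        + 2 * (a 3 * a 7 * a 9 - 2 * a 4 * a 7 * a 8 + a 5 * a 6 * a 8)
        - a 5 * (a 5 * a 10 - 2 * a 3 * a 12)
        - 2 * a 4 * (3 * a 3 * a 13 - 5 * a 4 * a 12 + 3 * a 5 * a 11)
        + 4 * (a 10 * a 14 + 2 * a 11 * a 13 - 3 * (a 12)^2);
      s3 = 2 * a 12 * (2 * (a 4)^2 + a 3 * a 5) + a 3 * (a 3 * a 14 - 4 * a 4 * a 13)
        + a 5 * (a 5 * a 10 - 4 * a 4 * a 11)
        - 4 * (a 10 * a 14 - 4 * a 11 * a 13 + 3 * (a 12)^2)
     in {r1, r2, r3, r4, r5, r6, t1, t2, t3, t4, t5, t6, s1, s2, s3})"

definition J :: "cpoly set" where
  "J = genideal (poly_alg {3..14}) (relations var)"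

section \<open>The invariant commuting variety\<close>

type_synonym mat4 = "complex^4^4"

definition Com4 :: "(mat4 \<times> mat4) set" where
  "Com4 = {(X, Y). X ** Y - Y ** X = 0}"

definition conj_act :: "mat4 \<Rightarrow> mat4 \<times> mat4 \<Rightarrow> mat4 \<times> mat4" where
  "conj_act g = (\<lambda>(X, Y). (g ** X ** matrix_inv g, g ** Y ** matrix_inv g))"

text \<open>Complex analogue of the library's \<open>real_polynomial_function\<close>.\<close>

inductive_set polynomial_fns :: "(mat4 \<times> mat4 \<Rightarrow> complex) set" where
  const: "(\<lambda>_. c) \<in> polynomial_fns"
| entry_fst: "(\<lambda>(X, Y). X $ i $ j) \<in> polynomial_fns"
| entry_snd: "(\<lambda>(X, Y). Y $ i $ j) \<in> polynomial_fns"
| add: "f \<in> polynomial_fns \<Longrightarrow> g \<in> polynomial_fns \<Longrightarrow> (\<lambda>p. f p + g p) \<in> polynomial_fns"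
| mult: "f \<in> polynomial_fns \<Longrightarrow> g \<in> polynomial_fns \<Longrightarrow> (\<lambda>p. f p * g p) \<in> polynomial_fns"

text \<open>Regular functions on the affine variety \<open>Com4\<close> are the restrictions of polynomial functions.
  The coordinate ring of the affine quotient by GL(4) is by definition the
  algebra of invariant regular functions.\<close>

definition regular_fns :: "(mat4 \<times> mat4 \<Rightarrow> complex) set" where
  "regular_fns = (\<lambda>f. restrict f Com4) ` polynomial_fns"

definition coord_ring_inv_Com4 :: "(complex, mat4 \<times> mat4 \<Rightarrow> complex) module" where
  "coord_ring_inv_Com4 =
    \<lparr>carrier = {f \<in> regular_fns. \<forall>g. invertible g \<longrightarrow> (\<forall>p\<in>Com4. f (conj_act g p) = f p)},
     mult = (\<lambda>f g. \<lambda>p\<in>Com4. f p * g p),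
     one = (\<lambda>p\<in>Com4. 1),
     zero = (\<lambda>p\<in>Com4. 0),
     add = (\<lambda>f g. \<lambda>p\<in>Com4. f p + g p),
     smult = (\<lambda>c f. \<lambda>p\<in>Com4. c * f p)\<rparr>"

definition traceless :: "mat4 \<Rightarrow> mat4" where
  "traceless X = X - mat (trace X / 4)"

text \<open>The list index starts at 0, so \<open>a\<^sub>i\<close> is entry \<open>i - 1\<close>.\<close>

definition trace_fn :: "nat \<Rightarrow> mat4 \<times> mat4 \<Rightarrow> complex" where
  "trace_fn i = (\<lambda>(X, Y). let A = traceless X; B = traceless Y in
    [trace X, trace Y,
     trace (A ** A), trace (A ** B), trace (B ** B),
     trace (A ** A ** A), trace (A ** A ** B), trace (A ** B ** B), trace (B ** B ** B),
     trace (A ** A ** A ** A), trace (A ** A ** A ** B), trace (A ** A ** B ** B),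
     trace (A ** B ** B ** B), trace (B ** B ** B ** B)] ! (i - 1))"

end

theory Submission
  imports Defs "HOL-Computational_Algebra.Fundamental_Theorem_Algebra"
begin

text \<open>Two commuting matrices can be triangularized simultaneously, and conjugation by
  \<open>diag(t\<^sup>3, t\<^sup>2, t, 1)\<close> with \<open>t \<rightarrow> 0\<close> kills the entries above the diagonal. An invariant regular function
  is thus determined by its values on pairs of diagonal matrices, where it is a multisymmetric
  function of four points of the plane, hence a polynomial in power sums of degree at most four.
  What remains is to show that a polynomial \<open>q\<close> in \<open>a\<^sub>3, \<dots>, a\<^sub>1\<^sub>4\<close> which vanishes at all centered
  quadruples of points lies in \<open>J\<close>. Modulo \<open>J\<close>, by a Groebner basis, \<open>q\<close> is a combination of 24
  monomials, with coefficients in the six pure power sums \<open>a\<^sub>3, a\<^sub>6, a\<^sub>1\<^sub>0, a\<^sub>5, a\<^sub>9, a\<^sub>1\<^sub>4\<close>. Permuting the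
  second coordinates against the first ones fixes the pure power sums, and so gives 24 linear
  equations for the coefficients; their matrix is invertible at one point, hence generically, and the
  coefficients vanish. The pure power sums being algebraically independent, they are zero
  polynomials.\<close>

section \<open>Polynomials and their values\<close>

text \<open>The count of 24 is what makes the argument close. Over the pure power sums, the
  invariants of two independent copies of the symmetric group, all polynomial functions on pairs of
  sum-zero vectors form a free module of rank 24^2, and the diagonal invariants one of rank 24. So
  as soon as 24 monomials span modulo \<open>J\<close> and are independent as functions,
  \<open>J\<close> is the whole vanishing ideal: neither an S-polynomial criterion nor primality of
  \<open>J\<close> has to be verified, only the existence of remainders. The 24 permuted pairs are
  the general fibre of the map that forgets how the two lists are paired, hence as many equations as
  unknowns. The degeneration takes the place of the density of simultaneously diagonalizable pairs
  in the commuting variety: a pair need not be a limit of diagonalizable ones, it is enough that its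
  orbit has a diagonal pair in its closure. The factor in \<open>a_1, a_2\<close> splits off because
  scalar matrices can be added to \<open>X\<close> and \<open>Y\<close> without changing the centred
  matrices, so the two traces are arbitrary over each centred point.\<close>

definition monom_val :: "(nat \<Rightarrow> 'r::comm_ring_1) \<Rightarrow> (nat \<Rightarrow>\<^sub>0 nat) \<Rightarrow> 'r" where
  "monom_val a m = (\<Prod>i\<in>Poly_Mapping.keys m. a i ^ Poly_Mapping.lookup m i)"

definition poly_val :: "(nat \<Rightarrow> complex) \<Rightarrow> cpoly \<Rightarrow> complex" where
  "poly_val a p = (\<Sum>m\<in>Poly_Mapping.keys p. Poly_Mapping.lookup p m * monom_val a m)"

abbreviation polys :: "nat set \<Rightarrow> cpoly set" where
  "polys I \<equiv> carrier (poly_alg I)"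

abbreviation Const :: "complex \<Rightarrow> cpoly" where
  "Const \<equiv> Poly_Mapping.single 0"

lemma monom_val_superset:
  assumes "finite A" "Poly_Mapping.keys m \<subseteq> A"
  shows "monom_val a m = (\<Prod>i\<in>A. a i ^ Poly_Mapping.lookup m i)"
  unfolding monom_val_def
  by (rule prod.mono_neutral_left) (use assms in \<open>auto simp: in_keys_iff\<close>)

lemma monom_val_zero [simp]: "monom_val a 0 = 1"
  by (simp add: monom_val_def)

lemma monom_val_single [simp]: "monom_val a (Poly_Mapping.single i n) = a i ^ n"
  by (cases "n = 0") (auto simp: monom_val_def)

lemma monom_val_add: "monom_val a (m + n) = monom_val a m * monom_val a n"
proof -
  let ?A = "Poly_Mapping.keys m \<union> Poly_Mapping.keys n"
  have "monom_val a (m + n) = (\<Prod>i\<in>?A. a i ^ Poly_Mapping.lookup (m + n) i)"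
    by (rule monom_val_superset) (auto simp: Poly_Mapping.keys_add)
  also have "\<dots> = (\<Prod>i\<in>?A. a i ^ Poly_Mapping.lookup m i) * (\<Prod>i\<in>?A. a i ^ Poly_Mapping.lookup n i)"
    by (simp add: lookup_add power_add prod.distrib)
  also have "\<dots> = monom_val a m * monom_val a n"
    by (simp add: monom_val_superset[of ?A])
  finally show ?thesis .
qed

lemma monom_val_mult: "monom_val (\<lambda>i. a i * b i) m = monom_val a m * monom_val b m"
  by (simp add: monom_val_def power_mult_distrib prod.distrib)

lemma poly_mapping_eq_sum_single:
  "p = (\<Sum>m\<in>Poly_Mapping.keys p. Poly_Mapping.single m (Poly_Mapping.lookup p m))"
proof (rule poly_mapping_eqI)
  fix k
  show "Poly_Mapping.lookup p k
      = Poly_Mapping.lookup (\<Sum>m\<in>Poly_Mapping.keys p. Poly_Mapping.single m (Poly_Mapping.lookup p m)) k"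
    by (simp add: lookup_sum lookup_single when_def in_keys_iff)
qed

lemma poly_val_superset:
  assumes "finite A" "Poly_Mapping.keys p \<subseteq> A"
  shows "poly_val a p = (\<Sum>m\<in>A. Poly_Mapping.lookup p m * monom_val a m)"
  unfolding poly_val_def
  by (rule sum.mono_neutral_left) (use assms in \<open>auto simp: in_keys_iff\<close>)

lemma poly_val_zero [simp]: "poly_val a 0 = 0"
  by (simp add: poly_val_def)

lemma poly_val_single [simp]: "poly_val a (Poly_Mapping.single m c) = c * monom_val a m"
  by (cases "c = 0") (auto simp: poly_val_def)

lemma poly_val_one [simp]: "poly_val a 1 = 1"
  using poly_val_single[of a 0 1] by simp

lemma poly_val_add [simp]: "poly_val a (p + q) = poly_val a p + poly_val a q"
proof -
  let ?A = "Poly_Mapping.keys p \<union> Poly_Mapping.keys q"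
  have "poly_val a (p + q) = (\<Sum>m\<in>?A. Poly_Mapping.lookup (p + q) m * monom_val a m)"
    by (rule poly_val_superset) (auto simp: Poly_Mapping.keys_add)
  also have "\<dots> = poly_val a p + poly_val a q"
    by (simp add: lookup_add distrib_right sum.distrib poly_val_superset[of ?A])
  finally show ?thesis .
qed

lemma poly_val_uminus [simp]: "poly_val a (- p) = - poly_val a p"
  using poly_val_add[of a p "- p"] by (simp add: eq_neg_iff_add_eq_0 add.commute)

lemma poly_val_diff [simp]: "poly_val a (p - q) = poly_val a p - poly_val a q"
  using poly_val_add[of a p "- q"] by simp

lemma poly_val_sum [simp]: "poly_val a (sum f A) = (\<Sum>x\<in>A. poly_val a (f x))"
  by (induction A rule: infinite_finite_induct) auto

lemma poly_val_mult [simp]: "poly_val a (p * q) = poly_val a p * poly_val a q"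
proof -
  have single: "poly_val a (Poly_Mapping.single m c * q) = c * monom_val a m * poly_val a q" for m c
  proof -
    have "poly_val a (Poly_Mapping.single m c
          * (\<Sum>n\<in>Poly_Mapping.keys q. Poly_Mapping.single n (Poly_Mapping.lookup q n)))
        = c * monom_val a m * poly_val a q"
      by (simp add: sum_distrib_left mult_single monom_val_add mult_ac)
        (simp add: poly_val_def sum_distrib_left mult_ac)
    then show ?thesis by (simp flip: poly_mapping_eq_sum_single)
  qed
  have "poly_val a ((\<Sum>m\<in>Poly_Mapping.keys p. Poly_Mapping.single m (Poly_Mapping.lookup p m)) * q)
      = poly_val a p * poly_val a q"
    by (simp add: sum_distrib_right single) (simp add: poly_val_def sum_distrib_right)
  then show ?thesis by (simp flip: poly_mapping_eq_sum_single)
qed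

lemma poly_val_power [simp]: "poly_val a (p ^ n) = poly_val a p ^ n"
  by (induction n) auto

lemma poly_val_numeral [simp]: "poly_val a (numeral n) = numeral n"
  using poly_val_single[of a 0 "numeral n"] by (simp del: poly_val_single)

lemma poly_val_var [simp]: "poly_val a (var i) = a i"
  by (simp add: var_def)

lemma monom_val_cong:
  "(\<And>i. i \<in> Poly_Mapping.keys m \<Longrightarrow> a i = b i) \<Longrightarrow> monom_val a m = monom_val b m"
  by (simp add: monom_val_def)

lemma poly_val_cong:
  assumes "p \<in> polys I" "\<And>i. i \<in> I \<Longrightarrow> a i = b i"
  shows "poly_val a p = poly_val b p"
  unfolding poly_val_def
proof (rule sum.cong[OF refl])
  fix m assume "m \<in> Poly_Mapping.keys p"
  with assms have "monom_val a m = monom_val b m"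
    by (intro monom_val_cong) (auto simp: poly_alg_def)
  then show "Poly_Mapping.lookup p m * monom_val a m = Poly_Mapping.lookup p m * monom_val b m"
    by simp
qed

lemma poly_alg_simps [simp]:
  "mult (poly_alg I) = (*)" "one (poly_alg I) = 1" "zero (poly_alg I) = 0" "add (poly_alg I) = (+)"
  "smult (poly_alg I) c p = Const c * p"
  by (simp_all add: poly_alg_def mult_map_scale_conv_mult)

section \<open>Polynomials in a prescribed set of variables\<close>

lemma polys_iff: "p \<in> polys I \<longleftrightarrow> (\<forall>m\<in>Poly_Mapping.keys p. Poly_Mapping.keys m \<subseteq> I)"
  by (simp add: poly_alg_def)

lemma polys_zero [simp]: "0 \<in> polys I"
  by (simp add: polys_iff)

lemma polys_single: "Poly_Mapping.keys m \<subseteq> I \<Longrightarrow> Poly_Mapping.single m c \<in> polys I"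
  by (auto simp: polys_iff)

lemma polys_Const [simp]: "Const c \<in> polys I"
  by (simp add: polys_single)

lemma polys_one [simp]: "1 \<in> polys I"
  using polys_Const[of 1] by simp

lemma polys_numeral [simp]: "numeral n \<in> polys I"
  using polys_Const[of "numeral n"] by simp

lemma polys_var [simp]: "i \<in> I \<Longrightarrow> var i \<in> polys I"
  by (auto simp: var_def intro!: polys_single)

lemma polys_add [intro]: "p \<in> polys I \<Longrightarrow> q \<in> polys I \<Longrightarrow> p + q \<in> polys I"
  using Poly_Mapping.keys_add[of p q] by (auto simp: polys_iff)

lemma polys_mult [intro]: "p \<in> polys I \<Longrightarrow> q \<in> polys I \<Longrightarrow> p * q \<in> polys I"
proof (unfold polys_iff, intro ballI)
  fix m assume p: "\<forall>m\<in>Poly_Mapping.keys p. Poly_Mapping.keys m \<subseteq> I"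
    and q: "\<forall>m\<in>Poly_Mapping.keys q. Poly_Mapping.keys m \<subseteq> I" and "m \<in> Poly_Mapping.keys (p * q)"
  then obtain k l where "m = k + l" "k \<in> Poly_Mapping.keys p" "l \<in> Poly_Mapping.keys q"
    using keys_mult[of p q] by blast
  then show "Poly_Mapping.keys m \<subseteq> I"
    using Poly_Mapping.keys_add[of k l] p q by blast
qed

lemma polys_uminus [intro]: "p \<in> polys I \<Longrightarrow> - p \<in> polys I"
  using polys_mult[OF polys_Const[of "-1"], of p I] by (simp add: single_uminus)

lemma polys_diff [intro]: "p \<in> polys I \<Longrightarrow> q \<in> polys I \<Longrightarrow> p - q \<in> polys I"
  using polys_add[of p I "- q"] polys_uminus[of q I] by simp

lemma polys_power [intro]: "p \<in> polys I \<Longrightarrow> p ^ n \<in> polys I"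
  by (induction n) (auto intro: polys_mult)

lemma polys_sum [intro]: "(\<And>x. x \<in> A \<Longrightarrow> f x \<in> polys I) \<Longrightarrow> sum f A \<in> polys I"
  by (induction A rule: infinite_finite_induct) auto

lemma polys_mono: "I \<subseteq> K \<Longrightarrow> polys I \<subseteq> polys K"
  by (unfold subset_iff polys_iff) blast

lemma single_eq_prod_var:
  "Poly_Mapping.single m c = Const c * monom_val var m"
proof -
  have "monom_val var m = Poly_Mapping.single m 1"
  proof -
    have pow: "var i ^ n = Poly_Mapping.single (Poly_Mapping.single i n) 1" for i n
      by (induction n) (auto simp: var_def mult_single simp flip: single_add)
    have "(\<Prod>i\<in>A. var i ^ Poly_Mapping.lookup m i)
        = Poly_Mapping.single (\<Sum>i\<in>A. Poly_Mapping.single i (Poly_Mapping.lookup m i)) 1"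
      if "finite A" for A
      using that by (induction A) (auto simp: pow mult_single)
    then show ?thesis
      by (simp add: monom_val_def flip: poly_mapping_eq_sum_single)
  qed
  then show ?thesis by (simp add: mult_single)
qed

lemma polys_induct [consumes 1, case_names Const var add mult]:
  assumes "p \<in> polys I"
    and "\<And>c. P (Const c)" "\<And>i. i \<in> I \<Longrightarrow> P (var i)"
    and add: "\<And>p q. p \<in> polys I \<Longrightarrow> q \<in> polys I \<Longrightarrow> P p \<Longrightarrow> P q \<Longrightarrow> P (p + q)"
    and mult: "\<And>p q. p \<in> polys I \<Longrightarrow> q \<in> polys I \<Longrightarrow> P p \<Longrightarrow> P q \<Longrightarrow> P (p * q)"
  shows "P p"
proof -
  let ?Q = "\<lambda>p. p \<in> polys I \<and> P p"
  have one: "?Q 1" and zero: "?Q 0" using assms(2)[of 1] assms(2)[of 0] by auto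
  have pow: "?Q (var i ^ n)" if "i \<in> I" for i n
    by (induction n) (use that one in \<open>auto intro!: mult assms(3)\<close>)
  have prod: "?Q (\<Prod>i\<in>A. var i ^ f i)" if "A \<subseteq> I" "finite A" for A and f :: "nat \<Rightarrow> nat"
    using that(2,1) by (induction A) (use one pow in \<open>auto intro!: mult\<close>)
  have single: "?Q (Poly_Mapping.single m c)" if "Poly_Mapping.keys m \<subseteq> I" for m c
    by (subst single_eq_prod_var, unfold monom_val_def)
      (use prod[OF that, of "Poly_Mapping.lookup m"] assms(2)[of c] that
        in \<open>auto intro!: mult polys_single\<close>)
  have "?Q (\<Sum>m\<in>A. Poly_Mapping.single m (f m))"
    if "finite A" "\<forall>m\<in>A. Poly_Mapping.keys m \<subseteq> I" for A f
    using that by (induction A) (use zero single in \<open>auto intro!: add\<close>)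
  from this[of "Poly_Mapping.keys p" "Poly_Mapping.lookup p"] assms(1) show ?thesis
    by (auto simp: polys_iff simp flip: poly_mapping_eq_sum_single)
qed

lemma cring_poly_alg: "cring (poly_alg I)"
proof (rule cringI)
  show "abelian_group (poly_alg I)"
    by (rule abelian_groupI)
      (auto simp: add_ac intro!: bexI[of _ "- x" for x])
  show "Group.comm_monoid (poly_alg I)"
    by (rule Group.comm_monoidI) (auto simp: mult_ac)
qed (auto simp: distrib_right)

text \<open>Dedekind's independence of characters: distinct monomials are distinct
  multiplicative characters of the monoid of all points.\<close>

lemma monom_val_inj:
  assumes "m \<noteq> n"
  shows "\<exists>a. monom_val a m \<noteq> (monom_val a n :: complex)"
proof -
  from assms obtain i where i: "Poly_Mapping.lookup m i \<noteq> Poly_Mapping.lookup n i"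
    by (metis poly_mapping_eqI)
  \<comment> \<open>The value 2 sits at a coordinate where the exponents differ, so the monomials
    become different powers of 2; norms turn this into a statement about reals.\<close>
  define a :: "nat \<Rightarrow> complex" where "a = (\<lambda>j. if j = i then 2 else 1)"
  have "monom_val a k = 2 ^ Poly_Mapping.lookup k i" for k
  proof -
    have "monom_val a k = (\<Prod>j\<in>insert i (Poly_Mapping.keys k). a j ^ Poly_Mapping.lookup k j)"
      by (rule monom_val_superset) auto
    also have "\<dots> = (\<Prod>j\<in>insert i (Poly_Mapping.keys k). if j = i then 2 ^ Poly_Mapping.lookup k i else 1)"
      by (rule prod.cong) (auto simp: a_def)
    also have "\<dots> = 2 ^ Poly_Mapping.lookup k i"
      by (subst prod.delta) auto
    finally show ?thesis .
  qed
  moreover have "(2::complex) ^ Poly_Mapping.lookup m i \<noteq> 2 ^ Poly_Mapping.lookup n i"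
  proof
    assume "(2::complex) ^ Poly_Mapping.lookup m i = 2 ^ Poly_Mapping.lookup n i"
    then have "norm ((2::complex) ^ Poly_Mapping.lookup m i) = norm ((2::complex) ^ Poly_Mapping.lookup n i)"
      by metis
    then have "(2::real) ^ Poly_Mapping.lookup m i = 2 ^ Poly_Mapping.lookup n i"
      by (metis norm_numeral norm_power)
    with i show False by simp
  qed
  ultimately have "monom_val a m \<noteq> monom_val a n" by simp
  then show ?thesis by blast
qed

lemma monom_val_independent:
  assumes "finite F" "\<And>a. (\<Sum>m\<in>F. c m * monom_val a m) = (0::complex)" "m \<in> F"
  shows "c m = 0"
  using assms
proof (induction F arbitrary: c m rule: finite_induct)
  case (insert n F)
  have F: "c k = 0" if "k \<in> F" for k
  proof -
    from that insert have "k \<noteq> n" by auto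
    then obtain b where b: "monom_val b k \<noteq> (monom_val b n :: complex)"
      using monom_val_inj by blast
    \<comment> \<open>Translate the relation by \<open>b\<close> and subtract
      \<open>monom_val b n\<close> times the original one: the term at \<open>n\<close> cancels and
      a relation over \<open>F\<close> remains.\<close>
    have "c k * (monom_val b k - monom_val b n) = 0"
    proof (rule insert.IH[where m = k and c = "\<lambda>k. c k * (monom_val b k - monom_val b n)"])
      fix a
      have "(\<Sum>m\<in>F. c m * (monom_val b m - monom_val b n) * monom_val a m)
          = (\<Sum>m\<in>insert n F. c m * (monom_val b m - monom_val b n) * monom_val a m)"
        using insert.hyps by simp
      also have "\<dots> = (\<Sum>m\<in>insert n F. c m * monom_val (\<lambda>i. b i * a i) m)
           - monom_val b n * (\<Sum>m\<in>insert n F. c m * monom_val a m)"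
        unfolding sum_distrib_left sum_subtractf[symmetric] monom_val_mult
        by (rule sum.cong) (auto simp: algebra_simps)
      also have "\<dots> = 0"
        using insert.prems(1)[of a] insert.prems(1)[of "\<lambda>i. b i * a i"]
        by (simp del: sum.insert)
      finally show "(\<Sum>m\<in>F. c m * (monom_val b m - monom_val b n) * monom_val a m) = 0" .
    qed (use that in auto)
    with b show ?thesis by simp
  qed
  have "c n * monom_val (\<lambda>_. 1) n = 0"
    using insert.prems(1)[of "\<lambda>_. 1"] insert.hyps F by simp
  then have "c n = 0" by (simp add: monom_val_def)
  with F insert.prems show ?case by auto
qed simp

lemma poly_eq_zeroI:
  assumes "\<And>a. poly_val a p = 0"
  shows "p = 0"
proof -
  have "Poly_Mapping.lookup p m = 0" if "m \<in> Poly_Mapping.keys p" for m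
    by (rule monom_val_independent[of "Poly_Mapping.keys p"])
      (use assms that in \<open>auto simp: poly_val_def\<close>)
  then show ?thesis by (intro poly_mapping_eqI) (auto simp: in_keys_iff)
qed

section \<open>A Groebner basis of the ideal \<open>J\<close>\<close>

lemma relations_subset: "relations var \<subseteq> polys {3..14}"
  unfolding relations_def Let_def
  by (intro insert_subsetI empty_subsetI polys_add polys_diff polys_mult polys_power polys_uminus
      polys_numeral polys_var) simp_all

lemma J_ideal: "ideal J (poly_alg {3..14})"
  unfolding J_def
  by (rule ring.genideal_ideal[OF cring.axioms(1)[OF cring_poly_alg] relations_subset])

lemma relations_subset_J: "relations var \<subseteq> J"
  unfolding J_def
  by (rule ring.genideal_self[OF cring.axioms(1)[OF cring_poly_alg] relations_subset])

lemma J_subset: "J \<subseteq> polys {3..14}"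
  using ideal.Icarr[OF J_ideal] by auto

lemma J_add: "p \<in> J \<Longrightarrow> q \<in> J \<Longrightarrow> p + q \<in> J"
  using additive_subgroup.a_closed[OF ideal.axioms(1)[OF J_ideal]] by simp

lemma J_zero: "0 \<in> J"
  using additive_subgroup.zero_closed[OF ideal.axioms(1)[OF J_ideal]] by simp

lemma J_mult: "p \<in> polys {3..14} \<Longrightarrow> q \<in> J \<Longrightarrow> p * q \<in> J"
  using ideal.I_l_closed[OF J_ideal] by simp

lemma J_uminus: "p \<in> J \<Longrightarrow> - p \<in> J"
  using J_mult[OF polys_Const[of "- 1"], of p] by (simp add: single_uminus)

section \<open>Leading exponents and division with remainder\<close>

type_synonym exps = "nat \<times> nat \<times> nat \<times> nat \<times> nat \<times> nat"

fun mixed_monom :: "(nat \<Rightarrow> 'r::comm_ring_1) \<Rightarrow> exps \<Rightarrow> 'r" where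
  "mixed_monom a (i, j, k, l, m, n) = a 4 ^ i * a 7 ^ j * a 8 ^ k * a 11 ^ l * a 12 ^ m * a 13 ^ n"

text \<open>An ad hoc grading of the mixed variables. The ordinary degree cannot single out a
  leading term, since the relations are homogeneous: the first basis element contains both
  \<open>a 4 ^ 3\<close> and \<open>a 7 * a 8\<close>. The numbers only have to make the chosen
  exponent of each basis element strictly heaviest.\<close>

fun weight :: "exps \<Rightarrow> nat" where
  "weight (i, j, k, l, m, n) = 5 * i + 6 * j + 6 * k + 6 * l + 9 * m + 6 * n"

text \<open>An entry \<open>(c, d, t)\<close> stands for the element \<open>c\<close> times the monomial with exponents \<open>d\<close>, plus the
  terms of \<open>t\<close>. Its leading exponent \<open>d\<close> has larger weight than all exponents in \<open>t\<close>, and the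
  coefficients in \<open>t\<close> only involve the pure power sums \<open>a\<^sub>3, a\<^sub>6, a\<^sub>1\<^sub>0, a\<^sub>5, a\<^sub>9, a\<^sub>1\<^sub>4\<close>.\<close>

definition groebner_basis :: "(nat \<Rightarrow> 'r::comm_ring_1) \<Rightarrow> (int \<times> exps \<times> ('r \<times> exps) list) list" where
  "groebner_basis a = [
    (1, (3, 0, 0, 0, 0, 0), [
      (- a 3 * a 5, (1, 0, 0, 0, 0, 0)), (a 6 * a 9, (0, 0, 0, 0, 0, 0)),
      (- 1, (0, 1, 1, 0, 0, 0)), (2 * a 3, (0, 0, 0, 0, 0, 1)), (- 4, (1, 0, 0, 0, 1, 0)),
      (2 * a 5, (0, 0, 0, 1, 0, 0))]),
    (-2, (0, 2, 0, 0, 0, 0), [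
      (a 3, (2, 0, 0, 0, 0, 0)), (2 * a 5 * a 10 - a 3^2 * a 5, (0, 0, 0, 0, 0, 0)),
      (2 * a 6, (0, 0, 1, 0, 0, 0)), (2 * a 3, (0, 0, 0, 0, 1, 0)), (- 4, (1, 0, 0, 1, 0, 0))]),
    (-2, (0, 0, 2, 0, 0, 0), [
      (a 5, (2, 0, 0, 0, 0, 0)), (2 * a 3 * a 14 - a 3 * a 5^2, (0, 0, 0, 0, 0, 0)),
      (2 * a 9, (0, 1, 0, 0, 0, 0)), (2 * a 5, (0, 0, 0, 0, 1, 0)), (- 4, (1, 0, 0, 0, 0, 1))]),
    (-24, (0, 0, 1, 0, 0, 1), [
      (- 4 * a 9, (2, 0, 0, 0, 0, 0)), (a 3 * a 5 * a 9, (0, 0, 0, 0, 0, 0)),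
      (12 * a 14 - 3 * a 5^2, (0, 1, 0, 0, 0, 0)), (6 * a 5, (1, 0, 1, 0, 0, 0)),
      (12 * a 9, (0, 0, 0, 0, 1, 0))]),
    (-24, (0, 1, 0, 1, 0, 0), [
      (- 4 * a 6, (2, 0, 0, 0, 0, 0)), (a 3 * a 5 * a 6, (0, 0, 0, 0, 0, 0)),
      (12 * a 10 - 3 * a 3^2, (0, 0, 1, 0, 0, 0)), (6 * a 3, (1, 1, 0, 0, 0, 0)),
      (12 * a 6, (0, 0, 0, 0, 1, 0))]),
    (-12, (0, 0, 1, 0, 1, 0), [
      (- 2 * a 3 * a 9, (1, 0, 0, 0, 0, 0)), (3 * a 3 * a 5, (0, 0, 1, 0, 0, 0)),
      (4 * a 6 * a 14 - a 5^2 * a 6, (0, 0, 0, 0, 0, 0)), (8 * a 9, (0, 0, 0, 1, 0, 0))]),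
    (-12, (0, 1, 0, 0, 1, 0), [
      (- 2 * a 5 * a 6, (1, 0, 0, 0, 0, 0)), (3 * a 3 * a 5, (0, 1, 0, 0, 0, 0)),
      (4 * a 9 * a 10 - a 3^2 * a 9, (0, 0, 0, 0, 0, 0)), (8 * a 6, (0, 0, 0, 0, 0, 1))]),
    (-12, (2, 0, 1, 0, 0, 0), [
      (- 3 * a 3 * a 5, (0, 0, 1, 0, 0, 0)), (4 * a 3 * a 9, (1, 0, 0, 0, 0, 0)),
      (18 * a 5, (1, 1, 0, 0, 0, 0)), (12 * a 6 * a 14 - 7 * a 5^2 * a 6, (0, 0, 0, 0, 0, 0)),
      (- 24, (0, 1, 0, 0, 0, 1)), (12, (0, 0, 1, 0, 1, 0))]),
    (-12, (2, 1, 0, 0, 0, 0), [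
      (- 3 * a 3 * a 5, (0, 1, 0, 0, 0, 0)), (4 * a 5 * a 6, (1, 0, 0, 0, 0, 0)),
      (18 * a 3, (1, 0, 1, 0, 0, 0)), (12 * a 9 * a 10 - 7 * a 3^2 * a 9, (0, 0, 0, 0, 0, 0)),
      (- 24, (0, 0, 1, 1, 0, 0)), (12, (0, 1, 0, 0, 1, 0))]),
    (-24, (0, 0, 0, 0, 0, 2), [
      (- 6 * a 14 - 3 * a 5^2, (2, 0, 0, 0, 0, 0)),
      (3 * a 3 * a 5^3 + 2 * a 3 * a 9^2 - 6 * a 3 * a 5 * a 14, (0, 0, 0, 0, 0, 0)),
      (2 * a 5 * a 9, (0, 1, 0, 0, 0, 0)), (- 4 * a 9, (1, 0, 1, 0, 0, 0)),
      (24 * a 14 - 12 * a 5^2, (0, 0, 0, 0, 1, 0)), (24 * a 5, (1, 0, 0, 0, 0, 1))]),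
    (-24, (0, 0, 0, 2, 0, 0), [
      (- 6 * a 10 - 3 * a 3^2, (2, 0, 0, 0, 0, 0)),
      (3 * a 3^3 * a 5 + 2 * a 5 * a 6^2 - 6 * a 3 * a 5 * a 10, (0, 0, 0, 0, 0, 0)),
      (2 * a 3 * a 6, (0, 0, 1, 0, 0, 0)), (- 4 * a 6, (1, 1, 0, 0, 0, 0)),
      (24 * a 10 - 12 * a 3^2, (0, 0, 0, 0, 1, 0)), (24 * a 3, (1, 0, 0, 1, 0, 0))]),
    (12, (2, 0, 0, 0, 0, 1), [
      (3 * a 3 * a 5^2 - 9 * a 3 * a 14, (1, 0, 0, 0, 0, 0)), (- 3 * a 5, (3, 0, 0, 0, 0, 0)),
      (2 * a 3 * a 9, (0, 0, 1, 0, 0, 0)), (- 4 * a 9, (1, 1, 0, 0, 0, 0)),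
      (2 * a 5 * a 6 * a 9, (0, 0, 0, 0, 0, 0)), (- 3 * a 5, (1, 0, 0, 0, 1, 0)),
      (3 * a 3 * a 5, (0, 0, 0, 0, 0, 1)), (12 * a 14 - 3 * a 5^2, (0, 0, 0, 1, 0, 0)),
      (- 12, (0, 0, 0, 0, 1, 1))]),
    (12, (2, 0, 0, 1, 0, 0), [
      (3 * a 3^2 * a 5 - 9 * a 5 * a 10, (1, 0, 0, 0, 0, 0)), (- 3 * a 3, (3, 0, 0, 0, 0, 0)),
      (2 * a 5 * a 6, (0, 1, 0, 0, 0, 0)), (- 4 * a 6, (1, 0, 1, 0, 0, 0)),
      (2 * a 3 * a 6 * a 9, (0, 0, 0, 0, 0, 0)), (- 3 * a 3, (1, 0, 0, 0, 1, 0)),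
      (3 * a 3 * a 5, (0, 0, 0, 1, 0, 0)), (12 * a 10 - 3 * a 3^2, (0, 0, 0, 0, 0, 1)),
      (- 12, (0, 0, 0, 1, 1, 0))]),
    (12, (0, 0, 0, 0, 2, 0), [
      (- 6 * a 3 * a 5, (0, 0, 0, 0, 1, 0)),
      (3 * a 3^2 * a 14 + 3 * a 5^2 * a 10 - 12 * a 10 * a 14, (0, 0, 0, 0, 0, 0)),
      (- 4 * a 3 * a 9, (0, 1, 0, 0, 0, 0)), (12, (1, 1, 1, 0, 0, 0)),
      (- 4 * a 5 * a 6, (0, 0, 1, 0, 0, 0)), (- 4 * a 6 * a 9, (1, 0, 0, 0, 0, 0))]),
    (2, (2, 0, 0, 0, 1, 0), [
      (4 * a 10 * a 14 - a 3^2 * a 14 - a 5^2 * a 10, (0, 0, 0, 0, 0, 0)),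
      (4 * a 3 * a 5, (0, 0, 0, 0, 1, 0)), (2 * a 3 * a 9, (0, 1, 0, 0, 0, 0)),
      (- 6, (1, 1, 1, 0, 0, 0)), (2 * a 5 * a 6, (0, 0, 1, 0, 0, 0)),
      (- 2 * a 3, (1, 0, 0, 0, 0, 1)), (- 2 * a 5, (1, 0, 0, 1, 0, 0)),
      (8, (0, 0, 0, 1, 0, 1)), (- 12, (0, 0, 0, 0, 2, 0)), (2 * a 6 * a 9, (1, 0, 0, 0, 0, 0))]),
    (24, (1, 0, 0, 0, 1, 1), [
      (- 2 * a 3 * a 9, (1, 0, 1, 0, 0, 0)), (3 * a 3 * a 5, (0, 0, 2, 0, 0, 0)),
      (4 * a 6 * a 14 - a 5^2 * a 6, (0, 0, 1, 0, 0, 0)), (8 * a 9, (0, 0, 1, 1, 0, 0)),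
      (- 6 * a 5, (2, 0, 0, 0, 1, 0)), (6 * a 3 * a 5^2 - 12 * a 3 * a 14, (0, 0, 0, 0, 1, 0)),
      (- 12 * a 9, (0, 1, 0, 0, 1, 0)), (- 12 * a 5, (0, 0, 0, 0, 2, 0))]),
    (24, (1, 0, 0, 1, 1, 0), [
      (- 2 * a 5 * a 6, (1, 1, 0, 0, 0, 0)), (3 * a 3 * a 5, (0, 2, 0, 0, 0, 0)),
      (4 * a 9 * a 10 - a 3^2 * a 9, (0, 1, 0, 0, 0, 0)), (8 * a 6, (0, 1, 0, 0, 0, 1)),
      (- 6 * a 3, (2, 0, 0, 0, 1, 0)), (6 * a 3^2 * a 5 - 12 * a 5 * a 10, (0, 0, 0, 0, 1, 0)),
      (- 12 * a 6, (0, 0, 1, 0, 1, 0)), (- 12 * a 3, (0, 0, 0, 0, 2, 0))])]"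

definition groebner_poly :: "(nat \<Rightarrow> 'r::comm_ring_1) \<Rightarrow> int \<times> exps \<times> ('r \<times> exps) list \<Rightarrow> 'r" where
  "groebner_poly a = (\<lambda>(c, d, t). of_int c * mixed_monom a d + (\<Sum>(p, m)\<leftarrow>t. p * mixed_monom a m))"

text \<open>Thirteen basis elements are original relations with their terms regrouped. The
  combinations of \<open>s1\<close>, \<open>s2\<close>, \<open>s3\<close> isolate the leading terms
  in \<open>a 12 ^ 2\<close> and \<open>a 4 ^ 2 * a 12\<close> by cancelling \<open>a 4 ^ 4\<close>.
  The last two are S-polynomials: the multiples of \<open>t3\<close> and \<open>t1\<close> share the
  term in \<open>a 8 ^ 2 * a 12\<close>, those of \<open>r3\<close> and \<open>r1\<close> the term
  in \<open>a 7 ^ 2 * a 12\<close>.\<close>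

lemma groebner_basis_combinations:
  fixes a :: "nat \<Rightarrow> 'r::comm_ring_1"
  shows "\<exists>r1 r2 r3 r4 r5 r6 t1 t2 t3 t4 t5 t6 s1 s2 s3.
    relations a = {r1, r2, r3, r4, r5, r6, t1, t2, t3, t4, t5, t6, s1, s2, s3} \<and>
    map (groebner_poly a) (groebner_basis a) = [
      s1, r1, t1, t2, r2, t3, r3, t6, r6, t4, r4, r5, t5, s3 + (- 2) * s2 + (- 4 * a 4) * s1, s2
      + (2 * a 4) * s1, a 8 * t3 + (- 6 * a 12) * t1, a 7 * r3 + (- 6 * a 12) * r1]"
  unfolding relations_def Let_def
  by (intro exI conjI, rule refl)
    (simp only: groebner_basis_def groebner_poly_def list.map prod.case mixed_monom.simps list.inject
      simp_thms sum_list.Cons sum_list.Nil of_int_numeral of_int_neg_numeral of_int_1 power_0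
      power_one_right mult_1_left mult_1_right add_0_right,
      (intro conjI; simp add: algebra_simps power2_eq_square power3_eq_cube))

lemma groebner_poly_in_J:
  assumes "g \<in> set (groebner_basis var)"
  shows "groebner_poly var g \<in> J"
  using groebner_basis_combinations[of var]
proof (elim exE conjE)
  fix r1 r2 r3 r4 r5 r6 t1 t2 t3 t4 t5 t6 s1 s2 s3
  assume rel: "relations var = {r1, r2, r3, r4, r5, r6, t1, t2, t3, t4, t5, t6, s1, s2, s3}"
    and map: "map (groebner_poly var) (groebner_basis var) = [
      s1, r1, t1, t2, r2, t3, r3, t6, r6, t4, r4, r5, t5, s3 + (- 2) * s2 + (- 4 * var 4) * s1, s2
      + (2 * var 4) * s1, var 8 * t3 + (- 6 * var 12) * t1, var 7 * r3 + (- 6 * var 12) * r1]"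
  have "{r1, r2, r3, r4, r5, r6, t1, t2, t3, t4, t5, t6, s1, s2, s3} \<subseteq> J"
    using relations_subset_J rel by simp
  then have "set (map (groebner_poly var) (groebner_basis var)) \<subseteq> J"
    unfolding map list.set insert_subset
    by (intro conjI empty_subsetI J_add J_mult polys_mult polys_uminus polys_numeral polys_var)
      simp_all
  with assms show ?thesis by auto
qed

definition pure_vars :: "nat set" where
  "pure_vars = {3, 5, 6, 9, 10, 14}"

lemma groebner_basis_weights:
  assumes "(c, d, t) \<in> set (groebner_basis var)"
  shows "c \<noteq> 0" "(p, m) \<in> set t \<Longrightarrow> p \<in> polys pure_vars \<and> weight m < weight d"
proof -
  have pure: "var i \<in> polys pure_vars" if "i \<in> {3, 5, 6, 9, 10, 14}" for i
    using that by (simp add: pure_vars_def)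
  have "\<forall>(c, d, t) \<in> set (groebner_basis var). c \<noteq> 0 \<and>
      (\<forall>(p, m) \<in> set t. p \<in> polys pure_vars \<and> weight m < weight d)"
    unfolding groebner_basis_def
    by (simp add: pure polys_add polys_diff polys_mult polys_power polys_uminus)
  from bspec[OF this assms] show "c \<noteq> 0" "(p, m) \<in> set t \<Longrightarrow> p \<in> polys pure_vars \<and> weight m < weight d"
    by blast+
qed

text \<open>The exponents divisible by none of the leading exponents. Their number is the rank of
  the diagonal invariants over the pure power sums.\<close>

definition std_exps :: "exps set" where
  "std_exps = {
    (0, 0, 0, 0, 0, 0), (1, 0, 0, 0, 0, 0), (0, 1, 0, 0, 0, 0), (0, 0, 1, 0, 0, 0),
    (2, 0, 0, 0, 0, 0), (0, 0, 0, 1, 0, 0), (0, 0, 0, 0, 1, 0), (0, 0, 0, 0, 0, 1),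
    (1, 1, 0, 0, 0, 0), (1, 0, 1, 0, 0, 0), (1, 0, 0, 1, 0, 0), (1, 0, 0, 0, 1, 0),
    (1, 0, 0, 0, 0, 1), (0, 1, 1, 0, 0, 0), (0, 1, 0, 0, 0, 1), (0, 0, 1, 1, 0, 0),
    (1, 1, 1, 0, 0, 0), (0, 0, 0, 1, 1, 0), (0, 0, 0, 1, 0, 1), (0, 0, 0, 0, 1, 1),
    (1, 1, 0, 0, 0, 1), (1, 0, 1, 1, 0, 0), (1, 0, 0, 1, 0, 1), (0, 0, 0, 1, 1, 1)}"

lemma finite_std_exps: "finite std_exps"
  by (simp add: std_exps_def)

lemma mixed_monom_add: "mixed_monom a (d + e) = mixed_monom a d * mixed_monom a e"
  by (cases d; cases e) (simp add: power_add mult_ac)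

lemma weight_add: "weight (d + e) = weight d + weight e"
  by (cases d; cases e) simp

lemma std_exps_or_reducible:
  "e \<in> std_exps \<or> (\<exists>(c, d, t) \<in> set (groebner_basis var). \<exists>e'. e = d + e')"
proof -
  obtain i j k l m n where e: "e = (i, j, k, l, m, n)" by (cases e) auto
  have split: "\<exists>e'. e = (i0, j0, k0, l0, m0, n0) + e'"
    if "i0 \<le> i" "j0 \<le> j" "k0 \<le> k" "l0 \<le> l" "m0 \<le> m" "n0 \<le> n" for i0 j0 k0 l0 m0 n0
    using that e by (intro exI[of _ "(i - i0, j - j0, k - k0, l - l0, m - m0, n - n0)"]) auto
  have lead: "(fst \<circ> snd) ` set (groebner_basis var) = {(3, 0, 0, 0, 0, 0), (0, 2, 0, 0, 0, 0),
      (0, 0, 2, 0, 0, 0), (0, 0, 1, 0, 0, 1), (0, 1, 0, 1, 0, 0), (0, 0, 1, 0, 1, 0),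
      (0, 1, 0, 0, 1, 0), (2, 0, 1, 0, 0, 0), (2, 1, 0, 0, 0, 0), (0, 0, 0, 0, 0, 2),
      (0, 0, 0, 2, 0, 0), (2, 0, 0, 0, 0, 1), (2, 0, 0, 1, 0, 0), (0, 0, 0, 0, 2, 0),
      (2, 0, 0, 0, 1, 0), (1, 0, 0, 0, 1, 1), (1, 0, 0, 1, 1, 0)}" (is "_ = ?lead")
    by (simp add: groebner_basis_def)
  have "e \<in> std_exps" if nred: "\<forall>d \<in> (fst \<circ> snd) ` set (groebner_basis var). \<nexists>e'. e = d + e'"
  proof -
    have nlead: "\<forall>(i0, j0, k0, l0, m0, n0) \<in> ?lead.
        \<not> (i0 \<le> i \<and> j0 \<le> j \<and> k0 \<le> k \<and> l0 \<le> l \<and> m0 \<le> m \<and> n0 \<le> n)"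
    proof
      fix d assume d: "d \<in> ?lead"
      obtain i0 j0 k0 l0 m0 n0 where t: "d = (i0, j0, k0, l0, m0, n0)" by (cases d) auto
      have "\<not> (i0 \<le> i \<and> j0 \<le> j \<and> k0 \<le> k \<and> l0 \<le> l \<and> m0 \<le> m \<and> n0 \<le> n)"
        using split[of i0 j0 k0 l0 m0 n0] bspec[OF nred[unfolded lead] d] unfolding t by iprover
      then show "case d of (i0, j0, k0, l0, m0, n0) \<Rightarrow>
          \<not> (i0 \<le> i \<and> j0 \<le> j \<and> k0 \<le> k \<and> l0 \<le> l \<and> m0 \<le> m \<and> n0 \<le> n)"
        unfolding t prod.case .
    qed
    from nlead have *: "case (i0, j0, k0, l0, m0, n0) of (i0, j0, k0, l0, m0, n0) \<Rightarrow>
        \<not> (i0 \<le> i \<and> j0 \<le> j \<and> k0 \<le> k \<and> l0 \<le> l \<and> m0 \<le> m \<and> n0 \<le> n)"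
      if "(i0, j0, k0, l0, m0, n0) \<in> ?lead" for i0 j0 k0 l0 m0 n0
      using that by (rule bspec)
    \<comment> \<open>The pure powers among the leading exponents bound every coordinate, so that
      only 3 * 2^5 = 96 exponents are left to inspect.\<close>
    have "i \<in> {0, 1, 2}" using *[of 3 0 0 0 0 0] by auto
    moreover have "j \<in> {0, 1}" using *[of 0 2 0 0 0 0] by auto
    moreover have "k \<in> {0, 1}" using *[of 0 0 2 0 0 0] by auto
    moreover have "l \<in> {0, 1}" using *[of 0 0 0 2 0 0] by auto
    moreover have "m \<in> {0, 1}" using *[of 0 0 0 0 2 0] by auto
    moreover have "n \<in> {0, 1}" using *[of 0 0 0 0 0 2] by auto
    moreover have "\<forall>i\<in>{0, 1, 2}. \<forall>j\<in>{0, 1}. \<forall>k\<in>{0, 1}. \<forall>l\<in>{0, 1}. \<forall>m\<in>{0, 1}. \<forall>n\<in>{0, 1}.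
        (\<forall>(i0, j0, k0, l0, m0, n0) \<in> ?lead.
          \<not> (i0 \<le> i \<and> j0 \<le> j \<and> k0 \<le> k \<and> l0 \<le> l \<and> m0 \<le> m \<and> n0 \<le> n)) \<longrightarrow>
        (i, j, k, l, m, n) \<in> std_exps"
      by (simp add: std_exps_def)
    ultimately show ?thesis
      using nlead unfolding e by (simp only: simp_thms)
  qed
  then show ?thesis
  proof (cases "e \<in> std_exps")
    case False
    with \<open>(\<forall>d \<in> (fst \<circ> snd) ` set (groebner_basis var). \<nexists>e'. e = d + e') \<Longrightarrow> e \<in> std_exps\<close>
    obtain d e' where d: "d \<in> (fst \<circ> snd) ` set (groebner_basis var)" and e': "e = d + e'"
      by blast
    then obtain g where "g \<in> set (groebner_basis var)" "d = fst (snd g)" by auto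
    with e' show ?thesis
      unfolding case_prod_beta by blast
  qed simp
qed

text \<open>The module spanned modulo \<open>J\<close> by the standard monomials over the pure power
  sums. Nothing is asked about uniqueness of \<open>c\<close>; independence enters later through
  values at points.\<close>

definition reducible_polys :: "cpoly set" where
  "reducible_polys = {x. \<exists>c. (\<forall>e\<in>std_exps. c e \<in> polys pure_vars) \<and>
    x - (\<Sum>e\<in>std_exps. c e * mixed_monom var e) \<in> J}"

lemma pure_vars_subset: "polys pure_vars \<subseteq> polys {3..14}"
  by (rule polys_mono) (simp add: pure_vars_def)

lemma reducible_cong:
  assumes "x \<in> reducible_polys" "y - x \<in> J"
  shows "y \<in> reducible_polys"
proof -
  from assms(1) obtain c where c: "\<forall>e\<in>std_exps. c e \<in> polys pure_vars"
    "x - (\<Sum>e\<in>std_exps. c e * mixed_monom var e) \<in> J"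
    by (auto simp: reducible_polys_def)
  have "(y - x) + (x - (\<Sum>e\<in>std_exps. c e * mixed_monom var e)) \<in> J"
    using assms(2) c(2) by (rule J_add)
  then show ?thesis
    using c(1) by (auto simp: reducible_polys_def)
qed

lemma reducible_zero: "0 \<in> reducible_polys"
  unfolding reducible_polys_def by (auto intro!: exI[of _ "\<lambda>_. 0"] J_zero)

lemma reducible_add:
  assumes "x \<in> reducible_polys" "y \<in> reducible_polys"
  shows "x + y \<in> reducible_polys"
proof -
  from assms(1) obtain c where c: "\<forall>e\<in>std_exps. c e \<in> polys pure_vars"
      "x - (\<Sum>e\<in>std_exps. c e * mixed_monom var e) \<in> J"
    by (auto simp: reducible_polys_def)
  from assms(2) obtain d where d: "\<forall>e\<in>std_exps. d e \<in> polys pure_vars"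
      "y - (\<Sum>e\<in>std_exps. d e * mixed_monom var e) \<in> J"
    by (auto simp: reducible_polys_def)
  have "x + y - (\<Sum>e\<in>std_exps. (c e + d e) * mixed_monom var e)
      = (x - (\<Sum>e\<in>std_exps. c e * mixed_monom var e)) + (y - (\<Sum>e\<in>std_exps. d e * mixed_monom var e))"
    by (simp add: distrib_right sum.distrib)
  with J_add[OF c(2) d(2)] have "x + y - (\<Sum>e\<in>std_exps. (c e + d e) * mixed_monom var e) \<in> J"
    by (simp only:)
  moreover have "\<forall>e\<in>std_exps. c e + d e \<in> polys pure_vars"
    using c(1) d(1) polys_add by blast
  ultimately show ?thesis
    unfolding reducible_polys_def mem_Collect_eq by (intro exI[of _ "\<lambda>e. c e + d e"] conjI)
qed

lemma reducible_mult:
  assumes "p \<in> polys pure_vars" "x \<in> reducible_polys"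
  shows "p * x \<in> reducible_polys"
proof -
  from assms obtain c where c: "\<forall>e\<in>std_exps. c e \<in> polys pure_vars"
      "x - (\<Sum>e\<in>std_exps. c e * mixed_monom var e) \<in> J"
    by (auto simp: reducible_polys_def)
  have "p * x - (\<Sum>e\<in>std_exps. (p * c e) * mixed_monom var e)
      = p * (x - (\<Sum>e\<in>std_exps. c e * mixed_monom var e))"
    by (simp add: right_diff_distrib sum_distrib_left mult.assoc)
  moreover have "p * (x - (\<Sum>e\<in>std_exps. c e * mixed_monom var e)) \<in> J"
    using assms(1) pure_vars_subset c(2) by (intro J_mult) auto
  ultimately show ?thesis
    using c assms(1) by (auto simp: reducible_polys_def intro!: exI[of _ "\<lambda>e. p * c e"])
qed

lemma reducible_std: "e \<in> std_exps \<Longrightarrow> mixed_monom var e \<in> reducible_polys"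
proof -
  assume e: "e \<in> std_exps"
  have "(\<Sum>d\<in>std_exps. (if d = e then 1 else 0) * mixed_monom var d)
      = (\<Sum>d\<in>std_exps. if d = e then mixed_monom var d else 0)"
    by (rule sum.cong) auto
  also have "\<dots> = mixed_monom var e"
    using e finite_std_exps by simp
  finally show ?thesis
    unfolding reducible_polys_def by (auto intro!: exI[of _ "\<lambda>d. if d = e then 1 else 0"] J_zero)
qed

text \<open>One division step: multiply the basis element with leading exponent \<open>d\<close> by
  the monomial of \<open>e'\<close> and solve for the monomial of \<open>d + e'\<close>, the integer
  \<open>c\<close> being invertible over the complex numbers. All other terms have smaller weight,
  and the pure coefficients do not affect the weight, so the recursion ends.\<close>

lemma reducible_mixed_monom: "mixed_monom var e \<in> reducible_polys"
proof (induction "weight e" arbitrary: e rule: less_induct)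
  case less
  show ?case
  proof (cases "e \<in> std_exps")
    case False
    then obtain c d t e' where g: "(c, d, t) \<in> set (groebner_basis var)" and e: "e = d + e'"
      using std_exps_or_reducible[of e] by blast
    have mixed: "mixed_monom var e' \<in> polys {3..14}"
      by (cases e') (auto intro!: polys_mult polys_power)
    have "p * mixed_monom var (m + e') \<in> reducible_polys" if "(p, m) \<in> set t" for p m
      using groebner_basis_weights(2)[OF g that] less e
      by (intro reducible_mult) (auto simp: weight_add)
    then have tail: "(\<Sum>(p, m)\<leftarrow>t. p * mixed_monom var (m + e')) \<in> reducible_polys"
      by (induction t) (auto intro: reducible_zero reducible_add)
    have "mixed_monom var e' * groebner_poly var (c, d, t) \<in> J"
      by (intro J_mult groebner_poly_in_J g mixed)
    also have "mixed_monom var e' * groebner_poly var (c, d, t)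
        = of_int c * mixed_monom var e + (\<Sum>(p, m)\<leftarrow>t. p * mixed_monom var (m + e'))"
      unfolding groebner_poly_def e prod.case distrib_left mixed_monom_add
      by (induction t) (auto simp: algebra_simps)
    finally have "Const (1 / of_int c) * (of_int c * mixed_monom var e
        + (\<Sum>(p, m)\<leftarrow>t. p * mixed_monom var (m + e'))) \<in> J"
      by (intro J_mult) auto
    moreover have "Const (1 / of_int c) * of_int c = 1"
      using groebner_basis_weights(1)[OF g] by (simp add: mult_single flip: single_of_int)
    ultimately have "mixed_monom var e
        - Const (- 1 / of_int c) * (\<Sum>(p, m)\<leftarrow>t. p * mixed_monom var (m + e')) \<in> J"
      by (simp add: distrib_left single_uminus flip: mult.assoc)
    then show ?thesis
      by (rule reducible_cong[rotated]) (intro reducible_mult tail polys_Const)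
  qed (rule reducible_std)
qed

theorem polys_subset_reducible: "polys {3..14} \<subseteq> reducible_polys"
proof
  fix q assume q: "q \<in> polys {3..14}"
  have "Poly_Mapping.single m c \<in> reducible_polys" if "Poly_Mapping.keys m \<subseteq> {3..14}" for m c
  proof -
    let ?l = "Poly_Mapping.lookup m"
    have set: "{3..14::nat} = {3, 4, 5, 6, 7, 8, 9, 10, 11, 12, 13, 14}"
      unfolding set_eq_iff atLeastAtMost_iff insert_iff empty_iff by presburger
    \<comment> \<open>The six pure variables move into the coefficient; the other six form a mixed
      monomial.\<close>
    have "Poly_Mapping.single m c
        = (Const c * (var 3 ^ ?l 3 * var 5 ^ ?l 5 * var 6 ^ ?l 6 * var 9 ^ ?l 9 * var 10 ^ ?l 10
            * var 14 ^ ?l 14)) * mixed_monom var (?l 4, ?l 7, ?l 8, ?l 11, ?l 12, ?l 13)"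
      by (subst single_eq_prod_var, subst monom_val_superset[OF _ that]) (simp_all add: set mult_ac)
    also have "\<dots> \<in> reducible_polys"
      by (intro reducible_mult reducible_mixed_monom polys_mult polys_power polys_Const polys_var)
        (simp_all add: pure_vars_def)
    finally show ?thesis .
  qed
  note single = this
  have "(\<Sum>m\<in>A. Poly_Mapping.single m (f m)) \<in> reducible_polys"
    if "finite A" "\<forall>m\<in>A. Poly_Mapping.keys m \<subseteq> {3..14}" for A f
    using that by (induction A rule: finite_induct) (auto intro: reducible_zero reducible_add single)
  from this[of "Poly_Mapping.keys q" "Poly_Mapping.lookup q"] q show "q \<in> reducible_polys"
    by (auto simp: polys_iff simp flip: poly_mapping_eq_sum_single)
qed

section \<open>Independence of the standard monomials\<close>

definition bidegree :: "nat \<Rightarrow> nat \<times> nat" where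
  "bidegree i = [(1, 0), (0, 1), (2, 0), (1, 1), (0, 2), (3, 0), (2, 1), (1, 2), (0, 3),
    (4, 0), (3, 1), (2, 2), (1, 3), (0, 4)] ! (i - 1)"

text \<open>Stated over any commutative ring because it is evaluated at integers in the matrix
  certificate, at polynomials along a line, and at complex numbers.\<close>

definition moment :: "'r::comm_ring_1 list \<Rightarrow> 'r list \<Rightarrow> nat \<Rightarrow> 'r" where
  "moment as bs i = (\<Sum>(a, b)\<leftarrow>zip as bs. a ^ fst (bidegree i) * b ^ snd (bidegree i))"

definition traceless_list :: "'r::comm_ring_1 list \<Rightarrow> bool" where
  "traceless_list as \<longleftrightarrow> length as = 4 \<and> sum_list as = 0"

lemma traceless_listE:
  assumes "traceless_list as"
  obtains a1 a2 a3 a4 where "as = [a1, a2, a3, a4]" "a1 + a2 + a3 + a4 = 0"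
  using assms
  by (auto simp: traceless_list_def numeral_eq_Suc length_Suc_conv add_ac)

lemma bidegree_simps [simp]:
  "bidegree 3 = (2, 0)" "bidegree 4 = (1, 1)" "bidegree 5 = (0, 2)" "bidegree 6 = (3, 0)"
  "bidegree 7 = (2, 1)" "bidegree 8 = (1, 2)" "bidegree 9 = (0, 3)" "bidegree 10 = (4, 0)"
  "bidegree 11 = (3, 1)" "bidegree 12 = (2, 2)" "bidegree 13 = (1, 3)" "bidegree 14 = (0, 4)"
  by (simp_all add: bidegree_def)

text \<open>Sum-zero vectors in the coordinates in which the symmetric group acts by signed permutations;
  the moments become sparse.\<close>

definition cube_coords :: "'r::comm_ring_1 \<Rightarrow> 'r \<Rightarrow> 'r \<Rightarrow> 'r list" where
  "cube_coords u v w = [u + v + w, u - v - w, - u + v - w, - u - v + w]"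

lemma traceless_cube_coords:
  assumes "traceless_list (as :: complex list)"
  shows "\<exists>u v w. as = cube_coords u v w"
  using assms
proof (rule traceless_listE)
  fix a1 a2 a3 a4 assume as: "as = [a1, a2, a3, a4]" "a1 + a2 + a3 + a4 = 0"
  have "a4 = (a1 + a2 + a3 + a4) - a1 - a2 - a3" by simp
  then have a4: "a4 = - a1 - a2 - a3" unfolding as(2) by simp
  have "as = cube_coords ((a1 + a2) / 2) ((a1 + a3) / 2) (- (a2 + a3) / 2)"
    unfolding as(1) a4 cube_coords_def by (simp add: field_simps)
  then show ?thesis by blast
qed

lemma moment_cube_coords:
  fixes u v w x y z :: "'r::comm_ring_1"
  defines "m \<equiv> moment (cube_coords u v w) (cube_coords x y z)"
  shows "m 3 = 4 * (u^2 + v^2 + w^2)" "m 4 = 4 * (u * x + v * y + w * z)"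
    "m 5 = 4 * (x^2 + y^2 + z^2)" "m 6 = 24 * (u * v * w)"
    "m 7 = 8 * (u * v * z + u * w * y + v * w * x)" "m 8 = 8 * (u * y * z + v * x * z + w * x * y)"
    "m 9 = 24 * (x * y * z)"
    "m 10 = 4 * (u^4 + v^4 + w^4) + 24 * (u^2 * v^2 + u^2 * w^2 + v^2 * w^2)"
    "m 11 = 4 * (u^3 * x + v^3 * y + w^3 * z)
      + 12 * (u^2 * (v * y + w * z) + v^2 * (u * x + w * z) + w^2 * (u * x + v * y))"
    "m 12 = 4 * (u^2 * x^2 + v^2 * y^2 + w^2 * z^2)
      + 4 * (u^2 * (y^2 + z^2) + v^2 * (x^2 + z^2) + w^2 * (x^2 + y^2))
      + 16 * (u * v * x * y + u * w * x * z + v * w * y * z)"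
    "m 13 = 4 * (u * x^3 + v * y^3 + w * z^3)
      + 12 * (x^2 * (v * y + w * z) + y^2 * (u * x + w * z) + z^2 * (u * x + v * y))"
    "m 14 = 4 * (x^4 + y^4 + z^4) + 24 * (x^2 * y^2 + x^2 * z^2 + y^2 * z^2)"
  unfolding m_def by (simp_all add: moment_def cube_coords_def)
    (simp_all add: algebra_simps power2_eq_square power3_eq_cube power4_eq_xxxx)

text \<open>Nine identities suffice: exchanging the two lists turns \<open>r1\<close> to
  \<open>r6\<close> into \<open>t1\<close> to \<open>t6\<close>. In the cube coordinates each
  becomes a polynomial identity in six free variables, with the condition of zero sum already built
  in.\<close>

lemma moment_relations:
  fixes as bs :: "complex list"
  assumes "traceless_list as" "traceless_list bs"
  defines "m \<equiv> moment as bs"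
  shows
    "m 3 * ((m 4)^2 - m 3 * m 5) - 2 * ((m 7)^2 - m 6 * m 8) + 2 * (m 3 * m 12 - 2 * m 4 * m 11 +
      m 5 * m 10) = 0"
    "-m 6 * (4 * (m 4)^2 - m 3 * m 5) - 3 * m 3 * (m 3 * m 8 - 2 * m 4 * m 7) + 12 * (m 6 * m 12
      - 2 * m 7 * m 11 + m 8 * m 10) = 0"
    "-2 * m 4 * m 5 * m 6 + 3 * m 3 * m 5 * m 7 - (m 3)^2 * m 9 + 4 * (2 * m 6 * m 13 - 3 * m 7 *
      m 12 + m 9 * m 10) = 0"
    "-6 * m 10 * ((m 4)^2 + m 3 * m 5) - 3 * (m 3)^2 * ((m 4)^2 - m 3 * m 5) + 2 * m 6 * (m 3 * m
      8 - 2 * m 4 * m 7 + m 5 * m 6) - 12 * m 3 * (m 3 * m 12 - 2 * m 4 * m 11) + 24 * (m 10 * m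
      12 - (m 11)^2) = 0"
    "3 * m 4 * m 5 * (m 3 * m 5 - (m 4)^2) + 2 * (m 3 * m 8 * m 9 - 2 * m 4 * m 7 * m 9 + m 5 * m
      6 * m 9) - 3 * m 4 * (m 5 * m 12 - 4 * m 4 * m 13 + 3 * m 3 * m 14) + 3 * m 5 * (m 3 * m 13
      - m 5 * m 11) + 12 * (m 11 * m 14 - m 12 * m 13) = 0"
    "-3 * m 7 * (4 * (m 4)^2 + m 3 * m 5) + 4 * m 4 * m 5 * m 6 + 18 * m 3 * m 4 * m 8 - 7 * (m
      3)^2 * m 9 + 12 * (m 9 * m 10 - 2 * m 8 * m 11 + m 7 * m 12) = 0"
    "m 4 * ((m 4)^2 - m 3 * m 5) + (m 6 * m 9 - m 7 * m 8) + 2 * (m 3 * m 13 - 2 * m 4 * m 12 + m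
      5 * m 11) = 0"
    "2 * (m 4)^2 * (m 3 * m 5 - (m 4)^2) - m 3 * (m 3 * m 14 - 2 * m 5 * m 12) + 2 * (m 3 * m 7 *
      m 9 - 2 * m 4 * m 7 * m 8 + m 5 * m 6 * m 8) - m 5 * (m 5 * m 10 - 2 * m 3 * m 12) - 2 * m 4
      * (3 * m 3 * m 13 - 5 * m 4 * m 12 + 3 * m 5 * m 11) + 4 * (m 10 * m 14 + 2 * m 11 * m 13 -
      3 * (m 12)^2) = 0"
    "2 * m 12 * (2 * (m 4)^2 + m 3 * m 5) + m 3 * (m 3 * m 14 - 4 * m 4 * m 13) + m 5 * (m 5 * m
      10 - 4 * m 4 * m 11) - 4 * (m 10 * m 14 - 4 * m 11 * m 13 + 3 * (m 12)^2) = 0"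
  using assms(1,2)[THEN traceless_cube_coords]
  by (elim exE; simp only: m_def moment_cube_coords;
      simp add: algebra_simps power2_eq_square power3_eq_cube power4_eq_xxxx)+

lemma moment_swap:
  assumes "traceless_list as" "traceless_list bs"
  shows "moment bs as 3 = moment as bs 5" "moment bs as 4 = moment as bs 4"
    "moment bs as 5 = moment as bs 3" "moment bs as 6 = moment as bs 9"
    "moment bs as 7 = moment as bs 8" "moment bs as 8 = moment as bs 7"
    "moment bs as 9 = moment as bs 6" "moment bs as 10 = moment as bs 14"
    "moment bs as 11 = moment as bs 13" "moment bs as 12 = moment as bs 12"
    "moment bs as 13 = moment as bs 11" "moment bs as 14 = moment as bs 10"
  using assms by (auto elim!: traceless_listE simp: moment_def mult.commute)

lemma relations_moment:
  assumes "traceless_list as" "traceless_list bs" "r \<in> relations (moment as bs)"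
  shows "r = (0::complex)"
proof -
  note swapped = moment_relations[OF assms(2,1), unfolded moment_swap[OF assms(1,2)]]
  show ?thesis
    using assms(3) unfolding relations_def Let_def insert_iff empty_iff
    apply (elim disjE FalseE)
    apply (erule trans, rule moment_relations[OF assms(1,2)])+
    apply (erule trans, rule swapped[THEN trans[rotated]], simp add: algebra_simps; fail)+
    done
qed

lemma poly_val_relations: "poly_val a ` relations var = relations a"
  unfolding relations_def Let_def by (simp only: image_insert image_empty poly_val_add poly_val_diff
      poly_val_mult poly_val_power poly_val_uminus poly_val_numeral poly_val_var)

lemma a_inv_poly_alg: "p \<in> polys I \<Longrightarrow> \<ominus>\<^bsub>poly_alg I\<^esub> p = - p"
  by (rule abelian_group.minus_equality)
    (auto intro: abelian_group.intro cring.axioms ring.is_abelian_group[OF cring.axioms(1)[OF cring_poly_alg]])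

text \<open>The easy inclusion: the polynomials vanishing at a given centred pair form an ideal that
  contains the fifteen relations.\<close>

lemma poly_val_J:
  assumes "traceless_list as" "traceless_list bs" "q \<in> J"
  shows "poly_val (moment as bs) q = 0"
proof -
  interpret cring "poly_alg {3..14}" by (rule cring_poly_alg)
  let ?I = "{q \<in> polys {3..14}. poly_val (moment as bs) q = 0}"
  have "ideal ?I (poly_alg {3..14})"
  proof (rule idealI[OF ring_axioms])
    show "subgroup ?I (add_monoid (poly_alg {3..14}))"
    proof (rule subgroup.intro)
      fix q assume "q \<in> ?I"
      moreover have "inv\<^bsub>add_monoid (poly_alg {3..14})\<^esub> q = - q" if "q \<in> polys {3..14}"
        using a_inv_poly_alg[OF that] by (simp only: a_inv_def)
      ultimately show "inv\<^bsub>add_monoid (poly_alg {3..14})\<^esub> q \<in> ?I"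
        by (simp only: mem_Collect_eq polys_uminus poly_val_uminus neg_equal_0_iff_equal simp_thms)
    qed auto
  qed (auto intro: polys_mult)
  moreover have "relations var \<subseteq> ?I"
    using relations_subset relations_moment[OF assms(1,2)] poly_val_relations[of "moment as bs"]
    by blast
  ultimately have "J \<subseteq> ?I"
    unfolding J_def by (rule genideal_minimal)
  with assms(3) show ?thesis by auto
qed

subsection \<open>Independence at one point\<close>

definition perms4 :: "nat list list" where
  "perms4 = [
    [0, 1, 2, 3], [0, 1, 3, 2], [0, 2, 1, 3], [0, 2, 3, 1], [0, 3, 1, 2], [0, 3, 2, 1],
    [1, 0, 2, 3], [1, 0, 3, 2], [1, 2, 0, 3], [1, 2, 3, 0], [1, 3, 0, 2], [1, 3, 2, 0],
    [2, 0, 1, 3], [2, 0, 3, 1], [2, 1, 0, 3], [2, 1, 3, 0], [2, 3, 0, 1], [2, 3, 1, 0],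
    [3, 0, 1, 2], [3, 0, 2, 1], [3, 1, 0, 2], [3, 1, 2, 0], [3, 2, 0, 1], [3, 2, 1, 0]]"

definition std_list :: "exps list" where
  "std_list = [
    (0, 0, 0, 0, 0, 0), (1, 0, 0, 0, 0, 0), (0, 1, 0, 0, 0, 0), (0, 0, 1, 0, 0, 0),
    (2, 0, 0, 0, 0, 0), (0, 0, 0, 1, 0, 0), (0, 0, 0, 0, 1, 0), (0, 0, 0, 0, 0, 1),
    (1, 1, 0, 0, 0, 0), (1, 0, 1, 0, 0, 0), (1, 0, 0, 1, 0, 0), (1, 0, 0, 0, 1, 0),
    (1, 0, 0, 0, 0, 1), (0, 1, 1, 0, 0, 0), (0, 1, 0, 0, 0, 1), (0, 0, 1, 1, 0, 0),
    (1, 1, 1, 0, 0, 0), (0, 0, 0, 1, 1, 0), (0, 0, 0, 1, 0, 1), (0, 0, 0, 0, 1, 1),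
    (1, 1, 0, 0, 0, 1), (1, 0, 1, 1, 0, 0), (1, 0, 0, 1, 0, 1), (0, 0, 0, 1, 1, 1)]"

text \<open>A left inverse, up to a nonzero scalar in each row, of the matrix of the values of the standard
  monomials at the pairs \<open>(x, x\<^sub>\<sigma>)\<close> with \<open>x = (1, -1, 2, -2)\<close>.\<close>

definition left_inverse :: "int list list" where
  "left_inverse = [
    [-1300, 1156, 670, -850, -850, 1030, 1156, -1300, -850, 1030, 670, -850, -850, 670, 1030,
    -850, -769, 1075, 1030, -850, -850, 670, 1075, -769],
    [3755, 1853, -170, -850, -850, -3570, -1853, -3755, 850, 3570, 170, 850, 850, 170, -3570,
    -850, 3604, 0, 3570, 850, -850, -170, 0, -3604],
    [0, 0, -27, 3, -9, 1, 0, 0, 9, -1, 27, -3, 3, -27, -1, 9, 0, 0, 1, -9, -3, 27, 0, 0],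
    [0, 0, -27, -9, 3, 1, 0, 0, 3, 1, -27, -9, 9, 27, -1, -3, 0, 0, -1, -3, 9, 27, 0, 0],
    [-425, 425, 758, -578, -578, 398, 425, -425, -578, 398, 758, -578, -578, 758, 398, -578,
    -200, 200, 398, -578, -578, 758, 200, -200],
    [-3125, -1635, 182, 654, 846, 2862, 1635, 3125, -846, -2862, -182, -654, -654, -182, 2862,
    846, -2680, -300, -2862, -846, 654, 182, 300, 2680],
    [1075, -931, -526, 706, 706, -886, -931, 1075, 706, -886, -526, 706, 706, -526, -886, 706,
    706, -850, -886, 706, 706, -526, -850, 706],
    [-3125, -1635, 182, 846, 654, 2862, 1635, 3125, -654, -2862, -182, -846, -846, -182, 2862,
    654, -2680, 300, -2862, -654, 846, 182, -300, 2680],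
    [0, 0, -81, -43, 89, 67, 0, 0, 89, 67, -81, -43, 43, 81, -67, -89, 0, 0, -67, -89, 43, 81,
    0, 0],
    [0, 0, -81, 89, -43, 67, 0, 0, 43, -67, 81, -89, 89, -81, -67, 43, 0, 0, 67, -43, -89, 81,
    0, 0],
    [85, -85, -103, 67, 103, -67, -85, 85, 103, -67, -103, 67, 67, -103, -67, 103, 40, -40, -67,
    103, 67, -103, -40, 40],
    [385, 327, -70, -150, -150, -270, -327, -385, 150, 270, 70, 150, 150, 70, -270, -150, 164,
    0, 270, 150, -150, -70, 0, -164],
    [85, -85, -103, 103, 67, -67, -85, 85, 67, -67, -103, 103, 103, -103, -67, 67, 40, -40, -67,
    67, 103, -103, -40, 40],
    [125, 75, 28, -24, -24, -108, -75, -125, 24, 108, -28, 24, 24, -28, -108, -24, 100, 0, 108,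
    24, -24, 28, 0, -100],
    [0, 0, 9, 7, -9, -7, 0, 0, -9, -7, 9, 7, -7, -9, 7, 9, 0, 0, 7, 9, -7, -9, 0, 0],
    [0, 0, 9, -9, 7, -7, 0, 0, -7, 7, -9, 9, -9, 9, 7, -7, 0, 0, -7, 7, 9, -9, 0, 0],
    [-133, 101, 88, -92, -92, 128, 101, -133, -92, 128, 88, -92, -92, 88, 128, -92, -124, 92,
    128, -92, -92, 88, 92, -124],
    [22, 10, -1, -3, -7, -21, -10, -22, 7, 21, 1, 3, 3, 1, -21, -7, 20, 4, 21, 7, -3, -1, -4,
    -20],
    [-1, 1, 0, 0, 0, 0, 1, -1, 0, 0, 0, 0, 0, 0, 0, 0, 1, -1, 0, 0, 0, 0, -1, 1],
    [22, 10, -1, -7, -3, -21, -10, -22, 3, 21, 1, 7, 7, 1, -21, -3, 20, -4, 21, 3, -7, -1, 4,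
    -20],
    [0, 0, 3, -3, 1, -1, 0, 0, -1, 1, -3, 3, -3, 3, 1, -1, 0, 0, -1, 1, 3, -3, 0, 0],
    [0, 0, 3, 1, -3, -1, 0, 0, -3, -1, 3, 1, -1, -3, 1, 3, 0, 0, 1, 3, -1, -3, 0, 0],
    [-10, -6, 1, 3, 3, 9, 6, 10, -3, -9, -1, -3, -3, -1, 9, 3, -8, 0, -9, -3, 3, 1, 0, 8],
    [-1, 1, 1, -1, -1, 1, 1, -1, -1, 1, 1, -1, -1, 1, 1, -1, -1, 1, 1, -1, -1, 1, 1, -1]]"

definition left_inverse_diag :: "int list" where
  "left_inverse_diag = [
    324, 1728, 768, 768, 10368, 5184, 5184, 5184, 2304, 2304, 5184, 10368, 5184, 10368, 1728,
    1728, 10368, 1728, 576, 1728, 3456, 3456, 5184, 5184]"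

definition permute :: "nat list \<Rightarrow> 'a list \<Rightarrow> 'a list" where
  "permute s bs = map ((!) bs) s"

text \<open>Rows are permutations, columns standard monomials. The four entries of the point must be
  distinct, as a repeated entry would make two permuted lists, and hence two rows, equal.\<close>

definition point_matrix :: "int list list" where
  "point_matrix = map (\<lambda>s. map (mixed_monom (moment [1, -1, 2, -2] (permute s [1, -1, 2, -2]))) std_list) perms4"

text \<open>An exact integer certificate of invertibility. Scaling each row of the inverse clears
  its denominators, which leaves a diagonal matrix with nonzero entries in place of the
  identity.\<close>

lemma left_inverse_point_matrix:
  "map (\<lambda>row. map (\<lambda>k. \<Sum>(x, r)\<leftarrow>zip row point_matrix. x * r ! k) [0..<24]) left_inverse
    = map (\<lambda>j. map (\<lambda>k. if j = k then left_inverse_diag ! j else 0) [0..<24]) [0..<24]"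
  by code_simp

lemma left_inverse_diag_nonzero: "j < 24 \<Longrightarrow> left_inverse_diag ! j \<noteq> 0"
proof -
  have "\<forall>x\<in>set left_inverse_diag. x \<noteq> 0" "length left_inverse_diag = 24"
    by (simp_all add: left_inverse_diag_def)
  then show "j < 24 \<Longrightarrow> left_inverse_diag ! j \<noteq> 0"
    using nth_mem by metis
qed

lemma left_inverse_sum:
  assumes "j < 24" "k < 24"
  shows "(\<Sum>i<24. left_inverse ! j ! i * point_matrix ! i ! k)
    = (if j = k then left_inverse_diag ! j else 0)"
proof -
  have len: "length left_inverse = 24" "\<forall>row\<in>set left_inverse. length row = 24"
    "length point_matrix = 24"
    by (simp_all add: left_inverse_def point_matrix_def perms4_def)
  then have row: "length (left_inverse ! j) = 24"
    using assms(1) by simp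
  have "(\<Sum>(x, r)\<leftarrow>zip (left_inverse ! j) point_matrix. x * r ! k)
      = (\<Sum>i<24. left_inverse ! j ! i * point_matrix ! i ! k)"
    by (simp add: sum_list_sum_nth row len atLeast0LessThan)
  moreover have "(\<Sum>(x, r)\<leftarrow>zip (left_inverse ! j) point_matrix. x * r ! k)
      = (if j = k then left_inverse_diag ! j else 0)"
    using arg_cong[OF left_inverse_point_matrix, of "\<lambda>m. m ! j ! k"] assms len by simp
  ultimately show ?thesis by simp
qed

text \<open>Applied to evaluation of polynomials at a point and to the embedding of the integers, so
  that the line argument and the integer certificate speak about the same moments.\<close>

lemma moment_hom:
  fixes h :: "'a::comm_ring_1 \<Rightarrow> 'b::comm_ring_1"
  assumes "h 0 = 0" "h 1 = 1" "\<And>x y. h (x + y) = h x + h y" "\<And>x y. h (x * y) = h x * h y"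
  shows "moment (map h as) (map h bs) = (\<lambda>i. h (moment as bs i))"
proof
  have pow: "h (x ^ n) = h x ^ n" for x n
    by (induction n) (auto simp: assms)
  have "(\<Sum>(a, b)\<leftarrow>map (map_prod h h) ps. a ^ m * b ^ n) = h (\<Sum>(a, b)\<leftarrow>ps. a ^ m * b ^ n)" for ps m n
    by (induction ps) (auto simp: assms pow)
  then show "moment (map h as) (map h bs) i = h (moment as bs i)" for i
    by (simp add: moment_def zip_map_map map_prod_def)
qed

lemma moment_poly:
  "moment (map (\<lambda>p. poly p t) as) (map (\<lambda>p. poly p t) bs) = (\<lambda>i. poly (moment as bs i) t)"
  by (rule moment_hom) simp_all

lemma moment_of_int: "moment (map of_int as) (map of_int bs) = (\<lambda>i. of_int (moment as bs i))"
  by (rule moment_hom) simp_all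

lemma mixed_monom_hom:
  fixes h :: "'a::comm_ring_1 \<Rightarrow> 'b::comm_ring_1"
  assumes "h 1 = 1" "\<And>x y. h (x * y) = h x * h y"
  shows "mixed_monom (\<lambda>i. h (a i)) e = h (mixed_monom a e)"
proof -
  have "h (x ^ n) = h x ^ n" for x n
    by (induction n) (auto simp: assms)
  then show ?thesis by (cases e) (simp add: assms)
qed

lemma mixed_monom_poly: "mixed_monom (\<lambda>i. poly (a i) t) e = poly (mixed_monom a e) t"
  by (rule mixed_monom_hom) simp_all

lemma mixed_monom_of_int: "mixed_monom (\<lambda>i. of_int (a i)) e = of_int (mixed_monom a e)"
  by (rule mixed_monom_hom) simp_all

lemma permute_map: "set s \<subseteq> {..<length bs} \<Longrightarrow> permute s (map h bs) = map h (permute s bs)"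
  by (auto simp: permute_def)

lemma set_perms4: "s \<in> set perms4 \<Longrightarrow> set s \<subseteq> {..<4}"
  by (auto simp: perms4_def)

lemma point_independent:
  fixes c :: "exps \<Rightarrow> complex"
  assumes zero: "\<And>s. s \<in> set perms4 \<Longrightarrow> (\<Sum>e\<in>std_exps.
      c e * mixed_monom (moment [1, -1, 2, -2] (permute s [1, -1, 2, -2])) e) = 0"
    and "e \<in> std_exps"
  shows "c e = 0"
proof -
  have len: "length std_list = 24" "length perms4 = 24"
    by (simp_all add: std_list_def perms4_def)
  have std: "set std_list = std_exps"
    unfolding std_list_def std_exps_def list.set ..
  have "distinct std_list"
    by (simp add: std_list_def)
  then have bij: "bij_betw ((!) std_list) {..<24} std_exps"
    using bij_betw_nth[of std_list "{..<24}" std_exps] len std by simp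
  obtain j where j: "j < 24" "e = std_list ! j"
    using assms(2) std len by (metis in_set_conv_nth)
  have entry: "mixed_monom (moment [1, -1, 2, -2] (permute (perms4 ! i) [1, -1, 2, -2])) (std_list ! k)
      = complex_of_int (point_matrix ! i ! k)" if "i < 24" "k < 24" for i k
  proof -
    let ?s = "perms4 ! i" and ?L = "[1, - 1, 2, - 2] :: int list"
    have "length ?L = 4" by simp
    then have "permute ?s (map complex_of_int ?L) = map of_int (permute ?s ?L)"
      using set_perms4[of ?s] that len by (intro permute_map) (simp del: list.size)
    then have "moment (map complex_of_int ?L) (permute ?s (map complex_of_int ?L))
        = (\<lambda>l. of_int (moment ?L (permute ?s ?L) l))"
      by (simp only: moment_of_int)
    then have "moment [1, - 1, 2, - 2] (permute ?s [1, - 1, 2, - 2])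
        = (\<lambda>l. complex_of_int (moment ?L (permute ?s ?L) l))"
      by simp
    then have "mixed_monom (moment [1, - 1, 2, - 2] (permute ?s [1, - 1, 2, - 2])) (std_list ! k)
        = complex_of_int (mixed_monom (moment ?L (permute ?s ?L)) (std_list ! k))"
      by (simp only: mixed_monom_of_int)
    then show ?thesis
      using that len by (simp add: point_matrix_def)
  qed
  have row: "(\<Sum>k<24. c (std_list ! k) * complex_of_int (point_matrix ! i ! k)) = 0" if "i < 24" for i
    using zero[of "perms4 ! i"] that len entry[OF that]
    by (simp add: sum.reindex_bij_betw[OF bij, symmetric])
  have "0 = (\<Sum>i<24. complex_of_int (left_inverse ! j ! i)
      * (\<Sum>k<24. c (std_list ! k) * complex_of_int (point_matrix ! i ! k)))"
    by (simp add: row)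
  also have "\<dots> = (\<Sum>k<24. c (std_list ! k)
      * complex_of_int (\<Sum>i<24. left_inverse ! j ! i * point_matrix ! i ! k))"
    unfolding of_int_sum of_int_mult sum_distrib_left by (subst sum.swap) (simp add: mult_ac)
  also have "\<dots> = (\<Sum>k<24. if j = k then c (std_list ! k) * complex_of_int (left_inverse_diag ! j) else 0)"
    by (rule sum.cong) (simp_all add: left_inverse_sum[OF j(1)])
  also have "\<dots> = c e * complex_of_int (left_inverse_diag ! j)"
    using j by simp
  finally show ?thesis
    using left_inverse_diag_nonzero[OF j(1)] by simp
qed

subsection \<open>From one point to all points\<close>

text \<open>A nonzero vector of polynomials annihilated by the matrix would have a nonzero lowest
  coefficient vector, annihilated by the value of the matrix at \<open>0\<close>.\<close>

lemma poly_vector_eq_zero: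
  fixes r :: "'a \<Rightarrow> complex poly" and M :: "'b \<Rightarrow> 'a \<Rightarrow> complex poly"
  assumes zero: "\<And>s. s \<in> P \<Longrightarrow> (\<Sum>e\<in>S. r e * M s e) = 0"
    and ker: "\<And>c e. (\<And>s. s \<in> P \<Longrightarrow> (\<Sum>e\<in>S. c e * poly (M s e) 0) = 0) \<Longrightarrow> e \<in> S \<Longrightarrow> c e = 0"
    and "e \<in> S"
  shows "r e = 0"
proof -
  have "\<forall>e\<in>S. coeff (r e) n = 0" for n
  proof (induction n rule: less_induct)
    case (less n)
    have "(\<Sum>e\<in>S. coeff (r e) n * poly (M s e) 0) = 0" if "s \<in> P" for s
    proof -
      have "coeff (r e * M s e) n = coeff (r e) n * poly (M s e) 0" if "e \<in> S" for e
      proof -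
        \<comment> \<open>By induction the coefficients of \<open>r e\<close> below \<open>n\<close>
          vanish, so a single term of the convolution survives.\<close>
        have "coeff (r e * M s e) n = (\<Sum>i\<le>n. if i = n then coeff (r e) n * coeff (M s e) 0 else 0)"
          unfolding coeff_mult by (rule sum.cong) (use less that in \<open>auto simp: le_less\<close>)
        then show ?thesis by (simp add: poly_0_coeff_0)
      qed
      then show ?thesis
        using arg_cong[OF zero[OF that], of "\<lambda>p. coeff p n"] by (simp add: coeff_sum)
    qed
    then show ?case using ker[where c = "\<lambda>e. coeff (r e) n"] by blast
  qed
  with assms(3) show ?thesis by (intro poly_eqI) simp
qed

lemma poly_val_along_line:
  fixes a :: "nat \<Rightarrow> complex poly"
  shows "\<exists>r. \<forall>t. poly r t = poly_val (\<lambda>i. poly (a i) t) q"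
proof -
  have "q \<in> polys UNIV" by (simp add: polys_iff)
  then show ?thesis
  proof (induction q rule: polys_induct)
    case (Const c)
    show ?case by (intro exI[of _ "[:c:]"]) simp
  next
    case (var i)
    show ?case by (intro exI[of _ "a i"]) simp
  next
    case (add p q)
    then show ?case by (metis poly_add poly_val_add)
  next
    case (mult p q)
    then show ?case by (metis poly_mult poly_val_mult)
  qed
qed

lemma moment_permute:
  assumes "length as = 4" "length bs = 4" "s \<in> set perms4" "i \<in> pure_vars"
  shows "moment as (permute s bs) i = moment as bs i"
proof -
  from assms(1,2) obtain a1 a2 a3 a4 b1 b2 b3 b4 where "as = [a1, a2, a3, a4]" "bs = [b1, b2, b3, b4]"
    by (auto simp: numeral_eq_Suc length_Suc_conv)
  then show ?thesis
    using assms(3,4) by (auto simp: perms4_def pure_vars_def moment_def permute_def add_ac)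
qed

lemma traceless_permute:
  assumes "traceless_list bs" "s \<in> set perms4"
  shows "traceless_list (permute s bs)"
  using assms(1)
proof (rule traceless_listE)
  fix b1 b2 b3 b4 assume "bs = [b1, b2, b3, b4]" "b1 + b2 + b3 + b4 = 0"
  then show ?thesis
    using assms(2) by (auto simp: perms4_def traceless_list_def permute_def algebra_simps)
qed

text \<open>On the line from the special pair of quadruples at \<open>t = 0\<close> to the given pair at \<open>t = 1\<close>, the
  coefficients and the monomials become polynomials in \<open>t\<close>.\<close>

lemma coefficients_vanish:
  assumes c: "\<And>e. e \<in> std_exps \<Longrightarrow> c e \<in> polys pure_vars"
    and zero: "\<And>as bs. traceless_list as \<Longrightarrow> traceless_list bs \<Longrightarrow>
      (\<Sum>e\<in>std_exps. poly_val (moment as bs) (c e) * mixed_monom (moment as bs) e) = 0"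
    and e: "e \<in> std_exps" and as: "traceless_list as" and bs: "traceless_list bs"
  shows "poly_val (moment as bs) (c e) = 0"
proof -
  define pt :: "complex list" where "pt = [1, -1, 2, -2]"
  define line where "line = (\<lambda>xs. map2 (\<lambda>x y. [:x, y - x:]) pt xs)"
  define ev where "ev = (\<lambda>t ps. map (\<lambda>p. poly p (t::complex)) ps)"
  have ev: "traceless_list (ev t (line xs)) \<and> ev 0 (line xs) = pt \<and> ev 1 (line xs) = xs \<and>
      length (ev t (line xs)) = 4"
    if "traceless_list xs" for t xs
    using that
  proof (rule traceless_listE)
    fix x1 x2 x3 x4 assume xs: "xs = [x1, x2, x3, x4]" "x1 + x2 + x3 + x4 = 0"
    have "sum_list (ev t (line xs)) = t * (x1 + x2 + x3 + x4)"
      unfolding xs(1) by (simp add: ev_def line_def pt_def algebra_simps)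
    then show ?thesis
      unfolding xs(2) by (simp add: traceless_list_def) (simp add: xs(1) ev_def line_def pt_def)
  qed
  note ev = ev[THEN conjunct1] ev[THEN conjunct2, THEN conjunct1]
    ev[THEN conjunct2, THEN conjunct2, THEN conjunct1] ev[THEN conjunct2, THEN conjunct2, THEN conjunct2]
  define A where "A = line as"
  define B where "B = line bs"
  have "\<exists>r. \<forall>t. poly r t = poly_val (moment (ev t A) (ev t B)) (c e)" for e
    using poly_val_along_line[of "moment A B" "c e"]
    by (simp add: ev_def moment_poly)
  then obtain r where r: "\<And>e t. poly (r e) t = poly_val (moment (ev t A) (ev t B)) (c e)"
    by metis
  define M where "M = (\<lambda>s e. mixed_monom (moment A (permute s B)) e)"
  have M: "poly (M s e) t = mixed_monom (moment (ev t A) (permute s (ev t B))) e"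
    if "s \<in> set perms4" for s e t
  proof -
    have "permute s (ev t B) = ev t (permute s B)"
      using set_perms4[OF that] ev(4)[OF bs, of 0] by (simp add: ev_def B_def permute_map)
    then show ?thesis
      by (simp add: M_def ev_def moment_poly mixed_monom_poly)
  qed
  have "r e = 0"
  proof (rule poly_vector_eq_zero[where P = "set perms4" and S = std_exps and M = M])
    fix s assume s: "s \<in> set perms4"
    have "poly (\<Sum>e\<in>std_exps. r e * M s e) t = 0" for t
    proof -
      \<comment> \<open>The coefficients involve only pure moments, which do not notice how the
        lists are paired. The same unknowns therefore occur in all 24 equations.\<close>
      have "poly_val (moment (ev t A) (ev t B)) (c e)
          = poly_val (moment (ev t A) (permute s (ev t B))) (c e)" if "e \<in> std_exps" for e
        by (rule poly_val_cong[OF c[OF that]]) (simp add: moment_permute s A_def B_def ev as bs)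
      then show ?thesis
        using zero[OF ev(1)[OF as] traceless_permute[OF ev(1)[OF bs] s], of t t]
        by (simp add: poly_sum r M[OF s] A_def B_def)
    qed
    then show "(\<Sum>e\<in>std_exps. r e * M s e) = 0"
      by (simp add: poly_all_0_iff_0[symmetric])
  next
    fix d e assume "\<And>s. s \<in> set perms4 \<Longrightarrow> (\<Sum>e\<in>std_exps. d e * poly (M s e) 0) = 0" "e \<in> std_exps"
    then show "d e = 0"
      by (intro point_independent[of d]) (simp_all add: M A_def B_def ev as bs pt_def)
  qed (rule e)
  then have "poly_val (moment (ev 1 A) (ev 1 B)) (c e) = 0"
    using r[of e 1] by simp
  then show ?thesis by (simp add: A_def B_def ev as bs)
qed

text \<open>Newton's identities with vanishing first elementary symmetric function read
  \<open>s2 = - 2 * e2\<close>, \<open>s3 = 3 * e3\<close> and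
  \<open>s4 = 2 * e2^2 - 4 * e4\<close>. They can be solved for the elementary symmetric functions,
  and the roots of the resulting quartic are the required points.\<close>

lemma power_sums_surj:
  "\<exists>as. traceless_list as \<and> (\<Sum>a\<leftarrow>as. a ^ 2) = s2 \<and> (\<Sum>a\<leftarrow>as. a ^ 3) = s3 \<and> (\<Sum>a\<leftarrow>as. a ^ 4) = (s4 :: complex)"
proof -
  define e2 e3 e4 where "e2 = - s2 / 2" "e3 = s3 / 3" "e4 = (2 * e2^2 - s4) / 4"
  define p where "p = [:e4, - e3, e2, 0, 1:]"
  have "p \<noteq> 0" "degree p = 4" "lead_coeff p = 1" by (simp_all add: p_def)
  then obtain A where A: "size A = 4" "p = (\<Prod>x\<in>#A. [:- x, 1:])"
    using alg_closed_imp_factorization[of p] by auto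
  then obtain xs where "A = mset xs" "length xs = 4"
    by (metis ex_mset size_mset)
  then obtain a b c d where "A = {#a, b, c, d#}"
    by (auto simp: numeral_eq_Suc length_Suc_conv)
  with A(2) have "p = [:- a, 1:] * [:- b, 1:] * [:- c, 1:] * [:- d, 1:]"
    by (simp only: image_mset_add_mset image_mset_empty prod_mset.add_mset prod_mset.empty mult_1_right
        mult.assoc)
  also have "\<dots> = [:a * b * c * d, - (a*b*c + a*b*d + a*c*d + b*c*d),
      a*b + a*c + a*d + b*c + b*d + c*d, - (a + b + c + d), 1:]"
    by (simp add: algebra_simps)
  finally have *: "e4 = a * b * c * d" "e3 = a*b*c + a*b*d + a*c*d + b*c*d"
    "e2 = a*b + a*c + a*d + b*c + b*d + c*d" "a + b + c + d = 0"
    unfolding p_def by (simp_all only: pCons_eq_iff neg_equal_iff_equal) (metis neg_0_equal_iff_equal)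
  have d: "d = - a - b - c"
    using *(4) by (simp add: eq_neg_iff_add_eq_0 algebra_simps)
  have "s2 = -2 * e2" "s3 = 3 * e3"
    by (simp_all add: e2_e3_e4_def)
  moreover have "s4 = 2 * e2^2 - 4 * e4"
    unfolding e2_e3_e4_def(3) by (simp add: field_simps)
  ultimately have "a^2 + b^2 + c^2 + d^2 = s2" "a^3 + b^3 + c^3 + d^3 = s3" "a^4 + b^4 + c^4 + d^4 = s4"
    unfolding * d by (simp_all add: algebra_simps power2_eq_square power3_eq_cube power4_eq_xxxx)
  then show ?thesis
    using *(4) by (intro exI[of _ "[a, b, c, d]"]) (simp add: traceless_list_def add.assoc)
qed

text \<open>The two lists are chosen independently, each realizing three prescribed power sums. So
  the six pure moments take arbitrary values, and \<open>c\<close> vanishes at every point.\<close>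

lemma pure_poly_eq_zero:
  assumes "c \<in> polys pure_vars"
    and zero: "\<And>as bs. traceless_list as \<Longrightarrow> traceless_list bs \<Longrightarrow> poly_val (moment as bs) c = 0"
  shows "c = 0"
proof (rule poly_eq_zeroI)
  fix a :: "nat \<Rightarrow> complex"
  obtain as where as: "traceless_list as" "(\<Sum>x\<leftarrow>as. x ^ 2) = a 3" "(\<Sum>x\<leftarrow>as. x ^ 3) = a 6"
    "(\<Sum>x\<leftarrow>as. x ^ 4) = a 10"
    using power_sums_surj by blast
  obtain bs where bs: "traceless_list bs" "(\<Sum>x\<leftarrow>bs. x ^ 2) = a 5" "(\<Sum>x\<leftarrow>bs. x ^ 3) = a 9"
    "(\<Sum>x\<leftarrow>bs. x ^ 4) = a 14"
    using power_sums_surj by blast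
  have "poly_val a c = poly_val (moment as bs) c"
  proof (rule poly_val_cong[OF assms(1)])
    fix i assume "i \<in> pure_vars"
    with as bs show "a i = moment as bs i"
      by (elim traceless_listE) (auto simp: pure_vars_def moment_def)
  qed
  with zero[OF as(1) bs(1)] show "poly_val a c = 0" by simp
qed

text \<open>Spanning and independence meet here: the remainder of \<open>q\<close> vanishes at all
  centred pairs because \<open>q\<close> and the elements of \<open>J\<close> do, which forces its
  coefficients to be zero.\<close>

theorem J_eq_vanishing:
  assumes q: "q \<in> polys {3..14}"
    and zero: "\<And>as bs. traceless_list as \<Longrightarrow> traceless_list bs \<Longrightarrow> poly_val (moment as bs) q = 0"
  shows "q \<in> J"
proof -
  obtain c where c: "\<forall>e\<in>std_exps. c e \<in> polys pure_vars"
    and J: "q - (\<Sum>e\<in>std_exps. c e * mixed_monom var e) \<in> J"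
    using q polys_subset_reducible by (auto simp: reducible_polys_def)
  have mixed: "poly_val a (mixed_monom var e) = mixed_monom a e" for a e
    by (cases e) simp
  have "(\<Sum>e\<in>std_exps. poly_val (moment as bs) (c e) * mixed_monom (moment as bs) e) = 0"
    if "traceless_list as" "traceless_list bs" for as bs
    using poly_val_J[OF that J] zero[OF that] by (simp add: mixed)
  then have "c e = 0" if "e \<in> std_exps" for e
    using c that by (intro pure_poly_eq_zero coefficients_vanish[of c]) auto
  then show ?thesis using J by simp
qed

section \<open>Multisymmetric functions of four pairs\<close>

definition entry_monom :: "'r::comm_ring_1 list \<Rightarrow> 'r list \<Rightarrow> nat \<times> nat \<Rightarrow> nat \<Rightarrow> 'r" where
  "entry_monom as bs e i = as ! i ^ fst e * bs ! i ^ snd e"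

text \<open>Unlike \<open>moment\<close>, it admits exponents of any degree; the aim is to reduce
  all of them to degree at most four.\<close>

definition power_sum :: "'r::comm_ring_1 list \<Rightarrow> 'r list \<Rightarrow> nat \<times> nat \<Rightarrow> 'r" where
  "power_sum as bs e = (\<Sum>i<4. entry_monom as bs e i)"

text \<open>The permanent of the 4 by 4 matrix with rows \<open>f\<close>, \<open>g\<close>,
  \<open>h\<close>, \<open>k\<close>.\<close>

definition orbit_sum :: "(nat \<Rightarrow> 'r::comm_ring_1) \<Rightarrow> (nat \<Rightarrow> 'r) \<Rightarrow> (nat \<Rightarrow> 'r) \<Rightarrow> (nat \<Rightarrow> 'r) \<Rightarrow> 'r" where
  "orbit_sum f g h k = (\<Sum>s\<leftarrow>perms4. f (s ! 0) * g (s ! 1) * h (s ! 2) * k (s ! 3))"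

lemma sum_lessThan_4: "(\<Sum>i<4. f i) = f 0 + f 1 + f 2 + f (3::nat)"
  by (simp add: eval_nat_numeral)

text \<open>Moebius inversion over the set partitions of the four slots: a block of size
  \<open>n\<close> carries the factor \<open>(-1)^(n-1) * (n-1)!\<close>, whence the coefficients 1,
  -1, 2, 1 and -6.\<close>

lemma orbit_sum_expand:
  fixes f g h k :: "nat \<Rightarrow> 'r::comm_ring_1"
  defines "p \<equiv> \<lambda>f. \<Sum>i<4. f (i::nat)"
  shows "orbit_sum f g h k = p f * p g * p h * p k
    - (p (\<lambda>i. f i * g i) * p h * p k + p (\<lambda>i. f i * h i) * p g * p k + p (\<lambda>i. f i * k i) * p g * p h
      + p (\<lambda>i. g i * h i) * p f * p k + p (\<lambda>i. g i * k i) * p f * p h + p (\<lambda>i. h i * k i) * p f * p g)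
    + 2 * (p (\<lambda>i. f i * g i * h i) * p k + p (\<lambda>i. f i * g i * k i) * p h
      + p (\<lambda>i. f i * h i * k i) * p g + p (\<lambda>i. g i * h i * k i) * p f)
    + (p (\<lambda>i. f i * g i) * p (\<lambda>i. h i * k i) + p (\<lambda>i. f i * h i) * p (\<lambda>i. g i * k i)
      + p (\<lambda>i. f i * k i) * p (\<lambda>i. g i * h i))
    - 6 * p (\<lambda>i. f i * g i * h i * k i)"
proof -
  \<comment> \<open>A permutation is determined by its first three values, so this is the sum over
    ordered triples of distinct indices. Adding a fourth index freely and removing the three
    possible coincidences gives the orbit sum.\<close>
  define t where "t = (\<lambda>f g h. \<Sum>s\<leftarrow>perms4. f (s ! 0) * g (s ! 1) * (h (s ! 2) :: 'r))"
  have t: "t f g h = p f * p g * p h - p (\<lambda>i. f i * g i) * p h - p (\<lambda>i. f i * h i) * p g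
      - p (\<lambda>i. g i * h i) * p f + 2 * p (\<lambda>i. f i * g i * h i)" for f g h
    unfolding t_def p_def perms4_def sum_lessThan_4 by (simp add: algebra_simps)
  have "orbit_sum f g h k = t f g h * p k - t (\<lambda>i. f i * k i) g h - t f (\<lambda>i. g i * k i) h
      - t f g (\<lambda>i. h i * k i)"
    unfolding t_def p_def orbit_sum_def perms4_def sum_lessThan_4 by (simp add: algebra_simps)
  then show ?thesis
    unfolding t by (simp add: algebra_simps)
qed

text \<open>The four slots exhaust the indices, so the index of \<open>l\<close> coincides with that
  of exactly one slot.\<close>

lemma orbit_sum_mult:
  fixes f g h k l :: "nat \<Rightarrow> 'r::comm_ring_1"
  shows "orbit_sum f g h k * (\<Sum>i<4. l i) = orbit_sum (\<lambda>i. f i * l i) g h k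
    + orbit_sum f (\<lambda>i. g i * l i) h k + orbit_sum f g (\<lambda>i. h i * l i) k + orbit_sum f g h (\<lambda>i. k i * l i)"
  unfolding orbit_sum_def perms4_def sum_lessThan_4
  by (simp add: algebra_simps)

text \<open>The expansion of the orbit sum without its last term, the power sum of the full
  exponent. It serves as the lower-order part in the recursion on degree.\<close>

definition orbit_sum_lower :: "(nat \<times> nat \<Rightarrow> 'r::comm_ring_1) \<Rightarrow> nat \<times> nat \<Rightarrow> nat \<times> nat \<Rightarrow> nat \<times> nat
    \<Rightarrow> nat \<times> nat \<Rightarrow> 'r" where
  "orbit_sum_lower p a b c d = p a * p b * p c * p d
    - (p (a + b) * p c * p d + p (a + c) * p b * p d + p (a + d) * p b * p c
      + p (b + c) * p a * p d + p (b + d) * p a * p c + p (c + d) * p a * p b)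
    + 2 * (p (a + b + c) * p d + p (a + b + d) * p c + p (a + c + d) * p b + p (b + c + d) * p a)
    + (p (a + b) * p (c + d) + p (a + c) * p (b + d) + p (a + d) * p (b + c))"

lemma entry_monom_add: "entry_monom as bs (d + e) = (\<lambda>i. entry_monom as bs d i * entry_monom as bs e i)"
  by (rule ext) (simp add: entry_monom_def power_add mult_ac)

lemma orbit_sum_entry_monom:
  "orbit_sum (entry_monom as bs a) (entry_monom as bs b) (entry_monom as bs c) (entry_monom as bs d)
    = orbit_sum_lower (power_sum as bs) a b c d - 6 * power_sum as bs (a + b + c + d)"
  unfolding orbit_sum_expand orbit_sum_lower_def power_sum_def entry_monom_add ..

text \<open>The polarized Newton identity in degree five: five-fold sums over distinct indices among four vanish.\<close>

lemma power_sum_reduce: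
  fixes as bs :: "'r::comm_ring_1 list"
  defines "p \<equiv> power_sum as bs"
  shows "24 * p (a + b + c + d + e) = orbit_sum_lower p (a + e) b c d + orbit_sum_lower p a (b + e) c d
    + orbit_sum_lower p a b (c + e) d + orbit_sum_lower p a b c (d + e)
    - (orbit_sum_lower p a b c d - 6 * p (a + b + c + d)) * p e"
proof -
  let ?u = "entry_monom as bs"
  have "orbit_sum (?u a) (?u b) (?u c) (?u d) * p e = orbit_sum (?u (a + e)) (?u b) (?u c) (?u d)
      + orbit_sum (?u a) (?u (b + e)) (?u c) (?u d) + orbit_sum (?u a) (?u b) (?u (c + e)) (?u d)
      + orbit_sum (?u a) (?u b) (?u c) (?u (d + e))"
    unfolding p_def power_sum_def orbit_sum_mult entry_monom_add ..
  \<comment> \<open>Each of the four orbit sums on the right contributes -6 times the power sum of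
    the full exponent, which accounts for the factor 24.\<close>
  then show ?thesis
    unfolding orbit_sum_entry_monom p_def[symmetric]
    by (simp add: add_ac)
qed

section \<open>Reduction of all power sums to the fourteen generators\<close>

definition center :: "complex list \<Rightarrow> complex list" where
  "center xs = map (\<lambda>x. x - sum_list xs / 4) xs"

definition generator :: "complex list \<Rightarrow> complex list \<Rightarrow> nat \<Rightarrow> complex" where
  "generator xs ys i = (if i = 1 then sum_list xs else if i = 2 then sum_list ys
    else moment (center xs) (center ys) i)"

definition generated :: "(complex list \<Rightarrow> complex list \<Rightarrow> complex) \<Rightarrow> bool" where
  "generated f \<longleftrightarrow> (\<exists>q\<in>polys {1..14}. \<forall>xs ys. length xs = 4 \<longrightarrow> length ys = 4 \<longrightarrow>
    f xs ys = poly_val (generator xs ys) q)"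

lemma length_center [simp]: "length (center xs) = length xs"
  by (simp add: center_def)

lemma length_4E:
  assumes "length xs = 4"
  obtains a b c d where "xs = [a, b, c, d]"
  using assms by (auto simp: numeral_eq_Suc length_Suc_conv)

lemma traceless_center: "length xs = 4 \<Longrightarrow> traceless_list (center xs)"
  by (erule length_4E) (simp add: traceless_list_def center_def field_simps)

lemma generated_const: "generated (\<lambda>_ _. c)"
  unfolding generated_def by (rule bexI[of _ "Const c"]) simp_all

lemma generated_generator: "i \<in> {1..14} \<Longrightarrow> generated (\<lambda>xs ys. generator xs ys i)"
  unfolding generated_def by (rule bexI[of _ "var i"]) simp_all

lemma generated_add:
  assumes "generated f" "generated g"
  shows "generated (\<lambda>xs ys. f xs ys + g xs ys)"
proof -
  from assms obtain p q where "p \<in> polys {1..14}" "q \<in> polys {1..14}"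
    "\<forall>xs ys. length xs = 4 \<longrightarrow> length ys = 4 \<longrightarrow> f xs ys = poly_val (generator xs ys) p"
    "\<forall>xs ys. length xs = 4 \<longrightarrow> length ys = 4 \<longrightarrow> g xs ys = poly_val (generator xs ys) q"
    unfolding generated_def by auto
  then show ?thesis
    unfolding generated_def by (intro bexI[of _ "p + q"]) auto
qed

lemma generated_mult:
  assumes "generated f" "generated g"
  shows "generated (\<lambda>xs ys. f xs ys * g xs ys)"
proof -
  from assms obtain p q where "p \<in> polys {1..14}" "q \<in> polys {1..14}"
    "\<forall>xs ys. length xs = 4 \<longrightarrow> length ys = 4 \<longrightarrow> f xs ys = poly_val (generator xs ys) p"
    "\<forall>xs ys. length xs = 4 \<longrightarrow> length ys = 4 \<longrightarrow> g xs ys = poly_val (generator xs ys) q"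
    unfolding generated_def by auto
  then show ?thesis
    unfolding generated_def by (intro bexI[of _ "p * q"]) auto
qed

lemma generated_diff:
  assumes "generated f" "generated g"
  shows "generated (\<lambda>xs ys. f xs ys - g xs ys)"
  using generated_add[OF assms(1) generated_mult[OF generated_const[of "- 1"] assms(2)]] by simp

lemmas generated_intros = generated_const generated_add generated_mult generated_diff

lemma generated_cong:
  assumes "generated f" "\<And>xs ys. length xs = 4 \<Longrightarrow> length ys = 4 \<Longrightarrow> f xs ys = g xs ys"
  shows "generated g"
  using assms unfolding generated_def by auto

lemma moment_eq_power_sum:
  assumes "length as = 4" "length bs = 4"
  shows "moment as bs i = power_sum as bs (bidegree i)"
  using assms
  by (elim length_4E) (simp add: moment_def power_sum_def entry_monom_def sum_lessThan_4 add.assoc)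

definition total :: "nat \<times> nat \<Rightarrow> nat" where
  "total e = fst e + snd e"

lemma total_add: "total (d + e) = total d + total e"
  by (simp add: total_def)

lemma split_exponent:
  assumes "total e > 0"
  shows "\<exists>d e'. total d = 1 \<and> e = d + e'"
proof (cases e)
  case (Pair m n)
  show ?thesis
  proof (cases "m > 0")
    case True
    then show ?thesis
      by (intro exI[of _ "(1, 0)"] exI[of _ "(m - 1, n)"]) (simp add: Pair total_def)
  next
    case False
    then show ?thesis using assms
      by (intro exI[of _ "(0, 1)"] exI[of _ "(m, n - 1)"]) (simp add: Pair total_def)
  qed
qed

text \<open>With a positive degree in every slot, each partial sum of the exponents has strictly
  smaller total degree than all four together.\<close>

lemma generated_orbit_sum_lower:
  assumes "\<And>e. total e < total a + total b + total c + total d \<Longrightarrow>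
      generated (\<lambda>xs ys. power_sum (center xs) (center ys) e)"
    and "total a > 0" "total b > 0" "total c > 0" "total d > 0"
  shows "generated (\<lambda>xs ys. orbit_sum_lower (power_sum (center xs) (center ys)) a b c d)"
  unfolding orbit_sum_lower_def
  by (intro generated_intros assms(1)) (use assms(2-) in \<open>simp_all add: total_add\<close>)

lemma power_sum_small:
  assumes "length as = 4" "length bs = 4"
  shows "power_sum as bs (0, 0) = 4" "power_sum as bs (1, 0) = sum_list as"
    "power_sum as bs (0, 1) = sum_list bs"
  using assms by (elim length_4E; simp add: power_sum_def entry_monom_def sum_lessThan_4 add.assoc)+

lemma generated_power_sum_small:
  assumes "total e \<le> 4"
  shows "generated (\<lambda>xs ys. power_sum (center xs) (center ys) e)"
proof -
  obtain m n where e: "e = (m, n)" by (cases e)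
  have "(\<exists>i\<in>{3..14}. bidegree i = e) \<or> e \<in> {(0, 0), (1, 0), (0, 1)}"
  proof -
    let ?B = "bidegree ` {3, 4, 5, 6, 7, 8, 9, 10, 11, 12, 13, 14} \<union> {(0, 0), (1, 0), (0, 1)}"
    have all: "\<forall>m\<in>{0, 1, 2, 3, 4}. \<forall>n\<in>{0, 1, 2, 3, 4}. m + n \<le> 4 \<longrightarrow> (m, n) \<in> ?B"
      by simp
    have "m \<in> {0, 1, 2, 3, 4}" "n \<in> {0, 1, 2, 3, 4}" "m + n \<le> 4"
      using assms by (auto simp: e total_def)
    from bspec[OF bspec[OF all this(1)] this(2), THEN mp, OF this(3)] have "e \<in> ?B"
      by (simp only: e)
    then show ?thesis
    proof
      assume "e \<in> bidegree ` {3, 4, 5, 6, 7, 8, 9, 10, 11, 12, 13, 14}"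
      then obtain i where i: "i \<in> {3, 4, 5, 6, 7, 8, 9, 10, 11, 12, 13, 14}" "e = bidegree i"
        by (rule imageE)
      from i(1) have "i \<in> {3..14}" by auto
      with i(2) show ?thesis by (intro disjI1 bexI[of _ i]) simp_all
    qed (rule disjI2)
  qed
  then show ?thesis
  proof (elim disjE bexE)
    fix i assume i: "i \<in> {3..14}" "bidegree i = e"
    show ?thesis
      by (rule generated_cong[OF generated_generator[of i]])
        (use i in \<open>auto simp: generator_def moment_eq_power_sum\<close>)
  next
    assume *: "e \<in> {(0, 0), (1, 0), (0, 1)}"
    show ?thesis
    \<comment> \<open>The exponent zero counts the four points; in degree one the power sum is zero
      by centring.\<close>
    proof (rule generated_cong[OF generated_const[of "if e = (0, 0) then 4 else 0"]])
      fix xs ys :: "complex list" assume "length xs = 4" "length ys = 4"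
      then have "traceless_list (center xs)" "traceless_list (center ys)"
        by (simp_all add: traceless_center)
      then show "(if e = (0, 0) then 4 else 0) = power_sum (center xs) (center ys) e"
        using * power_sum_small[of "center xs" "center ys"] by (auto simp: traceless_list_def)
    qed
  qed
qed

lemma generated_power_sum: "generated (\<lambda>xs ys. power_sum (center xs) (center ys) e)"
proof (induction "total e" arbitrary: e rule: less_induct)
  case less
  show ?case
  proof (cases "total e \<le> 4")
    case False
    \<comment> \<open>Four exponents of degree one are split off and the rest \<open>r\<close>
      serves as the fifth. Since \<open>r\<close> is not zero, all terms of the reduction have
      smaller degree than \<open>e\<close>.\<close>
    obtain a e1 where a: "total a = 1" "e = a + e1" using split_exponent[of e] False by auto
    obtain b e2 where b: "total b = 1" "e1 = b + e2" using split_exponent[of e1] False a by (auto simp: total_add)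
    obtain c e3 where c: "total c = 1" "e2 = c + e3" using split_exponent[of e2] False a b by (auto simp: total_add)
    obtain d r where d: "total d = 1" "e3 = d + r" using split_exponent[of e3] False a b c by (auto simp: total_add)
    have e: "e = a + b + c + d + r" by (simp add: a b c d add.assoc)
    have r: "total r > 0" "total e = 4 + total r"
      using False a b c d by (simp_all add: total_add)
    have "generated (\<lambda>xs ys. power_sum (center xs) (center ys) f)" if "total f < 4 + total r" for f
      using less that r by simp
    then have "generated (\<lambda>xs ys. (1 / 24) *
        (orbit_sum_lower (power_sum (center xs) (center ys)) (a + r) b c d
        + orbit_sum_lower (power_sum (center xs) (center ys)) a (b + r) c d
        + orbit_sum_lower (power_sum (center xs) (center ys)) a b (c + r) d
        + orbit_sum_lower (power_sum (center xs) (center ys)) a b c (d + r)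
        - (orbit_sum_lower (power_sum (center xs) (center ys)) a b c d
          - 6 * power_sum (center xs) (center ys) (a + b + c + d)) * power_sum (center xs) (center ys) r))"
      by (intro generated_intros generated_orbit_sum_lower) (simp_all add: total_add a b c d r)
    then show ?thesis
      by (rule generated_cong) (simp add: e flip: power_sum_reduce)
  qed (rule generated_power_sum_small)
qed

section \<open>Symmetrization over the four points\<close>

lemma perms4_facts:
  assumes "s \<in> set perms4"
  shows "length s = 4" "set s = {..<4}" "distinct s"
  using assms by (auto simp: perms4_def)

lemma sum_list_perm: "s \<in> set perms4 \<Longrightarrow> (\<Sum>k\<leftarrow>s. f k) = (\<Sum>k<4. f k)"
  using perms4_facts[of s] by (simp add: sum_list_distinct_conv_sum_set)

lemma sum_list_permute:
  fixes xs :: "'a::comm_monoid_add list"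
  assumes "s \<in> set perms4" "length xs = 4"
  shows "sum_list (permute s xs) = sum_list xs"
  using assms sum_list_perm[OF assms(1), of "(!) xs"]
  by (simp add: permute_def sum_list_sum_nth atLeast0LessThan)

lemma center_permute:
  assumes "s \<in> set perms4" "length xs = 4"
  shows "center (permute s xs) = permute s (center xs)"
proof -
  have "center (permute s xs) = map (\<lambda>x. x - sum_list xs / 4) (permute s xs)"
    by (simp add: center_def sum_list_permute[OF assms])
  also have "\<dots> = permute s (center xs)"
    using perms4_facts[OF assms(1)] assms(2) by (simp add: center_def permute_map)
  finally show ?thesis .
qed

lemma nth_permute: "k < length s \<Longrightarrow> permute s xs ! k = xs ! (s ! k)"
  by (simp add: permute_def)

lemma length_permute [simp]: "length (permute s xs) = length s"
  by (simp add: permute_def)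

lemma power_sum_permute:
  assumes "s \<in> set perms4"
  shows "power_sum (permute s as) (permute s bs) e = power_sum as bs e"
proof -
  have "(\<Sum>k\<leftarrow>s. entry_monom as bs e k) = (\<Sum>i<4. entry_monom as bs e (s ! i))"
    using perms4_facts[OF assms] by (simp add: sum_list_sum_nth atLeast0LessThan)
  then show ?thesis
    using perms4_facts[OF assms] sum_list_perm[OF assms, of "entry_monom as bs e"]
    by (simp add: power_sum_def entry_monom_def nth_permute)
qed

lemma generator_permute:
  assumes "s \<in> set perms4" "length xs = 4" "length ys = 4"
  shows "generator (permute s xs) (permute s ys) = generator xs ys"
proof
  fix i
  have "moment (permute s (center xs)) (permute s (center ys)) i = moment (center xs) (center ys) i"
    using assms(2,3) perms4_facts(1)[OF assms(1)] power_sum_permute[OF assms(1)]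
    by (simp add: moment_eq_power_sum)
  then show "generator (permute s xs) (permute s ys) i = generator xs ys i"
    by (simp add: generator_def sum_list_permute[OF assms(1)] center_permute[OF assms(1)] assms(2,3))
qed

lemma generated_permute:
  assumes "generated f" "s \<in> set perms4" "length xs = 4" "length ys = 4"
  shows "f (permute s xs) (permute s ys) = f xs ys"
  using assms perms4_facts[OF assms(2)] generator_permute[OF assms(2-)] unfolding generated_def by auto

text \<open>A shape on which symmetrization can be computed: the invariant factor passes through the
  sum, and the product of one monomial per point becomes an orbit sum. Every polynomial in the
  entries has this shape, an entry being its centred value plus the mean.\<close>

inductive decomposed :: "(complex list \<Rightarrow> complex list \<Rightarrow> complex) \<Rightarrow> bool" where
  product: "generated f \<Longrightarrow> decomposed (\<lambda>xs ys. f xs ys * (entry_monom (center xs) (center ys) a 0 *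
    entry_monom (center xs) (center ys) b 1 * entry_monom (center xs) (center ys) c 2 *
    entry_monom (center xs) (center ys) d 3))"
| add: "decomposed f \<Longrightarrow> decomposed g \<Longrightarrow> decomposed (\<lambda>xs ys. f xs ys + g xs ys)"

lemma decomposed_mult:
  assumes "decomposed f" "decomposed g"
  shows "decomposed (\<lambda>xs ys. f xs ys * g xs ys)"
  using assms(1)
proof induction
  case (product f a b c d)
  show ?case using assms(2)
  proof induction
    case (product f' a' b' c' d')
    have "decomposed (\<lambda>xs ys. (f xs ys * f' xs ys) * (entry_monom (center xs) (center ys) (a + a') 0 *
        entry_monom (center xs) (center ys) (b + b') 1 * entry_monom (center xs) (center ys) (c + c') 2 *
        entry_monom (center xs) (center ys) (d + d') 3))"
      using \<open>generated f\<close> \<open>generated f'\<close> by (intro decomposed.product generated_mult)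
    then show ?case by (simp add: entry_monom_add mult_ac)
  next
    case (add g h)
    then show ?case using decomposed.add[OF add.IH] by (simp add: distrib_left)
  qed
next
  case (add f h)
  then show ?case using decomposed.add[OF add.IH] by (simp add: distrib_right)
qed

lemma decomposed_generated:
  assumes "generated f"
  shows "decomposed f"
  using decomposed.product[OF assms, of 0 0 0 0] by (simp add: entry_monom_def)

lemma decomposed_center:
  assumes "i < 4"
  shows "decomposed (\<lambda>xs ys. center xs ! i)" "decomposed (\<lambda>xs ys. center ys ! i)"
proof -
  have i: "i \<in> {0, 1, 2, 3}" using assms by auto
  have *: "decomposed (\<lambda>xs ys. 1 * (entry_monom (center xs) (center ys) (if i = 0 then e else 0) 0 *
      entry_monom (center xs) (center ys) (if i = 1 then e else 0) 1 *
      entry_monom (center xs) (center ys) (if i = 2 then e else 0) 2 *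
      entry_monom (center xs) (center ys) (if i = 3 then e else 0) 3))" for e
    by (rule decomposed.product) (rule generated_const)
  show "decomposed (\<lambda>xs ys. center xs ! i)"
    using *[of "(1, 0)"] i by (auto simp: entry_monom_def)
  show "decomposed (\<lambda>xs ys. center ys ! i)"
    using *[of "(0, 1)"] i by (auto simp: entry_monom_def)
qed

text \<open>Permuting the points and summing turns the product over the points into an orbit sum,
  which is a polynomial in power sums.\<close>

lemma generated_symmetrization:
  assumes "decomposed f"
  shows "generated (\<lambda>xs ys. \<Sum>s\<leftarrow>perms4. f (permute s xs) (permute s ys))"
  using assms
proof induction
  case (product f a b c d)
  let ?u = "\<lambda>xs ys. entry_monom (center xs) (center ys)"
  have "generated (\<lambda>xs ys. f xs ys * (orbit_sum_lower (power_sum (center xs) (center ys)) a b c d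
      - 6 * power_sum (center xs) (center ys) (a + b + c + d)))"
    unfolding orbit_sum_lower_def
    by (intro generated_intros product generated_power_sum)
  then show ?case
  proof (rule generated_cong)
    fix xs ys :: "complex list" assume len: "length xs = 4" "length ys = 4"
    have "(\<Sum>s\<leftarrow>perms4. f (permute s xs) (permute s ys) * (?u (permute s xs) (permute s ys) a 0 *
          ?u (permute s xs) (permute s ys) b 1 * ?u (permute s xs) (permute s ys) c 2 *
          ?u (permute s xs) (permute s ys) d 3))
        = (\<Sum>s\<leftarrow>perms4. f xs ys * (?u xs ys a (s ! 0) * ?u xs ys b (s ! 1) * ?u xs ys c (s ! 2)
          * ?u xs ys d (s ! 3)))"
      using len perms4_facts
      by (intro arg_cong[where f = sum_list] map_cong refl)
        (simp add: generated_permute[OF product] center_permute entry_monom_def nth_permute)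
    also have "\<dots> = f xs ys * orbit_sum (?u xs ys a) (?u xs ys b) (?u xs ys c) (?u xs ys d)"
      by (simp add: orbit_sum_def sum_list_const_mult)
    finally show "f xs ys * (orbit_sum_lower (power_sum (center xs) (center ys)) a b c d
        - 6 * power_sum (center xs) (center ys) (a + b + c + d))
        = (\<Sum>s\<leftarrow>perms4. f (permute s xs) (permute s ys) * (?u (permute s xs) (permute s ys) a 0 *
          ?u (permute s xs) (permute s ys) b 1 * ?u (permute s xs) (permute s ys) c 2 *
          ?u (permute s xs) (permute s ys) d 3))"
      by (simp add: orbit_sum_entry_monom)
  qed
next
  case (add f g)
  then show ?case
    using generated_add[OF add.IH] by (simp add: sum_list_addf)
qed

text \<open>The Reynolds operator: a symmetric function equals its average over the 24
  permutations.\<close>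

theorem multisymmetric_generated:
  assumes "decomposed f"
    and sym: "\<And>s xs ys. s \<in> set perms4 \<Longrightarrow> length xs = 4 \<Longrightarrow> length ys = 4 \<Longrightarrow>
      f (permute s xs) (permute s ys) = f xs ys"
  shows "generated f"
proof (rule generated_cong[OF generated_mult[OF generated_const[of "1 / 24"]
      generated_symmetrization[OF assms(1)]]])
  fix xs ys :: "complex list" assume len: "length xs = 4" "length ys = 4"
  have "(\<Sum>s\<leftarrow>perms4. f (permute s xs) (permute s ys)) = (\<Sum>s\<leftarrow>perms4. f xs ys)"
    using sym[OF _ len] by (intro arg_cong[where f = sum_list] map_cong refl)
  also have "\<dots> = 24 * f xs ys"
    unfolding sum_list_triv by (simp add: perms4_def)
  finally show "1 / 24 * (\<Sum>s\<leftarrow>perms4. f (permute s xs) (permute s ys)) = f xs ys"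
    by simp
qed

section \<open>Simultaneous triangularization\<close>

text \<open>The vector \<open>p(T) w\<close>, expressed through iterates of the linear map.\<close>

definition krylov :: "complex^'n^'n \<Rightarrow> complex poly \<Rightarrow> complex^'n \<Rightarrow> complex^'n" where
  "krylov T p w = (\<Sum>i\<le>degree p. coeff p i *s ((*v) T ^^ i) w)"

lemma krylov_bound:
  assumes "degree p \<le> N"
  shows "krylov T p w = (\<Sum>i\<le>N. coeff p i *s ((*v) T ^^ i) w)"
  unfolding krylov_def
  by (rule sum.mono_neutral_left) (use assms in \<open>auto simp: coeff_eq_0\<close>)

lemma matrix_power_diff:
  fixes T :: "complex^'n^'n"
  shows "((*v) T ^^ i) (x - l *s y) = ((*v) T ^^ i) x - l *s ((*v) T ^^ i) y"
  by (induction i) (simp_all add: vec.diff vec.scale)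

text \<open>Lets one root of the polynomial be removed at a time, the corresponding factor acting on
  the vector first.\<close>

lemma krylov_linear_factor: "krylov T ([:- l, 1:] * q) w = krylov T q (T *v w - l *s w)"
proof -
  let ?N = "degree q" and ?T = "\<lambda>i. ((*v) T ^^ i) w"
  have "degree ([:- l, 1:] * q) \<le> Suc ?N"
    using degree_mult_le[of "[:- l, 1:]" q] by simp
  then have "krylov T ([:- l, 1:] * q) w = (\<Sum>i\<le>Suc ?N. coeff ([:- l, 1:] * q) i *s ?T i)"
    by (rule krylov_bound)
  also have "\<dots> = (\<Sum>i\<le>Suc ?N. coeff (pCons 0 q) i *s ?T i) - (\<Sum>i\<le>Suc ?N. (l * coeff q i) *s ?T i)"
    by (simp add: vec.scale_left_diff_distrib sum_subtractf del: sum.atMost_Suc)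
  also have "(\<Sum>i\<le>Suc ?N. coeff (pCons 0 q) i *s ?T i) = (\<Sum>i\<le>?N. coeff q i *s ?T (Suc i))"
    by (subst sum.atMost_Suc_shift) simp
  also have "(\<Sum>i\<le>Suc ?N. (l * coeff q i) *s ?T i) = (\<Sum>i\<le>?N. (l * coeff q i) *s ?T i)"
    by (simp add: coeff_eq_0)
  also have "(\<Sum>i\<le>?N. coeff q i *s ?T (Suc i)) - (\<Sum>i\<le>?N. (l * coeff q i) *s ?T i)
      = krylov T q (T *v w - l *s w)"
    unfolding krylov_def matrix_power_diff sum_subtractf[symmetric]
    by (rule sum.cong)
      (simp_all add: vec.scale_right_diff_distrib funpow_swap1 mult.commute)
  finally show ?thesis .
qed

text \<open>The vectors \<open>w, T w, ..., T^n w\<close> are one more than the dimension, hence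
  linearly related.\<close>

lemma krylov_annihilator:
  fixes T :: "complex^'n^'n"
  shows "\<exists>p. p \<noteq> 0 \<and> krylov T p w = 0"
proof -
  let ?N = "CARD('n)" and ?f = "\<lambda>i. ((*v) T ^^ i) w"
  have "\<exists>c. (\<exists>i\<le>?N. c i \<noteq> 0) \<and> (\<Sum>i\<le>?N. c i *s ?f i) = 0"
  proof (cases "inj_on ?f {..?N}")
    case True
    let ?S = "?f ` {..?N}"
    have "card ?S = Suc ?N"
      using True by (simp add: card_image)
    then have "vec.dependent ?S"
      using vec.independent_card_le_dim[of ?S UNIV] by (auto simp: vec.dim_UNIV card_cart_basis)
    then obtain u v where u: "v \<in> ?S" "u v \<noteq> 0" "(\<Sum>v\<in>?S. u v *s v) = 0"
      using vec.dependent_finite[of ?S] by auto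
    then show ?thesis
      by (intro exI[of _ "\<lambda>i. u (?f i)"]) (auto simp: sum.reindex[OF True])
  next
    \<comment> \<open>Dependence is a property of sets, and a repeated iterate makes the set
      smaller. The relation is then the difference of the two equal iterates.\<close>
    case False
    then obtain i j where ij: "i \<le> ?N" "j \<le> ?N" "i \<noteq> j" "?f i = ?f j"
      by (auto simp: inj_on_def)
    let ?c = "\<lambda>k. if k = i then 1 else if k = j then - 1 else 0 :: complex"
    have "(\<Sum>k\<le>?N. ?c k *s ?f k) = (\<Sum>k\<in>{i, j}. ?c k *s ?f k)"
      by (rule sum.mono_neutral_right) (use ij in auto)
    also have "\<dots> = 0"
      using ij by simp
    finally show ?thesis
      using ij(1) by (intro exI[of _ ?c]) (auto intro!: exI[of _ i])
  qed
  then obtain c i where c: "i \<le> ?N" "c i \<noteq> 0" "(\<Sum>i\<le>?N. c i *s ?f i) = 0" by blast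
  define p where "p = (\<Sum>i\<le>?N. Polynomial.monom (c i) i)"
  have coeff: "coeff p i = (if i \<le> ?N then c i else 0)" for i
    by (simp add: p_def coeff_sum)
  then have "degree p \<le> ?N"
    by (intro degree_le) simp
  then have "krylov T p w = 0"
    using c(3) by (simp add: krylov_bound coeff)
  moreover have "p \<noteq> 0"
    using c coeff[of i] by auto
  ultimately show ?thesis by blast
qed

text \<open>Apply to \<open>w\<close>, one after the other, the factors \<open>T - l\<close> of a polynomial annihilating it: the last
  vector outside \<open>V\<close> will do.\<close>

lemma relative_eigenvector:
  fixes T :: "complex^'n^'n"
  assumes U: "vec.subspace U" "\<And>u. u \<in> U \<Longrightarrow> T *v u \<in> U" and V: "vec.subspace V"
    and w: "w \<in> U" "w \<notin> V"
  shows "\<exists>u l. u \<in> U \<and> u \<notin> V \<and> T *v u - l *s u \<in> V"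
proof -
  obtain p where "p \<noteq> 0" "krylov T p w \<in> V"
    using krylov_annihilator[of T w] vec.subspace_0[OF V] by auto
  then show ?thesis using w
  proof (induction "degree p" arbitrary: p w rule: less_induct)
    case less
    show ?case
    proof (cases "degree p = 0")
      case True
      then obtain c where c: "p = [:c:]" by (rule degree_eq_zeroE)
      then have "c *s w \<in> V" "c \<noteq> 0"
        using less.prems by (auto simp: krylov_def)
      from vec.subspace_scale[OF V this(1), of "1 / c"] this(2) have "w \<in> V"
        by simp
      with less.prems show ?thesis by simp
    next
      case False
      then obtain l where "poly p l = 0"
        using fundamental_theorem_of_algebra[of p] by (auto simp: constant_degree)
      then obtain q where q: "p = [:- l, 1:] * q"
        by (auto simp: poly_eq_0_iff_dvd)
      show ?thesis
      proof (cases "T *v w - l *s w \<in> V")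
        case True
        with less.prems show ?thesis by blast
      next
        case False
        have "degree q < degree p"
          using less.prems(1) degree_mult_eq[of "[:- l, 1:]" q] by (auto simp: q simp del: mult_pCons_left)
        moreover have "T *v w - l *s w \<in> U"
          using U less.prems by (intro vec.subspace_diff vec.subspace_scale)
        ultimately show ?thesis
          using less.hyps[of q "T *v w - l *s w"] less.prems(1,2) False
          unfolding q krylov_linear_factor by (cases "q = 0") (simp, blast)
      qed
    qed
  qed
qed

text \<open>The usual common eigenvector argument, carried out modulo \<open>V\<close> rather than
  in the quotient space: the vectors that \<open>X - l\<close> sends into \<open>V\<close> form a
  subspace that reaches beyond \<open>V\<close> and is stable under \<open>Y\<close> by
  commutativity, so \<open>Y\<close> has an eigenvector modulo \<open>V\<close> there.\<close>

lemma common_relative_eigenvector: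
  fixes X Y :: "complex^'n^'n"
  assumes comm: "X ** Y = Y ** X" and V: "vec.subspace V" "V \<noteq> UNIV"
    and inv: "\<And>v. v \<in> V \<Longrightarrow> X *v v \<in> V" "\<And>v. v \<in> V \<Longrightarrow> Y *v v \<in> V"
  shows "\<exists>v l m. v \<notin> V \<and> X *v v - l *s v \<in> V \<and> Y *v v - m *s v \<in> V"
proof -
  obtain w where "w \<notin> V" using V by blast
  then obtain u l where u: "u \<notin> V" "X *v u - l *s u \<in> V"
    using relative_eigenvector[of UNIV X V w] V by (auto simp: vec.subspace_UNIV)
  let ?U = "{u. X *v u - l *s u \<in> V}"
  have "vec.subspace ?U"
  proof (rule vec.subspaceI)
    show "0 \<in> ?U" using vec.subspace_0[OF V(1)] by simp
  next
    fix x y assume "x \<in> ?U" "y \<in> ?U"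
    then have "(X *v x - l *s x) + (X *v y - l *s y) \<in> V"
      using V(1) by (auto intro: vec.subspace_add)
    then show "x + y \<in> ?U"
      by (simp add: vec.add vec.scale_right_distrib algebra_simps)
  next
    fix c x assume "x \<in> ?U"
    then have "c *s (X *v x - l *s x) \<in> V"
      by (intro vec.subspace_scale[OF V(1)]) simp
    then show "c *s x \<in> ?U"
      by (simp add: vec.scale vec.scale_right_diff_distrib mult.commute)
  qed
  moreover have "Y *v x \<in> ?U" if "x \<in> ?U" for x
  proof -
    have "X *v (Y *v x) - l *s (Y *v x) = Y *v (X *v x - l *s x)"
      by (simp add: vec.diff vec.scale matrix_vector_mul_assoc comm)
    with inv(2) that show ?thesis by simp
  qed
  ultimately obtain v m where "v \<in> ?U" "v \<notin> V" "Y *v v - m *s v \<in> V"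
    using relative_eigenvector[of ?U Y V u] V(1) u by auto
  then show ?thesis by blast
qed

lemma span_insert_invariant:
  fixes X :: "complex^'n^'n"
  assumes "\<And>u. u \<in> vec.span S \<Longrightarrow> X *v u \<in> vec.span S" "X *v v - l *s v \<in> vec.span S"
    and "u \<in> vec.span (insert v S)"
  shows "X *v u \<in> vec.span (insert v S)"
proof -
  have mono: "vec.span S \<subseteq> vec.span (insert v S)"
    by (rule vec.span_mono) auto
  obtain k where "u - k *s v \<in> vec.span S"
    using assms(3) by (auto simp: vec.span_breakdown_eq)
  then have "X *v (u - k *s v) + k *s (X *v v - l *s v) \<in> vec.span (insert v S)"
    using assms(1,2) mono by (intro vec.span_add vec.span_scale) auto
  moreover have "(k * l) *s v \<in> vec.span (insert v S)"
    by (intro vec.span_scale vec.span_base) simp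
  ultimately have "X *v (u - k *s v) + k *s (X *v v - l *s v) + (k * l) *s v \<in> vec.span (insert v S)"
    by (rule vec.span_add)
  then show ?thesis
    by (simp add: vec.diff vec.scale vec.scale_right_diff_distrib)
qed

text \<open>In the type \<open>4\<close> the numeral 4 is the residue 0. The order of rows and
  columns, and the matching positions in lists, are therefore fixed explicitly.\<close>

definition idx :: "4 \<Rightarrow> nat" where
  "idx i = (if i = 1 then 0 else if i = 2 then 1 else if i = 3 then 2 else 3)"

lemma idx_simps [simp]: "idx 1 = 0" "idx 2 = 1" "idx 3 = 2" "idx 4 = 3" "idx 0 = 3"
  by (simp_all add: idx_def)

lemma idx_eq_iff [simp]: "idx i = idx j \<longleftrightarrow> i = j"
  using exhaust_4[of i] exhaust_4[of j] by auto

lemma idx_less: "idx i < 4"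
  by (simp add: idx_def)

definition upper_triangular4 :: "mat4 \<Rightarrow> bool" where
  "upper_triangular4 A \<longleftrightarrow> (\<forall>i j. idx j < idx i \<longrightarrow> A $ i $ j = 0)"

definition preserves :: "complex^'n^'n \<Rightarrow> (complex^'n) set \<Rightarrow> bool" where
  "preserves X V \<longleftrightarrow> (\<forall>v\<in>V. X *v v \<in> V)"

text \<open>Adding a common eigenvector modulo the span enlarges an invariant subspace by one
  dimension; repetition from the empty set yields a complete invariant flag.\<close>

lemma extend_flag:
  fixes X Y :: "complex^'n^'n"
  assumes comm: "X ** Y = Y ** X" and S: "finite S" "card S < CARD('n)" "vec.independent S"
    and inv: "preserves X (vec.span S)" "preserves Y (vec.span S)"
  shows "\<exists>v. v \<notin> S \<and> vec.independent (insert v S) \<and> preserves X (vec.span (insert v S)) \<and>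
    preserves Y (vec.span (insert v S))"
proof -
  have inv': "X *v v \<in> vec.span S" "Y *v v \<in> vec.span S" if "v \<in> vec.span S" for v
    using inv that by (auto simp: preserves_def)
  have "vec.dim (vec.span S) < CARD('n)"
    using S vec.dim_le_card'[of S] by (simp add: vec.dim_span)
  then have "vec.span S \<noteq> UNIV"
    using vec.dim_UNIV card_cart_basis by (metis less_irrefl)
  then obtain v l m where v: "v \<notin> vec.span S" "X *v v - l *s v \<in> vec.span S" "Y *v v - m *s v \<in> vec.span S"
    using common_relative_eigenvector[OF comm vec.subspace_span _ inv'] by blast
  moreover have "v \<notin> S" using v(1) vec.span_base by blast
  moreover have "vec.independent (insert v S)"
    using v(1) S(3) by (rule vec.independent_insertI)
  ultimately show ?thesis
    using span_insert_invariant[OF inv'(1) v(2)] span_insert_invariant[OF inv'(2) v(3)]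
    unfolding preserves_def by blast
qed

lemma matrix_inv_mult:
  fixes P :: "'a::field^'n^'n"
  assumes "invertible P"
  shows "P ** matrix_inv P = mat 1" "matrix_inv P ** P = mat 1"
  using someI_ex[OF assms[unfolded invertible_def]] by (simp_all add: matrix_inv_def)

lemma matrix_inv_eqI:
  fixes P :: "'a::field^'n^'n"
  assumes "P ** Q = mat 1" "Q ** P = mat 1"
  shows "invertible P" "matrix_inv P = Q"
proof -
  show inv: "invertible P" using assms unfolding invertible_def by blast
  have "(Q ** P) ** matrix_inv P = Q"
    by (simp add: matrix_inv_mult[OF inv] flip: matrix_mul_assoc)
  then show "matrix_inv P = Q" by (simp add: assms(2))
qed

lemma simultaneous_triangularization:
  assumes "(X, Y) \<in> Com4"
  shows "\<exists>g. invertible g \<and> upper_triangular4 (g ** X ** matrix_inv g) \<and>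
    upper_triangular4 (g ** Y ** matrix_inv g)"
proof -
  have comm: "X ** Y = Y ** X" using assms by (simp add: Com4_def)
  obtain v1 where v1: "v1 \<notin> {}" "vec.independent {v1}"
    "preserves X (vec.span {v1})" "preserves Y (vec.span {v1})"
    using extend_flag[OF comm, of "{}"] vec.independent_empty by (auto simp: preserves_def)
  obtain v2 where v2: "v2 \<notin> {v1}" "vec.independent {v2, v1}"
    "preserves X (vec.span {v2, v1})" "preserves Y (vec.span {v2, v1})"
    using extend_flag[OF comm, of "{v1}"] v1 by (auto simp: card_insert_if)
  obtain v3 where v3: "v3 \<notin> {v2, v1}" "vec.independent {v3, v2, v1}"
    "preserves X (vec.span {v3, v2, v1})" "preserves Y (vec.span {v3, v2, v1})"
    using extend_flag[OF comm, of "{v2, v1}"] v1 v2 by (auto simp: card_insert_if)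
  obtain v4 where v4: "v4 \<notin> {v3, v2, v1}" "vec.independent {v4, v3, v2, v1}"
    using extend_flag[OF comm, of "{v3, v2, v1}"] v1 v2 v3 by (auto simp: card_insert_if)
  have card: "card {v4, v3, v2, v1} = 4"
    using v2(1) v3(1) v4(1) by auto
  then have span: "vec.span {v4, v3, v2, v1} = UNIV"
    using vec.card_ge_dim_independent[of "{v4, v3, v2, v1}" UNIV] v4(2)
    by (auto simp: vec.dim_UNIV card_cart_basis)
  \<comment> \<open>The flag vectors become the columns of \<open>P\<close> in the order in which
    they were found, so conjugation by the inverse of \<open>P\<close> moves the flag to the
    standard one.\<close>
  define v where "v = (\<lambda>j. [v1, v2, v3, v4] ! idx j)"
  define P :: mat4 where "P = (\<chi> i j. v j $ i)"
  have col: "column j P = v j" for j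
    by (simp add: column_def P_def vec_eq_iff)
  have "columns P = v ` UNIV"
    unfolding columns_def col by auto
  also have "\<dots> = {v4, v3, v2, v1}"
    unfolding UNIV_4 by (auto simp: v_def)
  finally have "columns P = {v4, v3, v2, v1}" .
  then obtain Q where "P ** Q = mat 1"
    using matrix_right_invertible_span_columns[of P] span by auto
  then have "invertible P"
    using invertible_right_inverse by blast
  define g where "g = matrix_inv P"
  have g: "g ** P = mat 1" "P ** g = mat 1"
    using \<open>invertible P\<close> by (simp_all add: g_def matrix_inv_mult)
  then have "invertible g" and inv_g: "matrix_inv g = P"
    by (simp_all add: matrix_inv_eqI)
  have gv: "g *v v j = axis j 1" for j
  proof -
    have "g *v (P *v axis j 1) = axis j 1"
      by (simp only: matrix_vector_mul_assoc g(1) matrix_vector_mul_lid)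
    moreover have "P *v axis j 1 = v j"
      by (simp add: vec_eq_iff matrix_vector_mult_def axis_def P_def if_distrib cong: if_cong)
    ultimately show ?thesis by simp
  qed
  have upper: "upper_triangular4 (g ** Z ** P)"
    if Z: "preserves Z (vec.span {v1})" "preserves Z (vec.span {v2, v1})"
      "preserves Z (vec.span {v3, v2, v1})" for Z
  proof -
    \<comment> \<open>The preimage under \<open>g\<close> of the span of the first
      \<open>k + 1\<close> coordinate vectors; it contains the corresponding member of the
      flag.\<close>
    let ?W = "\<lambda>k. {u. \<forall>i. k < idx i \<longrightarrow> (g *v u) $ i = 0}"
    have sub: "vec.subspace (?W k)" for k
      by (rule vec.subspaceI) (auto simp: vec.add vec.scale vec.zero)
    have mem: "v j \<in> ?W k" if "idx j \<le> k" for j k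
      using that by (auto simp: gv axis_def)
    have "v1 \<in> ?W k" "1 \<le> k \<Longrightarrow> v2 \<in> ?W k" "2 \<le> k \<Longrightarrow> v3 \<in> ?W k" for k
      using mem[of 1 k] mem[of 2 k] mem[of 3 k] by (simp_all add: v_def)
    from this[of 0] this[of 1] this[of 2] have "{v1} \<subseteq> ?W 0" "{v2, v1} \<subseteq> ?W 1" "{v3, v2, v1} \<subseteq> ?W 2"
      by simp_all
    then have "vec.span {v1} \<subseteq> ?W 0" "vec.span {v2, v1} \<subseteq> ?W 1" "vec.span {v3, v2, v1} \<subseteq> ?W 2"
      by (simp_all only: vec.span_minimal sub)
    moreover have "Z *v v1 \<in> vec.span {v1}" "Z *v v2 \<in> vec.span {v2, v1}" "Z *v v3 \<in> vec.span {v3, v2, v1}"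
      using Z by (auto simp: preserves_def vec.span_base)
    ultimately have "Z *v v1 \<in> ?W 0" "Z *v v2 \<in> ?W 1" "Z *v v3 \<in> ?W 2" by blast+
    then have "Z *v v j \<in> ?W (idx j)" for j
      using exhaust_4[of j] by (auto simp: v_def idx_def)
    moreover have "(g ** Z ** P) $ i $ j = (g *v (Z *v v j)) $ i" for i j
      by (simp add: matrix_vector_mul_assoc col[symmetric]) (simp add: matrix_matrix_mult_def
          matrix_vector_mult_def column_def)
    ultimately show ?thesis by (auto simp: upper_triangular4_def)
  qed
  show ?thesis
    using \<open>invertible g\<close> upper[OF v1(3) v2(3) v3(3)] upper[OF v1(4) v2(4) v3(4)]
    by (intro exI[of _ g]) (simp add: inv_g)
qed

section \<open>Invariant functions on commuting pairs\<close>

abbreviation coord_carrier :: "(mat4 \<times> mat4 \<Rightarrow> complex) set" where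
  "coord_carrier \<equiv> carrier coord_ring_inv_Com4"

lemma coord_carrierI:
  assumes "h \<in> polynomial_fns" "f = restrict h Com4"
    "\<And>g p. invertible g \<Longrightarrow> p \<in> Com4 \<Longrightarrow> f (conj_act g p) = f p"
  shows "f \<in> coord_carrier"
  using assms by (auto simp: coord_ring_inv_Com4_def regular_fns_def)

lemma coord_carrier_restrict: "f \<in> coord_carrier \<Longrightarrow> \<exists>h\<in>polynomial_fns. f = restrict h Com4"
  by (auto simp: coord_ring_inv_Com4_def regular_fns_def)

lemma coord_carrier_invariant:
  "f \<in> coord_carrier \<Longrightarrow> invertible g \<Longrightarrow> p \<in> Com4 \<Longrightarrow> f (conj_act g p) = f p"
  by (simp add: coord_ring_inv_Com4_def)

lemma conj_act_mult:
  assumes "invertible (g :: mat4)"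
  shows "(g ** X ** matrix_inv g) ** (g ** Y ** matrix_inv g) = g ** (X ** Y) ** matrix_inv g"
proof -
  have "(g ** X ** matrix_inv g) ** (g ** Y ** matrix_inv g)
      = g ** X ** (matrix_inv g ** g) ** Y ** matrix_inv g"
    by (simp only: matrix_mul_assoc)
  then show ?thesis
    by (simp add: matrix_inv_mult[OF assms] matrix_mul_assoc)
qed

lemma conj_act_Com4:
  assumes "invertible g" "p \<in> Com4"
  shows "conj_act g p \<in> Com4"
  using assms by (auto simp: Com4_def conj_act_def conj_act_mult)

lemma trace_conj:
  assumes "invertible (g :: mat4)"
  shows "trace (g ** X ** matrix_inv g) = trace X"
proof -
  have "trace (g ** X ** matrix_inv g) = trace (matrix_inv g ** (g ** X))"
    by (rule trace_mul_sym)
  then show ?thesis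
    by (simp add: matrix_mul_assoc matrix_inv_mult[OF assms])
qed

lemma matrix_diff_distrib:
  fixes A B C :: "'a::comm_ring_1^'n^'n"
  shows "(A - B) ** C = A ** C - B ** C" "C ** (A - B) = C ** A - C ** B"
  by (simp_all add: vec_eq_iff matrix_matrix_mult_def left_diff_distrib right_diff_distrib sum_subtractf)

lemma traceless_conj:
  assumes "invertible (g :: mat4)"
  shows "traceless (g ** X ** matrix_inv g) = g ** traceless X ** matrix_inv g"
proof -
  have "g ** mat c = mat c ** g" for c
    by (simp add: vec_eq_iff matrix_matrix_mult_def mat_def if_distrib if_distribR mult.commute cong: if_cong)
  then have "g ** mat c ** matrix_inv g = mat c" for c
    by (simp add: matrix_inv_mult[OF assms] flip: matrix_mul_assoc)
  then show ?thesis
    by (simp add: traceless_def trace_conj[OF assms] matrix_diff_distrib)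
qed

section \<open>The trace functions are invariant and polynomial\<close>

lemma trace_fn_expand:
  "trace_fn i (X, Y) = (let A = traceless X; B = traceless Y in
    [trace X, trace Y, trace (A ** A), trace (A ** B), trace (B ** B),
     trace (A ** A ** A), trace (A ** A ** B), trace (A ** B ** B), trace (B ** B ** B),
     trace (A ** A ** A ** A), trace (A ** A ** A ** B), trace (A ** A ** B ** B),
     trace (A ** B ** B ** B), trace (B ** B ** B ** B)] ! (i - 1))"
  by (simp add: trace_fn_def)

lemma trace_fn_conj:
  assumes "invertible g"
  shows "trace_fn i (conj_act g p) = trace_fn i p"
  by (cases p) (simp add: conj_act_def trace_fn_expand traceless_conj[OF assms] conj_act_mult[OF assms]
      trace_conj[OF assms] Let_def)

definition polynomial_matrix :: "(mat4 \<times> mat4 \<Rightarrow> mat4) \<Rightarrow> bool" where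
  "polynomial_matrix M \<longleftrightarrow> (\<forall>i j. (\<lambda>p. M p $ i $ j) \<in> polynomial_fns)"

lemma polynomial_fns_sum:
  "(\<And>x. x \<in> A \<Longrightarrow> f x \<in> polynomial_fns) \<Longrightarrow> (\<lambda>p. \<Sum>x\<in>A. f x p) \<in> polynomial_fns"
  by (induction A rule: infinite_finite_induct) (auto intro: polynomial_fns.intros)

lemma polynomial_matrix_fst: "polynomial_matrix fst"
  using polynomial_fns.entry_fst by (simp add: polynomial_matrix_def case_prod_beta')

lemma polynomial_matrix_snd: "polynomial_matrix snd"
  using polynomial_fns.entry_snd by (simp add: polynomial_matrix_def case_prod_beta')

lemma polynomial_matrix_mult:
  "polynomial_matrix M \<Longrightarrow> polynomial_matrix N \<Longrightarrow> polynomial_matrix (\<lambda>p. M p ** N p)"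
  by (auto simp: polynomial_matrix_def matrix_matrix_mult_def intro!: polynomial_fns_sum polynomial_fns.mult)

lemma polynomial_trace: "polynomial_matrix M \<Longrightarrow> (\<lambda>p. trace (M p)) \<in> polynomial_fns"
  by (auto simp: polynomial_matrix_def trace_def intro!: polynomial_fns_sum)

lemma polynomial_matrix_traceless:
  assumes "polynomial_matrix M"
  shows "polynomial_matrix (\<lambda>p. traceless (M p))"
  unfolding polynomial_matrix_def
proof (intro allI)
  fix i j
  have "(\<lambda>p. M p $ i $ j + (if i = j then - 1 / 4 else 0) * trace (M p)) \<in> polynomial_fns"
    using assms polynomial_trace[OF assms]
    by (intro polynomial_fns.add polynomial_fns.mult polynomial_fns.const) (auto simp: polynomial_matrix_def)
  also have "(\<lambda>p. M p $ i $ j + (if i = j then - 1 / 4 else 0) * trace (M p)) = (\<lambda>p. traceless (M p) $ i $ j)"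
    by (auto simp: traceless_def mat_def)
  finally show "(\<lambda>p. traceless (M p) $ i $ j) \<in> polynomial_fns" .
qed

lemma atLeastAtMost_1_14: "{1..14::nat} = {1, 2, 3, 4, 5, 6, 7, 8, 9, 10, 11, 12, 13, 14}"
  unfolding set_eq_iff atLeastAtMost_iff insert_iff empty_iff by presburger

lemma trace_fn_polynomial:
  assumes "i \<in> {1..14}"
  shows "trace_fn i \<in> polynomial_fns"
proof -
  have "(\<lambda>p. trace_fn i (fst p, snd p)) \<in> polynomial_fns"
    using assms unfolding atLeastAtMost_1_14 trace_fn_expand Let_def
    by (elim insertE emptyE; simp; intro polynomial_trace polynomial_matrix_mult
        polynomial_matrix_traceless polynomial_matrix_fst polynomial_matrix_snd)
  then show ?thesis by simp
qed

lemma trace_fn_in_coord: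
  assumes "i \<in> {1..14}"
  shows "restrict (trace_fn i) Com4 \<in> coord_carrier"
  by (rule coord_carrierI[OF trace_fn_polynomial[OF assms] refl])
    (simp add: trace_fn_conj conj_act_Com4)

subsection \<open>Diagonal pairs\<close>

lemma diagonal_mult_left:
  fixes A :: "'a::comm_ring_1^'n^'n"
  shows "((\<chi> i j. if i = j then f i else 0) ** A) $ i $ j = f i * A $ i $ j"
proof -
  have "((\<chi> i j. if i = j then f i else 0) ** A) $ i $ j = (\<Sum>k\<in>UNIV. if i = k then f k * A $ k $ j else 0)"
    unfolding matrix_matrix_mult_def vec_lambda_beta by (rule sum.cong) auto
  then show ?thesis by simp
qed

lemma diagonal_mult_right:
  fixes A :: "'a::comm_ring_1^'n^'n"
  shows "(A ** (\<chi> i j. if i = j then f i else 0)) $ i $ j = A $ i $ j * f j"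
proof -
  have "(A ** (\<chi> i j. if i = j then f i else 0)) $ i $ j = (\<Sum>k\<in>UNIV. if k = j then A $ i $ k * f k else 0)"
    unfolding matrix_matrix_mult_def vec_lambda_beta by (rule sum.cong) auto
  then show ?thesis by simp
qed

definition diag4 :: "complex list \<Rightarrow> mat4" where
  "diag4 xs = (\<chi> i j. if i = j then xs ! idx i else 0)"

lemma diag4_mult:
  assumes "length xs = 4" "length ys = 4"
  shows "diag4 xs ** diag4 ys = diag4 (map2 (*) xs ys)"
  using assms
  by (simp add: vec_eq_iff diag4_def diagonal_mult_left idx_less)

lemma diag4_Com4:
  assumes "length xs = 4" "length ys = 4"
  shows "(diag4 xs, diag4 ys) \<in> Com4"
proof -
  have "diag4 (map2 (*) xs ys) = diag4 (map2 (*) ys xs)"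
    using assms by (simp add: vec_eq_iff diag4_def idx_less mult.commute)
  with assms show ?thesis by (simp add: Com4_def diag4_mult)
qed

lemma trace_diag4:
  assumes "length xs = 4"
  shows "trace (diag4 xs) = sum_list xs"
proof -
  from assms obtain a b c d where xs: "xs = [a, b, c, d]" by (rule length_4E)
  show ?thesis
    unfolding xs trace_def sum_4 diag4_def by (simp add: add.assoc)
qed

lemma traceless_diag4:
  assumes "length xs = 4"
  shows "traceless (diag4 xs) = diag4 (center xs)"
  using assms unfolding traceless_def trace_diag4[OF assms]
  by (simp add: vec_eq_iff diag4_def center_def mat_def idx_less)

lemma trace_fn_diag4:
  assumes "length xs = 4" "length ys = 4" "i \<in> {1..14}"
  shows "trace_fn i (diag4 xs, diag4 ys) = generator xs ys i"
proof -
  obtain a b c d where as: "center xs = [a, b, c, d]"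
    using assms(1) by (metis length_center length_4E)
  obtain a' b' c' d' where bs: "center ys = [a', b', c', d']"
    using assms(2) by (metis length_center length_4E)
  show ?thesis
    using assms(3) unfolding atLeastAtMost_1_14 trace_fn_expand Let_def
    by (elim insertE emptyE; simp add: traceless_diag4 assms(1,2) trace_diag4 as bs diag4_mult
        generator_def moment_def power2_eq_square power3_eq_cube power4_eq_xxxx mult.assoc)
qed

lemma polynomial_fns_diag4:
  assumes "h \<in> polynomial_fns"
  shows "\<exists>g. decomposed g \<and> (\<forall>xs ys. length xs = 4 \<longrightarrow> length ys = 4 \<longrightarrow> h (diag4 xs, diag4 ys) = g xs ys)"
  using assms
proof induction
  case (const c)
  show ?case
    by (intro exI[of _ "\<lambda>_ _. c"] conjI decomposed_generated generated_const) simp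
next
  case (entry_fst i j)
  \<comment> \<open>A diagonal entry is its centred value plus a quarter of the trace. Entries off
    the diagonal are covered below by a constant factor 0.\<close>
  have "decomposed (\<lambda>xs ys. center xs ! idx i + generator xs ys 1 * (1 / 4))"
    by (intro decomposed.add decomposed_center idx_less decomposed_generated generated_mult
        generated_generator generated_const) simp
  from decomposed_mult[OF decomposed_generated[OF generated_const[of "if i = j then 1 else 0"]] this]
  show ?case
    by (intro exI[of _ "\<lambda>xs ys. (if i = j then 1 else 0) * (center xs ! idx i + generator xs ys 1 * (1 / 4))"]
        conjI allI impI) (simp_all add: diag4_def center_def generator_def idx_less)
next
  case (entry_snd i j)
  have "decomposed (\<lambda>xs ys. center ys ! idx i + generator xs ys 2 * (1 / 4))"
    by (intro decomposed.add decomposed_center idx_less decomposed_generated generated_mult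
        generated_generator generated_const) simp
  from decomposed_mult[OF decomposed_generated[OF generated_const[of "if i = j then 1 else 0"]] this]
  show ?case
    by (intro exI[of _ "\<lambda>xs ys. (if i = j then 1 else 0) * (center ys ! idx i + generator xs ys 2 * (1 / 4))"]
        conjI allI impI) (simp_all add: diag4_def center_def generator_def idx_less)
next
  case (add f g)
  then obtain f' g' where "decomposed f'" "decomposed g'"
    "\<forall>xs ys. length xs = 4 \<longrightarrow> length ys = 4 \<longrightarrow> f (diag4 xs, diag4 ys) = f' xs ys"
    "\<forall>xs ys. length xs = 4 \<longrightarrow> length ys = 4 \<longrightarrow> g (diag4 xs, diag4 ys) = g' xs ys"
    by blast
  then show ?case
    by (intro exI[of _ "\<lambda>xs ys. f' xs ys + g' xs ys"] conjI decomposed.add) simp_all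
next
  case (mult f g)
  then obtain f' g' where "decomposed f'" "decomposed g'"
    "\<forall>xs ys. length xs = 4 \<longrightarrow> length ys = 4 \<longrightarrow> f (diag4 xs, diag4 ys) = f' xs ys"
    "\<forall>xs ys. length xs = 4 \<longrightarrow> length ys = 4 \<longrightarrow> g (diag4 xs, diag4 ys) = g' xs ys"
    by blast
  then show ?case
    by (intro exI[of _ "\<lambda>xs ys. f' xs ys * g' xs ys"] conjI decomposed_mult) simp_all
qed

text \<open>Simultaneous permutation of the diagonal entries is realized by the group, so an
  invariant function is symmetric in the four points.\<close>

lemma permutation_conjugation:
  assumes s: "s \<in> set perms4"
  shows "\<exists>g. invertible g \<and> (\<forall>xs ys. length xs = 4 \<longrightarrow> length ys = 4 \<longrightarrow>
    conj_act g (diag4 xs, diag4 ys) = (diag4 (permute s xs), diag4 (permute s ys)))"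
proof -
  define p :: "4 \<Rightarrow> 4" where "p = (\<lambda>i. [1, 2, 3, 4] ! (s ! idx i))"
  have len: "s ! idx i < 4" for i
    using perms4_facts(1,2)[OF s] idx_less[of i] nth_mem[of "idx i" s] by auto
  have "idx ([1, 2, 3, 4] ! k) = k" if "k < 4" for k
  proof -
    have "k \<in> {0, 1, 2, 3}" using that by auto
    then show ?thesis by auto
  qed
  then have idx_p: "idx (p i) = s ! idx i" for i
    using len by (simp add: p_def)
  have inj: "p i = p j \<longleftrightarrow> i = j" for i j
  proof -
    have "p i = p j \<longleftrightarrow> s ! idx i = s ! idx j"
      using idx_eq_iff[of "p i" "p j"] unfolding idx_p by simp
    also have "\<dots> \<longleftrightarrow> i = j"
      using perms4_facts[OF s] idx_less by (simp add: nth_eq_iff_index_eq)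
    finally show ?thesis .
  qed
  \<comment> \<open>Row \<open>i\<close> has its single 1 in column \<open>p i\<close>, so that
    position \<open>i\<close> of the conjugated diagonal holds the entry at
    \<open>s ! idx i\<close>, as in \<open>permute\<close>.\<close>
  define g :: mat4 where "g = (\<chi> i j. if j = p i then 1 else 0)"
  have "(g ** transpose g) $ i $ j = mat 1 $ i $ j" for i j
  proof -
    have "(g ** transpose g) $ i $ j = (\<Sum>k\<in>UNIV. if k = p i then (if p i = p j then 1 else 0) else 0)"
      unfolding matrix_matrix_mult_def g_def transpose_def vec_lambda_beta by (rule sum.cong) auto
    then show ?thesis by (simp add: inj mat_def)
  qed
  then have "g ** transpose g = mat 1"
    by (simp only: vec_eq_iff simp_thms)
  moreover from this have "transpose g ** g = mat 1"
    by (rule matrix_left_right_inverse[THEN iffD1])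
  ultimately have inv: "invertible g" "matrix_inv g = transpose g"
    by (rule matrix_inv_eqI)+
  have "g ** diag4 xs ** transpose g = diag4 (permute s xs)" if "length xs = 4" for xs
  proof -
    have "g ** diag4 xs = diag4 (permute s xs) ** g"
      using perms4_facts[OF s] idx_less
      unfolding diag4_def vec_eq_iff diagonal_mult_left diagonal_mult_right
      by (simp add: g_def nth_permute idx_p)
    then show ?thesis
      by (simp add: \<open>g ** transpose g = mat 1\<close> flip: matrix_mul_assoc)
  qed
  with inv show ?thesis
    by (intro exI[of _ g]) (simp add: conj_act_def)
qed

subsection \<open>Degeneration to the diagonal\<close>

lemma polynomial_fns_continuous:
  assumes "h \<in> polynomial_fns" "\<And>i j. isCont (\<lambda>t. F t $ i $ j) a" "\<And>i j. isCont (\<lambda>t. G t $ i $ j) a"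
  shows "isCont (\<lambda>t. h (F t, G t)) a"
  using assms(1) by induction (use assms(2,3) in auto)

text \<open>The formula for conjugation by \<open>diag(t^3, t^2, t, 1)\<close> on upper triangular
  matrices, written without inverses of \<open>t\<close> so that it makes sense at
  \<open>t = 0\<close>.\<close>

definition shrink :: "complex \<Rightarrow> mat4 \<Rightarrow> mat4" where
  "shrink t Z = (\<chi> i j. if idx i \<le> idx j then t ^ (idx j - idx i) * Z $ i $ j else 0)"

lemma shrink_conjugate:
  assumes "t \<noteq> 0"
  shows "\<exists>g. invertible g \<and> (\<forall>Z. upper_triangular4 Z \<longrightarrow> g ** Z ** matrix_inv g = shrink t Z)"
proof -
  define D where "D = (\<lambda>c::complex. (\<chi> i j. if i = j then c ^ (3 - idx i) else 0) :: mat4)"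
  have mult: "D c ** D d = D (c * d)" for c d
    by (simp add: vec_eq_iff D_def diagonal_mult_left power_mult_distrib)
  have one: "D 1 = mat 1"
    by (simp add: D_def mat_def cong: if_cong)
  have inv: "invertible (D t)" "matrix_inv (D t) = D (1 / t)"
    using assms by (simp_all add: matrix_inv_eqI[of "D t" "D (1 / t)"] mult one)
  have "D t ** Z ** D (1 / t) = shrink t Z" if "upper_triangular4 Z" for Z
  proof -
    have entry: "(D t ** Z ** D (1 / t)) $ i $ j = t ^ (3 - idx i) * Z $ i $ j * (1 / t) ^ (3 - idx j)" for i j
      unfolding D_def diagonal_mult_left diagonal_mult_right ..
    have "t ^ (3 - idx i) * z * (1 / t) ^ (3 - idx j) = t ^ (idx j - idx i) * z"
      if "idx i \<le> idx j" for i j z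
    proof -
      have "3 - idx i = (idx j - idx i) + (3 - idx j)"
        using that idx_less[of j] by simp
      then show ?thesis
        using assms by (simp only: power_add) (simp add: power_divide)
    qed
    then have "(D t ** Z ** D (1 / t)) $ i $ j = shrink t Z $ i $ j" for i j
      using that unfolding entry shrink_def upper_triangular4_def vec_lambda_beta
      by (cases "idx i \<le> idx j") (simp_all only: if_True if_False not_le mult_zero_right mult_zero_left if_cancel)
    then show ?thesis by (simp only: vec_eq_iff simp_thms)
  qed
  with inv show ?thesis by (intro exI[of _ "D t"]) simp
qed

text \<open>For nonzero \<open>t\<close> the shrunken pair lies in the orbit of
  \<open>(X, Y)\<close>, so \<open>f\<close> is constant there; its polynomial extension
  \<open>h\<close> is continuous and carries the value to \<open>t = 0\<close>. The limit need not
  be conjugate to the pair.\<close>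

lemma triangular_to_diagonal:
  assumes f: "f \<in> coord_carrier" and XY: "(X, Y) \<in> Com4"
    and upper: "upper_triangular4 X" "upper_triangular4 Y"
  shows "f (X, Y) = f (diag4 [X$1$1, X$2$2, X$3$3, X$4$4], diag4 [Y$1$1, Y$2$2, Y$3$3, Y$4$4])"
proof -
  obtain h where h: "h \<in> polynomial_fns" "f = restrict h Com4"
    using coord_carrier_restrict[OF f] by blast
  note inv = coord_carrier_invariant[OF f]
  have "h (shrink t X, shrink t Y) = f (X, Y)" if t: "t \<noteq> 0" for t
  proof -
    obtain g where g: "invertible g" "\<And>Z. upper_triangular4 Z \<Longrightarrow> g ** Z ** matrix_inv g = shrink t Z"
      using shrink_conjugate[OF t] by blast
    then have "conj_act g (X, Y) = (shrink t X, shrink t Y)"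
      using upper by (simp add: conj_act_def)
    then show ?thesis
      using inv[OF g(1) XY] conj_act_Com4[OF g(1) XY] h(2) by simp
  qed
  then have "eventually (\<lambda>t. h (shrink t X, shrink t Y) = f (X, Y)) (at 0)"
    by (simp add: eventually_at_filter)
  then have "(\<lambda>t. h (shrink t X, shrink t Y)) \<midarrow>0\<rightarrow> f (X, Y)"
    by (rule tendsto_eventually)
  moreover have "isCont (\<lambda>t. shrink t Z $ i $ j) 0" for Z i j
    by (cases "idx i \<le> idx j") (simp_all add: shrink_def)
  then have "isCont (\<lambda>t. h (shrink t X, shrink t Y)) 0"
    by (intro polynomial_fns_continuous h)
  ultimately have "f (X, Y) = h (shrink 0 X, shrink 0 Y)"
    by (intro tendsto_unique[of "at 0"]) (auto simp: isCont_def)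
  moreover have "shrink 0 Z = diag4 [Z$1$1, Z$2$2, Z$3$3, Z$4$4]" for Z
  proof -
    have "(if idx i \<le> idx j then 0 ^ (idx j - idx i) * z else 0) = (if i = j then z else 0)"
      for i j and z :: complex
      using idx_eq_iff[of i j] by (auto simp: power_0_left simp del: idx_eq_iff)
    moreover have "[Z$1$1, Z$2$2, Z$3$3, Z$4$4] ! idx i = Z $ i $ i" for i
      using exhaust_4[of i] by auto
    ultimately show ?thesis
      by (simp add: vec_eq_iff shrink_def diag4_def)
  qed
  \<comment> \<open>Diagonal matrices commute, so the limit pair belongs to \<open>Com4\<close>,
    where \<open>h\<close> and \<open>f\<close> agree.\<close>
  ultimately show ?thesis
    using diag4_Com4 by (simp add: h(2))
qed

text \<open>The lists depend on \<open>p\<close> only and serve all invariant functions at once,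
  which later allows \<open>f\<close> and the trace functions to be compared at the same diagonal
  pair.\<close>

lemma diagonal_representative:
  assumes "p \<in> Com4"
  shows "\<exists>xs ys. length xs = 4 \<and> length ys = 4 \<and> (\<forall>f\<in>coord_carrier. f p = f (diag4 xs, diag4 ys))"
proof -
  obtain X Y where p: "p = (X, Y)" by (cases p)
  obtain g where g: "invertible g" "upper_triangular4 (g ** X ** matrix_inv g)"
    "upper_triangular4 (g ** Y ** matrix_inv g)"
    using simultaneous_triangularization assms p by blast
  define X' Y' where "X' = g ** X ** matrix_inv g" "Y' = g ** Y ** matrix_inv g"
  have conj: "conj_act g p = (X', Y')"
    by (simp add: conj_act_def p X'_Y'_def)
  have "f p = f (diag4 [X'$1$1, X'$2$2, X'$3$3, X'$4$4], diag4 [Y'$1$1, Y'$2$2, Y'$3$3, Y'$4$4])"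
    if "f \<in> coord_carrier" for f
  proof -
    have "f p = f (X', Y')"
      using coord_carrier_invariant[OF that g(1) assms] conj by simp
    also have "\<dots> = f (diag4 [X'$1$1, X'$2$2, X'$3$3, X'$4$4], diag4 [Y'$1$1, Y'$2$2, Y'$3$3, Y'$4$4])"
      using g conj_act_Com4[OF g(1) assms] conj that
      by (intro triangular_to_diagonal) (simp_all add: X'_Y'_def)
    finally show ?thesis .
  qed
  then show ?thesis
    by (intro exI[of _ "[X'$1$1, X'$2$2, X'$3$3, X'$4$4]"] exI[of _ "[Y'$1$1, Y'$2$2, Y'$3$3, Y'$4$4]"]) simp
qed

theorem coord_carrier_generated:
  assumes f: "f \<in> coord_carrier"
  shows "\<exists>q\<in>polys {1..14}. \<forall>p\<in>Com4. f p = poly_val (\<lambda>i. trace_fn i p) q"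
proof -
  obtain h where h: "h \<in> polynomial_fns" "f = restrict h Com4"
    using coord_carrier_restrict[OF f] by blast
  note inv = coord_carrier_invariant[OF f]
  obtain F where F: "decomposed F"
    "\<And>xs ys. length xs = 4 \<Longrightarrow> length ys = 4 \<Longrightarrow> h (diag4 xs, diag4 ys) = F xs ys"
    using polynomial_fns_diag4[OF h(1)] by blast
  have fF: "f (diag4 xs, diag4 ys) = F xs ys" if "length xs = 4" "length ys = 4" for xs ys
    using that F(2) diag4_Com4 h(2) by simp
  have "F (permute s xs) (permute s ys) = F xs ys"
    if s: "s \<in> set perms4" and len: "length xs = 4" "length ys = 4" for s xs ys
  proof -
    obtain g where "invertible g"
      "conj_act g (diag4 xs, diag4 ys) = (diag4 (permute s xs), diag4 (permute s ys))"
      using permutation_conjugation[OF s] len by blast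
    then have "f (diag4 (permute s xs), diag4 (permute s ys)) = f (diag4 xs, diag4 ys)"
      using inv[of g "(diag4 xs, diag4 ys)"] diag4_Com4[OF len] by simp
    then show ?thesis
      using len perms4_facts[OF s] by (simp add: fF)
  qed
  then have "generated F"
    by (rule multisymmetric_generated[OF F(1)])
  then obtain q where q: "q \<in> polys {1..14}"
    "\<And>xs ys. length xs = 4 \<Longrightarrow> length ys = 4 \<Longrightarrow> F xs ys = poly_val (generator xs ys) q"
    unfolding generated_def by auto
  have "f p = poly_val (\<lambda>i. trace_fn i p) q" if p: "p \<in> Com4" for p
  proof -
    obtain xs ys where len: "length xs = 4" "length ys = 4"
      and rep: "\<And>f. f \<in> coord_carrier \<Longrightarrow> f p = f (diag4 xs, diag4 ys)"
      using diagonal_representative[OF p] by blast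
    have "f p = poly_val (generator xs ys) q"
      by (simp add: rep[OF f] fF len q)
    \<comment> \<open>The trace functions are invariant regular functions themselves, so they too
      take the same values at \<open>p\<close> and at its diagonal representative.\<close>
    also have "\<dots> = poly_val (\<lambda>i. trace_fn i p) q"
    proof (rule poly_val_cong[OF q(1)])
      fix i assume i: "i \<in> {1..14::nat}"
      then show "generator xs ys i = trace_fn i p"
        using rep[OF trace_fn_in_coord[OF i]] p diag4_Com4[OF len] trace_fn_diag4[OF len i] by simp
    qed
    finally show ?thesis .
  qed
  with q(1) show ?thesis by blast
qed

section \<open>Tensor products of commutative algebras\<close>

definition pair_mult ::
  "(complex, 'a, 'm) module_scheme \<Rightarrow> (complex, 'b, 'n) module_scheme \<Rightarrow> 'a \<times> 'b \<Rightarrow> 'a \<times> 'b \<Rightarrow> 'a \<times> 'b" where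
  "pair_mult A B k l = (fst k \<otimes>\<^bsub>A\<^esub> fst l, snd k \<otimes>\<^bsub>B\<^esub> snd l)"

lemma free_prod_alg_simps [simp]:
  "carrier (free_prod_alg A B) = {f. Poly_Mapping.keys f \<subseteq> carrier A \<times> carrier B}"
  "one (free_prod_alg A B) = Poly_Mapping.single (\<one>\<^bsub>A\<^esub>, \<one>\<^bsub>B\<^esub>) 1"
  "zero (free_prod_alg A B) = 0" "add (free_prod_alg A B) = (+)"
  "smult (free_prod_alg A B) c = Poly_Mapping.map ((*) c)"
  by (simp_all add: free_prod_alg_def)

text \<open>Summing over supersets of the supports lets products with different supports share their
  index sets, which gives biadditivity.\<close>

lemma free_mult_superset:
  assumes "finite F" "Poly_Mapping.keys f \<subseteq> F" "finite G" "Poly_Mapping.keys g \<subseteq> G"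
  shows "f \<otimes>\<^bsub>free_prod_alg A B\<^esub> g = (\<Sum>k\<in>F. \<Sum>l\<in>G.
    Poly_Mapping.single (pair_mult A B k l) (Poly_Mapping.lookup f k * Poly_Mapping.lookup g l))"
proof -
  have "f \<otimes>\<^bsub>free_prod_alg A B\<^esub> g = (\<Sum>k\<in>Poly_Mapping.keys f. \<Sum>l\<in>Poly_Mapping.keys g.
      Poly_Mapping.single (pair_mult A B k l) (Poly_Mapping.lookup f k * Poly_Mapping.lookup g l))"
    by (simp add: free_prod_alg_def pair_mult_def case_prod_beta)
  also have "\<dots> = (\<Sum>k\<in>Poly_Mapping.keys f. \<Sum>l\<in>G.
      Poly_Mapping.single (pair_mult A B k l) (Poly_Mapping.lookup f k * Poly_Mapping.lookup g l))"
    by (intro sum.cong refl sum.mono_neutral_left) (use assms in \<open>auto simp: in_keys_iff\<close>)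
  also have "\<dots> = (\<Sum>k\<in>F. \<Sum>l\<in>G.
      Poly_Mapping.single (pair_mult A B k l) (Poly_Mapping.lookup f k * Poly_Mapping.lookup g l))"
    by (intro sum.mono_neutral_left) (use assms in \<open>auto simp: in_keys_iff\<close>)
  finally show ?thesis .
qed

lemma free_mult_add_left:
  "(f + g) \<otimes>\<^bsub>free_prod_alg A B\<^esub> h = f \<otimes>\<^bsub>free_prod_alg A B\<^esub> h + g \<otimes>\<^bsub>free_prod_alg A B\<^esub> h"
proof -
  let ?F = "Poly_Mapping.keys f \<union> Poly_Mapping.keys g"
  have *: "p \<otimes>\<^bsub>free_prod_alg A B\<^esub> h = (\<Sum>k\<in>?F. \<Sum>l\<in>Poly_Mapping.keys h.
      Poly_Mapping.single (pair_mult A B k l) (Poly_Mapping.lookup p k * Poly_Mapping.lookup h l))"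
    if "Poly_Mapping.keys p \<subseteq> ?F" for p
    by (rule free_mult_superset) (use that in auto)
  show ?thesis
    by (subst (1 2 3) *) (auto simp: lookup_add distrib_right single_add sum.distrib
        dest: subsetD[OF Poly_Mapping.keys_add])
qed

lemma free_mult_add_right:
  "h \<otimes>\<^bsub>free_prod_alg A B\<^esub> (f + g) = h \<otimes>\<^bsub>free_prod_alg A B\<^esub> f + h \<otimes>\<^bsub>free_prod_alg A B\<^esub> g"
proof -
  let ?F = "Poly_Mapping.keys f \<union> Poly_Mapping.keys g"
  have *: "h \<otimes>\<^bsub>free_prod_alg A B\<^esub> p = (\<Sum>k\<in>Poly_Mapping.keys h. \<Sum>l\<in>?F.
      Poly_Mapping.single (pair_mult A B k l) (Poly_Mapping.lookup h k * Poly_Mapping.lookup p l))"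
    if "Poly_Mapping.keys p \<subseteq> ?F" for p
    by (rule free_mult_superset) (use that in auto)
  show ?thesis
    by (subst (1 2 3) *) (auto simp: lookup_add distrib_left single_add sum.distrib
        dest: subsetD[OF Poly_Mapping.keys_add])
qed

lemma free_mult_single:
  "Poly_Mapping.single k c \<otimes>\<^bsub>free_prod_alg A B\<^esub> Poly_Mapping.single l d
    = Poly_Mapping.single (pair_mult A B k l) (c * d)"
  by (subst free_mult_superset[where F = "{k}" and G = "{l}"]) auto

lemma free_mult_zero:
  "0 \<otimes>\<^bsub>free_prod_alg A B\<^esub> f = 0" "f \<otimes>\<^bsub>free_prod_alg A B\<^esub> 0 = 0"
  by (simp_all add: free_prod_alg_def)

lemma keys_uminus_complex: "Poly_Mapping.keys (- f) = Poly_Mapping.keys (f :: 'k \<Rightarrow>\<^sub>0 complex)"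
  by (auto simp: in_keys_iff)

lemma keys_diff_subset: "Poly_Mapping.keys (f - g) \<subseteq> Poly_Mapping.keys f \<union> Poly_Mapping.keys (g :: 'k \<Rightarrow>\<^sub>0 complex)"
  by (auto simp: in_keys_iff lookup_minus)

lemma free_induct [consumes 1, case_names zero single add]:
  assumes "f \<in> carrier (free_prod_alg A B)" "P 0"
    and single: "\<And>x y c. x \<in> carrier A \<Longrightarrow> y \<in> carrier B \<Longrightarrow> P (Poly_Mapping.single (x, y) c)"
    and add: "\<And>f g. f \<in> carrier (free_prod_alg A B) \<Longrightarrow> g \<in> carrier (free_prod_alg A B) \<Longrightarrow> P f \<Longrightarrow> P g \<Longrightarrow> P (f + g)"
  shows "P f"
proof -
  let ?Q = "\<lambda>f. f \<in> carrier (free_prod_alg A B) \<and> P f"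
  have Q_add: "?Q (f + g)" if "?Q f" "?Q g" for f g
    using that add[of f g] Poly_Mapping.keys_add[of f g] by auto
  have "?Q (\<Sum>k\<in>K. Poly_Mapping.single k (u k))" if "finite K" "K \<subseteq> carrier A \<times> carrier B" for K u
    using that
  proof (induction K rule: finite_induct)
    case (insert k K)
    have "?Q (Poly_Mapping.single k (u k))"
      using insert.prems single[of "fst k" "snd k" "u k"] by (cases k) auto
    with insert show ?case using Q_add by simp
  qed (use assms(2) in simp)
  from this[of "Poly_Mapping.keys f" "Poly_Mapping.lookup f"] assms(1) show ?thesis
    by (simp flip: poly_mapping_eq_sum_single)
qed

lemma free_mult_closed:
  assumes "cring A" "cring B"
    and "f \<in> carrier (free_prod_alg A B)" "g \<in> carrier (free_prod_alg A B)"
  shows "f \<otimes>\<^bsub>free_prod_alg A B\<^esub> g \<in> carrier (free_prod_alg A B)"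
proof -
  interpret A: cring A by fact
  interpret B: cring B by fact
  have closed_add: "p + q \<in> carrier (free_prod_alg A B)"
    if "p \<in> carrier (free_prod_alg A B)" "q \<in> carrier (free_prod_alg A B)" for p q
    using that Poly_Mapping.keys_add[of p q] by auto
  have single: "Poly_Mapping.single (x, y) c \<otimes>\<^bsub>free_prod_alg A B\<^esub> g \<in> carrier (free_prod_alg A B)"
    if "x \<in> carrier A" "y \<in> carrier B" for x y c
    using assms(4)
  proof (induction g rule: free_induct)
    case (add f g)
    then show ?case unfolding free_mult_add_right by (intro closed_add)
  qed (use that in \<open>auto simp: free_mult_zero free_mult_single pair_mult_def\<close>)
  show ?thesis
    using assms(3)
  proof (induction f rule: free_induct)
    case (add f g)
    then show ?case unfolding free_mult_add_left by (intro closed_add)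
  qed (use single in \<open>auto simp: free_mult_zero\<close>)
qed

lemma cring_free_prod_alg:
  assumes "cring A" "cring B"
  shows "cring (free_prod_alg A B)"
proof -
  interpret A: cring A by fact
  interpret B: cring B by fact
  let ?M = "free_prod_alg A B"
  have comm: "f \<otimes>\<^bsub>?M\<^esub> g = g \<otimes>\<^bsub>?M\<^esub> f" if "f \<in> carrier ?M" "g \<in> carrier ?M" for f g
    using that(1)
  proof (induction f rule: free_induct)
    case (single x y c)
    show ?case using that(2)
      by (induction g rule: free_induct)
        (auto simp: free_mult_zero free_mult_single free_mult_add_left free_mult_add_right
          pair_mult_def single A.m_comm B.m_comm mult.commute)
  qed (auto simp: free_mult_zero free_mult_add_left free_mult_add_right)
  have assoc: "f \<otimes>\<^bsub>?M\<^esub> g \<otimes>\<^bsub>?M\<^esub> h = f \<otimes>\<^bsub>?M\<^esub> (g \<otimes>\<^bsub>?M\<^esub> h)"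
    if "f \<in> carrier ?M" "g \<in> carrier ?M" "h \<in> carrier ?M" for f g h
    using that(1)
  proof (induction f rule: free_induct)
    case f: (single x y c)
    show ?case using that(2)
    proof (induction g rule: free_induct)
      case g: (single x' y' c')
      show ?case using that(3)
        by (induction h rule: free_induct)
          (auto simp: free_mult_zero free_mult_single free_mult_add_left free_mult_add_right
            pair_mult_def f g A.m_assoc B.m_assoc mult.assoc)
    qed (auto simp: free_mult_zero free_mult_add_left free_mult_add_right)
  qed (auto simp: free_mult_zero free_mult_add_left free_mult_add_right)
  have one: "\<one>\<^bsub>?M\<^esub> \<otimes>\<^bsub>?M\<^esub> f = f" if "f \<in> carrier ?M" for f
    using that
    by (induction f rule: free_induct)
      (auto simp: free_mult_zero free_mult_single free_mult_add_right pair_mult_def)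
  show ?thesis
  proof (rule cringI)
    show "abelian_group ?M"
    proof (rule abelian_groupI)
      fix f assume "f \<in> carrier ?M"
      then show "\<exists>g\<in>carrier ?M. g \<oplus>\<^bsub>?M\<^esub> f = \<zero>\<^bsub>?M\<^esub>"
        by (intro bexI[of _ "- f"]) (auto simp: keys_uminus_complex)
    qed (use Poly_Mapping.keys_add in \<open>fastforce simp: add_ac\<close>)+
    show "Group.comm_monoid ?M"
    proof (rule Group.comm_monoidI)
      show "\<one>\<^bsub>?M\<^esub> \<in> carrier ?M" by simp
    qed (fact free_mult_closed[OF assms] assoc one comm)+
  qed (simp add: free_mult_add_left)
qed

text \<open>The universal property of the free vector space. Complex targets are enough, because
  tensors are evaluated one point of \<open>Com4\<close> at a time.\<close>

definition linear_ext :: "('k \<Rightarrow> complex) \<Rightarrow> ('k \<Rightarrow>\<^sub>0 complex) \<Rightarrow> complex" where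
  "linear_ext w f = (\<Sum>k\<in>Poly_Mapping.keys f. Poly_Mapping.lookup f k * w k)"

lemma linear_ext_superset:
  assumes "finite F" "Poly_Mapping.keys f \<subseteq> F"
  shows "linear_ext w f = (\<Sum>k\<in>F. Poly_Mapping.lookup f k * w k)"
  unfolding linear_ext_def
  by (rule sum.mono_neutral_left) (use assms in \<open>auto simp: in_keys_iff\<close>)

lemma linear_ext_zero [simp]: "linear_ext w 0 = 0"
  by (simp add: linear_ext_def)

lemma linear_ext_single [simp]: "linear_ext w (Poly_Mapping.single k c) = c * w k"
  by (subst linear_ext_superset[of "{k}"]) auto

lemma linear_ext_add [simp]: "linear_ext w (f + g) = linear_ext w f + linear_ext w g"
  using Poly_Mapping.keys_add[of f g]
  by (simp add: linear_ext_superset[of "Poly_Mapping.keys f \<union> Poly_Mapping.keys g"] lookup_add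
      distrib_right sum.distrib)

lemma linear_ext_diff [simp]: "linear_ext w (f - g) = linear_ext w f - linear_ext w g"
  using linear_ext_add[of w "f - g" g] by simp

lemma linear_ext_sum [simp]: "linear_ext w (sum f K) = (\<Sum>k\<in>K. linear_ext w (f k))"
  by (induction K rule: infinite_finite_induct) auto

lemma linear_ext_mult:
  assumes "\<And>x y x' y'. x \<in> carrier A \<Longrightarrow> x' \<in> carrier A \<Longrightarrow> y \<in> carrier B \<Longrightarrow> y' \<in> carrier B \<Longrightarrow>
      w (x \<otimes>\<^bsub>A\<^esub> x', y \<otimes>\<^bsub>B\<^esub> y') = w (x, y) * w (x', y')"
    and "f \<in> carrier (free_prod_alg A B)" "g \<in> carrier (free_prod_alg A B)"
  shows "linear_ext w (f \<otimes>\<^bsub>free_prod_alg A B\<^esub> g) = linear_ext w f * linear_ext w g"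
  using assms(2)
proof (induction f rule: free_induct)
  case (single x y c)
  show ?case using assms(3)
    by (induction g rule: free_induct)
      (auto simp: free_mult_zero free_mult_single free_mult_add_right pair_mult_def assms(1) single
        distrib_left)
qed (auto simp: free_mult_zero free_mult_add_left distrib_right)

lemma alg_quot_simps [simp]:
  "carrier (alg_quot A I) = carrier (A Quot I)" "mult (alg_quot A I) = mult (A Quot I)"
  "one (alg_quot A I) = one (A Quot I)" "zero (alg_quot A I) = zero (A Quot I)"
  "add (alg_quot A I) = add (A Quot I)"
  by (simp_all add: alg_quot_def)

text \<open>The scalar multiplication takes no part in the ring laws, so these carry over from the
  quotient ring field by field.\<close>

lemma cring_alg_quot:
  assumes "cring (A Quot I)"
  shows "cring (alg_quot A I)"
proof -
  interpret Q: cring "A Quot I" by fact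
  show ?thesis
  proof (rule cringI)
    show "abelian_group (alg_quot A I)"
    proof (rule abelian_groupI)
      fix x assume "x \<in> carrier (alg_quot A I)"
      then show "\<exists>y\<in>carrier (alg_quot A I). y \<oplus>\<^bsub>alg_quot A I\<^esub> x = \<zero>\<^bsub>alg_quot A I\<^esub>"
        using Q.l_neg Q.a_inv_closed by auto
    qed (simp_all add: Q.a_ac)
    show "Group.comm_monoid (alg_quot A I)"
      by (rule Group.comm_monoidI) (simp_all add: Q.m_ac)
  qed (simp add: Q.l_distr)
qed

section \<open>The coordinate ring as a ring\<close>

lemma coord_ring_simps [simp]:
  "mult coord_ring_inv_Com4 f g = (\<lambda>p\<in>Com4. f p * g p)"
  "add coord_ring_inv_Com4 f g = (\<lambda>p\<in>Com4. f p + g p)"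
  "one coord_ring_inv_Com4 = (\<lambda>p\<in>Com4. 1)" "zero coord_ring_inv_Com4 = (\<lambda>p\<in>Com4. 0)"
  "smult coord_ring_inv_Com4 c f = (\<lambda>p\<in>Com4. c * f p)"
  by (simp_all add: coord_ring_inv_Com4_def)

lemma coord_carrier_const: "(\<lambda>p\<in>Com4. c) \<in> coord_carrier"
  by (rule coord_carrierI[OF polynomial_fns.const refl]) (simp add: conj_act_Com4)

lemma coord_carrier_add:
  assumes "f \<in> coord_carrier" "g \<in> coord_carrier"
  shows "(\<lambda>p\<in>Com4. f p + g p) \<in> coord_carrier"
proof -
  obtain h k where "h \<in> polynomial_fns" "f = restrict h Com4" "k \<in> polynomial_fns" "g = restrict k Com4"
    using assms coord_carrier_restrict by meson
  note hk = this
  show ?thesis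
  proof (rule coord_carrierI[of "\<lambda>p. h p + k p"])
    show "(\<lambda>p\<in>Com4. f p + g p) = (\<lambda>p\<in>Com4. h p + k p)"
      by (rule restrict_ext) (simp add: hk)
  qed (simp_all add: hk(1,3) polynomial_fns.add conj_act_Com4 coord_carrier_invariant[OF assms(1)]
      coord_carrier_invariant[OF assms(2)])
qed

lemma coord_carrier_mult:
  assumes "f \<in> coord_carrier" "g \<in> coord_carrier"
  shows "(\<lambda>p\<in>Com4. f p * g p) \<in> coord_carrier"
proof -
  obtain h k where "h \<in> polynomial_fns" "f = restrict h Com4" "k \<in> polynomial_fns" "g = restrict k Com4"
    using assms coord_carrier_restrict by meson
  note hk = this
  show ?thesis
  proof (rule coord_carrierI[of "\<lambda>p. h p * k p"])
    show "(\<lambda>p\<in>Com4. f p * g p) = (\<lambda>p\<in>Com4. h p * k p)"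
      by (rule restrict_ext) (simp add: hk)
  qed (simp_all add: hk(1,3) polynomial_fns.mult conj_act_Com4 coord_carrier_invariant[OF assms(1)]
      coord_carrier_invariant[OF assms(2)])
qed

lemma coord_carrier_ext:
  assumes "f \<in> coord_carrier"
  shows "(\<lambda>p\<in>Com4. f p) = f"
  using coord_carrier_restrict[OF assms] by auto

lemma cring_coord_ring: "cring coord_ring_inv_Com4"
proof (rule cringI)
  show "abelian_group coord_ring_inv_Com4"
  proof (rule abelian_groupI)
    fix f assume f: "f \<in> coord_carrier"
    have "(\<lambda>p\<in>Com4. (\<lambda>p\<in>Com4. - 1) p * f p) \<in> coord_carrier"
      using f by (intro coord_carrier_mult coord_carrier_const)
    then show "\<exists>g\<in>coord_carrier. g \<oplus>\<^bsub>coord_ring_inv_Com4\<^esub> f = \<zero>\<^bsub>coord_ring_inv_Com4\<^esub>"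
      by (rule bexI[rotated]) (auto intro!: restrict_ext)
    show "\<zero>\<^bsub>coord_ring_inv_Com4\<^esub> \<oplus>\<^bsub>coord_ring_inv_Com4\<^esub> f = f"
      using coord_carrier_ext[OF f] by (simp cong: restrict_cong)
  qed (auto simp: coord_carrier_add coord_carrier_const add_ac intro!: restrict_ext)
  show "Group.comm_monoid coord_ring_inv_Com4"
  proof (rule Group.comm_monoidI)
    fix f assume f: "f \<in> coord_carrier"
    show "\<one>\<^bsub>coord_ring_inv_Com4\<^esub> \<otimes>\<^bsub>coord_ring_inv_Com4\<^esub> f = f"
      using coord_carrier_ext[OF f] by (simp cong: restrict_cong)
  qed (auto simp: coord_carrier_mult coord_carrier_const mult_ac intro!: restrict_ext)
qed (auto simp: distrib_right intro!: restrict_ext)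

section \<open>Comparison with the coordinate ring\<close>

abbreviation quot_alg :: "(complex, cpoly set) module" where
  "quot_alg \<equiv> alg_quot (poly_alg {3..14}) J"

abbreviation free_alg :: "(complex, (cpoly \<times> cpoly set) \<Rightarrow>\<^sub>0 complex) module" where
  "free_alg \<equiv> free_prod_alg (poly_alg {1, 2}) quot_alg"

abbreviation free_ideal :: "((cpoly \<times> cpoly set) \<Rightarrow>\<^sub>0 complex) set" where
  "free_ideal \<equiv> tensor_ideal (poly_alg {1, 2}) quot_alg"

definition coset_J :: "cpoly \<Rightarrow> cpoly set" where
  "coset_J y = J +>\<^bsub>poly_alg {3..14}\<^esub> y"

lemma coset_J_image: "coset_J y = (\<lambda>j. j + y) ` J"
  by (auto simp: coset_J_def a_r_coset_def')

lemma coset_J_eqI: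
  assumes "y - z \<in> J"
  shows "coset_J y = coset_J z"
proof -
  have "coset_J y \<subseteq> coset_J z" if "y - z \<in> J" for y z
  proof
    fix x assume "x \<in> coset_J y"
    then obtain j where j: "j \<in> J" "x = j + y" by (auto simp: coset_J_image)
    then have "x = (j + (y - z)) + z" by simp
    then show "x \<in> coset_J z" using J_add[OF j(1) that] unfolding coset_J_image by (rule image_eqI)
  qed
  moreover have "z - y \<in> J" using J_uminus[OF assms] by simp
  ultimately show ?thesis using assms by blast
qed

lemma cring_quot_alg: "cring quot_alg"
  by (rule cring_alg_quot) (rule ideal.quotient_is_cring[OF J_ideal cring_poly_alg])

lemma coset_J_closed: "y \<in> polys {3..14} \<Longrightarrow> coset_J y \<in> carrier quot_alg"
  by (auto simp: FactRing_def A_RCOSETS_def' coset_J_def)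

lemma quot_alg_cases:
  assumes "X \<in> carrier quot_alg"
  shows "\<exists>y\<in>polys {3..14}. X = coset_J y"
  using assms by (auto simp: FactRing_def A_RCOSETS_def' coset_J_def)

lemma coset_J_mult:
  assumes "y \<in> polys {3..14}" "z \<in> polys {3..14}"
  shows "coset_J y \<otimes>\<^bsub>quot_alg\<^esub> coset_J z = coset_J (y * z)"
  using ideal.rcoset_mult_add[OF J_ideal assms] by (simp add: FactRing_def coset_J_def)

lemma coset_J_add:
  assumes "y \<in> polys {3..14}" "z \<in> polys {3..14}"
  shows "coset_J y \<oplus>\<^bsub>quot_alg\<^esub> coset_J z = coset_J (y + z)"
proof -
  interpret cring "poly_alg {3..14}" by (rule cring_poly_alg)
  have "abelian_subgroup J (poly_alg {3..14})"
    by (rule abelian_subgroupI3[OF ideal.axioms(1)[OF J_ideal] abelian_group_axioms])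
  from abelian_subgroup.a_rcos_sum[OF this assms] show ?thesis
    by (simp add: FactRing_def coset_J_def)
qed

lemma coset_J_one: "\<one>\<^bsub>quot_alg\<^esub> = coset_J 1"
  by (simp add: FactRing_def coset_J_def)

lemma coset_J_smult:
  assumes "y \<in> polys {3..14}"
  shows "c \<odot>\<^bsub>quot_alg\<^esub> coset_J y = coset_J (Const c * y)"
proof -
  have "c \<odot>\<^bsub>quot_alg\<^esub> coset_J y = (\<Union>j\<in>J. coset_J (Const c * (j + y)))"
    unfolding alg_quot_def coset_J_image[of y] by (simp add: coset_J_def)
  \<comment> \<open>Multiples of elements of \<open>J\<close> stay in \<open>J\<close>, so all
    cosets in the union coincide; as \<open>J\<close> contains 0, the union is not empty.\<close>
  also have "\<dots> = (\<Union>j\<in>J. coset_J (Const c * y))"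
    by (intro SUP_cong refl coset_J_eqI) (simp add: distrib_left J_mult)
  also have "\<dots> = coset_J (Const c * y)"
    using J_zero by auto
  finally show ?thesis .
qed

section \<open>Evaluation of tensors at commuting pairs\<close>

lemma trace_fn_generator:
  assumes "p \<in> Com4"
  shows "\<exists>xs ys. length xs = 4 \<and> length ys = 4 \<and> (\<forall>i\<in>{1..14}. trace_fn i p = generator xs ys i)"
proof -
  obtain xs ys where len: "length xs = 4" "length ys = 4"
    and rep: "\<And>f. f \<in> coord_carrier \<Longrightarrow> f p = f (diag4 xs, diag4 ys)"
    using diagonal_representative[OF assms] by blast
  have "trace_fn i p = generator xs ys i" if "i \<in> {1..14}" for i
    using rep[OF trace_fn_in_coord[OF that]] assms diag4_Com4[OF len] trace_fn_diag4[OF len that] by simp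
  with len show ?thesis by blast
qed

abbreviation value_at :: "mat4 \<times> mat4 \<Rightarrow> cpoly \<Rightarrow> complex" where
  "value_at p \<equiv> poly_val (\<lambda>i. trace_fn i p)"

lemma value_at_J:
  assumes "p \<in> Com4" "q \<in> J"
  shows "value_at p q = 0"
proof -
  obtain xs ys where len: "length xs = 4" "length ys = 4"
    and gen: "\<And>i. i \<in> {1..14} \<Longrightarrow> trace_fn i p = generator xs ys i"
    using trace_fn_generator[OF assms(1)] by blast
  have "value_at p q = poly_val (moment (center xs) (center ys)) q"
    by (rule poly_val_cong[of q "{3..14}"]) (use assms(2) J_subset gen in \<open>auto simp: generator_def\<close>)
  then show ?thesis
    using poly_val_J[OF traceless_center traceless_center assms(2)] len by simp
qed

text \<open>On a coset of \<open>J\<close> the set of values at a point of \<open>Com4\<close> has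
  one element, since every element of \<open>J\<close> takes the value 0 there.\<close>

definition coset_val :: "mat4 \<times> mat4 \<Rightarrow> cpoly set \<Rightarrow> complex" where
  "coset_val p Y = the_elem (value_at p ` Y)"

lemma coset_val_coset_J:
  assumes "p \<in> Com4"
  shows "coset_val p (coset_J y) = value_at p y"
proof -
  have "value_at p ` coset_J y = {value_at p y}"
    using J_zero value_at_J[OF assms] by (auto simp: coset_J_image image_image intro!: image_eqI[of _ _ 0])
  then show ?thesis by (simp add: coset_val_def)
qed

definition tensor_weight :: "mat4 \<times> mat4 \<Rightarrow> cpoly \<times> cpoly set \<Rightarrow> complex" where
  "tensor_weight p k = value_at p (fst k) * coset_val p (snd k)"

definition tensor_eval :: "((cpoly \<times> cpoly set) \<Rightarrow>\<^sub>0 complex) \<Rightarrow> mat4 \<times> mat4 \<Rightarrow> complex" where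
  "tensor_eval f = (\<lambda>p\<in>Com4. linear_ext (tensor_weight p) f)"

lemma coord_carrier_cong:
  assumes "f \<in> coord_carrier" "\<And>p. p \<in> Com4 \<Longrightarrow> g p = f p"
  shows "restrict g Com4 \<in> coord_carrier"
proof -
  have "restrict g Com4 = f"
    using coord_carrier_ext[OF assms(1)] restrict_ext[of Com4 g f] assms(2) by metis
  then show ?thesis using assms(1) by simp
qed

lemma value_in_coord:
  assumes "q \<in> polys {1..14}"
  shows "(\<lambda>p\<in>Com4. value_at p q) \<in> coord_carrier"
  using assms
proof (induction q rule: polys_induct)
  case (Const c)
  show ?case by (rule coord_carrier_cong[OF coord_carrier_const[of c]]) simp
next
  case (var i)
  then show ?case using trace_fn_in_coord[of i] by (simp add: restrict_def)
next
  case (add q r)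
  show ?case by (rule coord_carrier_cong[OF coord_carrier_add[OF add.IH]]) simp
next
  case (mult q r)
  show ?case by (rule coord_carrier_cong[OF coord_carrier_mult[OF mult.IH]]) simp
qed

lemma tensor_eval_single:
  assumes "y \<in> polys {3..14}"
  shows "tensor_eval (Poly_Mapping.single (x, coset_J y) c) = (\<lambda>p\<in>Com4. value_at p (Const c * x * y))"
  unfolding tensor_eval_def
  by (rule restrict_ext) (simp add: tensor_weight_def coset_val_coset_J)

lemma tensor_eval_closed:
  assumes "f \<in> carrier free_alg"
  shows "tensor_eval f \<in> coord_carrier"
  using assms
proof (induction f rule: free_induct)
  case zero
  show ?case
    unfolding tensor_eval_def by (rule coord_carrier_cong[OF coord_carrier_const[of 0]]) simp
next
  case (single x Y c)
  obtain y where y: "y \<in> polys {3..14}" "Y = coset_J y"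
    using quot_alg_cases[OF single(2)] by blast
  have "Const c * x * y \<in> polys {1..14}"
    using single(1) y(1) polys_mono[of "{1, 2}" "{1..14}"] polys_mono[of "{3..14}" "{1..14}"]
    by (intro polys_mult polys_Const) auto
  then show ?case
    unfolding y(2) tensor_eval_single[OF y(1)] by (rule value_in_coord)
next
  case (add f g)
  show ?case
    unfolding tensor_eval_def[of "f + g"]
    by (rule coord_carrier_cong[OF coord_carrier_add[OF add.IH]]) (simp add: tensor_eval_def)
qed

lemma tensor_weight_mult:
  assumes "p \<in> Com4" "Y \<in> carrier quot_alg" "Y' \<in> carrier quot_alg"
  shows "tensor_weight p (x \<otimes>\<^bsub>poly_alg {1, 2}\<^esub> x', Y \<otimes>\<^bsub>quot_alg\<^esub> Y')
    = tensor_weight p (x, Y) * tensor_weight p (x', Y')"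
proof -
  obtain y y' where y: "y \<in> polys {3..14}" "Y = coset_J y" "y' \<in> polys {3..14}" "Y' = coset_J y'"
    using quot_alg_cases assms by meson
  show ?thesis
    unfolding y(2,4) coset_J_mult[OF y(1,3)] tensor_weight_def fst_conv snd_conv
      coset_val_coset_J[OF assms(1)] by simp
qed

lemma cring_free_alg: "cring free_alg"
  by (rule cring_free_prod_alg[OF cring_poly_alg cring_quot_alg])

lemma tensor_eval_hom: "ring_hom_ring free_alg coord_ring_inv_Com4 tensor_eval"
proof (rule ring_hom_ringI[OF cring.axioms(1)[OF cring_free_alg] cring.axioms(1)[OF cring_coord_ring]])
  fix f g assume fg: "f \<in> carrier free_alg" "g \<in> carrier free_alg"
  show "tensor_eval (f \<otimes>\<^bsub>free_alg\<^esub> g) = tensor_eval f \<otimes>\<^bsub>coord_ring_inv_Com4\<^esub> tensor_eval g"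
    unfolding coord_ring_simps tensor_eval_def
    by (rule restrict_ext) (simp only: linear_ext_mult[OF tensor_weight_mult fg] restrict_apply')
  show "tensor_eval (f \<oplus>\<^bsub>free_alg\<^esub> g) = tensor_eval f \<oplus>\<^bsub>coord_ring_inv_Com4\<^esub> tensor_eval g"
    unfolding coord_ring_simps tensor_eval_def by (rule restrict_ext) simp
next
  show "tensor_eval \<one>\<^bsub>free_alg\<^esub> = \<one>\<^bsub>coord_ring_inv_Com4\<^esub>"
    using tensor_eval_single[of 1 1 1] unfolding free_prod_alg_simps coset_J_one
    by (simp cong: restrict_cong)
qed (rule tensor_eval_closed)

text \<open>An invariant regular function is a polynomial in the fourteen trace functions, and
  preimages are built along that polynomial: \<open>a_1\<close> and \<open>a_2\<close> come from the
  left factor, the other variables from the right one.\<close>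

lemma tensor_eval_surj: "tensor_eval ` carrier free_alg = coord_carrier"
proof
  show "tensor_eval ` carrier free_alg \<subseteq> coord_carrier"
    using tensor_eval_closed by blast
next
  interpret ring_hom_ring free_alg coord_ring_inv_Com4 tensor_eval by (rule tensor_eval_hom)
  have preimage: "(\<lambda>p\<in>Com4. value_at p q) \<in> tensor_eval ` carrier free_alg" if "q \<in> polys {1..14}" for q
    using that
  proof (induction q rule: polys_induct)
    case (Const c)
    have "tensor_eval (Poly_Mapping.single (1, coset_J 1) c) = (\<lambda>p\<in>Com4. value_at p (Const c))"
      by (simp add: tensor_eval_single)
    moreover have "Poly_Mapping.single (1, coset_J 1) c \<in> carrier free_alg"
      using coset_J_closed[of 1] by simp
    ultimately show ?case by (rule image_eqI[OF sym])
  next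
    case (var i)
    show ?case
    proof (cases "i \<in> {1, 2}")
      case True
      have "tensor_eval (Poly_Mapping.single (var i, coset_J 1) 1) = (\<lambda>p\<in>Com4. value_at p (var i))"
        by (simp add: tensor_eval_single)
      moreover have "Poly_Mapping.single (var i, coset_J 1) 1 \<in> carrier free_alg"
        using True coset_J_closed[of 1] by simp
      ultimately show ?thesis by (rule image_eqI[OF sym])
    next
      case False
      then have i: "i \<in> {3..14}" using var by auto
      have "tensor_eval (Poly_Mapping.single (1, coset_J (var i)) 1) = (\<lambda>p\<in>Com4. value_at p (var i))"
        using i by (simp add: tensor_eval_single)
      moreover have "Poly_Mapping.single (1, coset_J (var i)) 1 \<in> carrier free_alg"
        using i coset_J_closed[of "var i"] by simp
      ultimately show ?thesis by (rule image_eqI[OF sym])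
    qed
  next
    case (add q r)
    obtain f where f: "(\<lambda>p\<in>Com4. value_at p q) = tensor_eval f" "f \<in> carrier free_alg"
      using add.IH(1) by (rule imageE)
    obtain g where g: "(\<lambda>p\<in>Com4. value_at p r) = tensor_eval g" "g \<in> carrier free_alg"
      using add.IH(2) by (rule imageE)
    have "tensor_eval (f \<oplus>\<^bsub>free_alg\<^esub> g) = (\<lambda>p\<in>Com4. value_at p (q + r))"
      unfolding hom_add[OF f(2) g(2)] f(1)[symmetric] g(1)[symmetric] coord_ring_simps
      by (rule restrict_ext) simp
    then show ?case using R.a_closed[OF f(2) g(2)] by (rule image_eqI[OF sym])
  next
    case (mult q r)
    obtain f where f: "(\<lambda>p\<in>Com4. value_at p q) = tensor_eval f" "f \<in> carrier free_alg"
      using mult.IH(1) by (rule imageE)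
    obtain g where g: "(\<lambda>p\<in>Com4. value_at p r) = tensor_eval g" "g \<in> carrier free_alg"
      using mult.IH(2) by (rule imageE)
    have "tensor_eval (f \<otimes>\<^bsub>free_alg\<^esub> g) = (\<lambda>p\<in>Com4. value_at p (q * r))"
      unfolding hom_mult[OF f(2) g(2)] f(1)[symmetric] g(1)[symmetric] coord_ring_simps
      by (rule restrict_ext) simp
    then show ?case using R.m_closed[OF f(2) g(2)] by (rule image_eqI[OF sym])
  qed
  show "coord_carrier \<subseteq> tensor_eval ` carrier free_alg"
  proof
    fix f assume f: "f \<in> coord_carrier"
    obtain q where q: "q \<in> polys {1..14}" "\<forall>p\<in>Com4. f p = value_at p q"
      using coord_carrier_generated[OF f] by blast
    have "(\<lambda>p\<in>Com4. f p) = (\<lambda>p\<in>Com4. value_at p q)"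
      by (rule restrict_ext) (rule bspec[OF q(2)])
    then have "f = (\<lambda>p\<in>Com4. value_at p q)"
      unfolding coord_carrier_ext[OF f] .
    then show "f \<in> tensor_eval ` carrier free_alg"
      using preimage[OF q(1)] by simp
  qed
qed

subsection \<open>The kernel\<close>

lemma tensor_relators_closed: "tensor_relators (poly_alg {1, 2}) quot_alg \<subseteq> carrier free_alg"
proof -
  interpret R: cring "poly_alg {1, 2}" by (rule cring_poly_alg)
  interpret S: cring quot_alg by (rule cring_quot_alg)
  have smult: "c \<odot>\<^bsub>quot_alg\<^esub> Y \<in> carrier quot_alg" if Y: "Y \<in> carrier quot_alg" for c Y
  proof -
    obtain y where y: "y \<in> polys {3..14}" "Y = coset_J y"
      using quot_alg_cases[OF Y] by blast
    show ?thesis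
      unfolding y(2) coset_J_smult[OF y(1)] by (intro coset_J_closed polys_mult polys_Const y(1))
  qed
  have diff: "f - g \<in> carrier free_alg" if "f \<in> carrier free_alg" "g \<in> carrier free_alg"
    for f g :: "(cpoly \<times> cpoly set) \<Rightarrow>\<^sub>0 complex"
    using that keys_diff_subset[of f g] by auto
  have single: "Poly_Mapping.single (x, Y) c \<in> carrier free_alg"
    if "x \<in> polys {1, 2}" "Y \<in> carrier quot_alg" for x Y and c :: complex
    using that by simp
  have x_smult: "c \<odot>\<^bsub>poly_alg {1, 2}\<^esub> x \<in> polys {1, 2}" if "x \<in> polys {1, 2}" for c x
    using that by (auto intro: polys_mult)
  show ?thesis
    unfolding tensor_relators_def
    by (intro Un_least subsetI; elim CollectE exE conjE; hypsubst)
      (intro diff single R.a_closed S.a_closed smult x_smult; assumption)+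
qed

lemma free_ideal_ideal: "ideal free_ideal free_alg"
  unfolding tensor_ideal_def
  by (rule ring.genideal_ideal[OF cring.axioms(1)[OF cring_free_alg] tensor_relators_closed])

lemma free_ideal_add: "f \<in> free_ideal \<Longrightarrow> g \<in> free_ideal \<Longrightarrow> f + g \<in> free_ideal"
  using additive_subgroup.a_closed[OF ideal.axioms(1)[OF free_ideal_ideal]] by simp

lemma free_ideal_zero: "0 \<in> free_ideal"
  using additive_subgroup.zero_closed[OF ideal.axioms(1)[OF free_ideal_ideal]] by simp

lemma free_ideal_relators: "tensor_relators (poly_alg {1, 2}) quot_alg \<subseteq> free_ideal"
  unfolding tensor_ideal_def
  by (rule ring.genideal_self[OF cring.axioms(1)[OF cring_free_alg] tensor_relators_closed])

lemma free_ideal_uminus: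
  assumes "f \<in> free_ideal"
  shows "- f \<in> free_ideal"
proof -
  interpret cring free_alg by (rule cring_free_alg)
  have f: "f \<in> carrier free_alg"
    using ideal.Icarr[OF free_ideal_ideal assms] .
  have "\<ominus>\<^bsub>free_alg\<^esub> f = - f"
    by (rule minus_equality) (use f in \<open>auto simp: keys_uminus_complex\<close>)
  then show ?thesis
    using additive_subgroup.a_inv_closed[OF ideal.axioms(1)[OF free_ideal_ideal] assms] by simp
qed

definition tensor_cong :: "((cpoly \<times> cpoly set) \<Rightarrow>\<^sub>0 complex) \<Rightarrow> ((cpoly \<times> cpoly set) \<Rightarrow>\<^sub>0 complex) \<Rightarrow> bool"
    (infix \<open>\<sim>\<^sub>T\<close> 50) where
  "f \<sim>\<^sub>T g \<longleftrightarrow> f - g \<in> free_ideal"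

lemma tensor_cong_refl: "f \<sim>\<^sub>T f"
  by (simp add: tensor_cong_def free_ideal_zero del: One_nat_def)

lemma tensor_cong_sym: "f \<sim>\<^sub>T g \<Longrightarrow> g \<sim>\<^sub>T f"
  using free_ideal_uminus[of "f - g"] by (simp add: tensor_cong_def)

lemma tensor_cong_trans [trans]: "f \<sim>\<^sub>T g \<Longrightarrow> g \<sim>\<^sub>T h \<Longrightarrow> f \<sim>\<^sub>T h"
  using free_ideal_add[of "f - g" "g - h"] by (simp add: tensor_cong_def)

lemma tensor_cong_add: "f \<sim>\<^sub>T g \<Longrightarrow> f' \<sim>\<^sub>T g' \<Longrightarrow> f + f' \<sim>\<^sub>T g + g'"
  using free_ideal_add[of "f - g" "f' - g'"] by (simp add: tensor_cong_def algebra_simps)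

lemma tensor_cong_sum: "(\<And>x. x \<in> K \<Longrightarrow> f x \<sim>\<^sub>T g x) \<Longrightarrow> sum f K \<sim>\<^sub>T sum g K"
  by (induction K rule: infinite_finite_induct) (auto intro: tensor_cong_refl tensor_cong_add)

lemma tensor_cong_add_left:
  assumes "x \<in> polys {1, 2}" "x' \<in> polys {1, 2}" "Y \<in> carrier quot_alg"
  shows "Poly_Mapping.single (x + x', Y) 1 \<sim>\<^sub>T Poly_Mapping.single (x, Y) 1 + Poly_Mapping.single (x', Y) 1"
proof -
  have "Poly_Mapping.single (x \<oplus>\<^bsub>poly_alg {1, 2}\<^esub> x', Y) 1 - Poly_Mapping.single (x, Y) 1
      - Poly_Mapping.single (x', Y) 1 \<in> tensor_relators (poly_alg {1, 2}) quot_alg"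
    unfolding tensor_relators_def using assms by blast
  then show ?thesis
    using free_ideal_relators by (auto simp: tensor_cong_def diff_diff_eq)
qed

lemma tensor_cong_add_right:
  assumes "x \<in> polys {1, 2}" "y \<in> polys {3..14}" "y' \<in> polys {3..14}"
  shows "Poly_Mapping.single (x, coset_J (y + y')) 1
    \<sim>\<^sub>T Poly_Mapping.single (x, coset_J y) 1 + Poly_Mapping.single (x, coset_J y') 1"
proof -
  have "Poly_Mapping.single (x, coset_J y \<oplus>\<^bsub>quot_alg\<^esub> coset_J y') 1 - Poly_Mapping.single (x, coset_J y) 1
      - Poly_Mapping.single (x, coset_J y') 1 \<in> tensor_relators (poly_alg {1, 2}) quot_alg"
    unfolding tensor_relators_def using assms coset_J_closed by blast
  then show ?thesis
    using free_ideal_relators unfolding coset_J_add[OF assms(2,3)] by (auto simp: tensor_cong_def diff_diff_eq)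
qed

lemma tensor_cong_smult_left:
  assumes "x \<in> polys {1, 2}" "Y \<in> carrier quot_alg"
  shows "Poly_Mapping.single (Const c * x, Y) 1 \<sim>\<^sub>T Poly_Mapping.single (x, Y) c"
proof -
  have "Poly_Mapping.single (c \<odot>\<^bsub>poly_alg {1, 2}\<^esub> x, Y) 1 - Poly_Mapping.single (x, Y) c
      \<in> tensor_relators (poly_alg {1, 2}) quot_alg"
    unfolding tensor_relators_def using assms by blast
  then show ?thesis
    using free_ideal_relators by (auto simp: tensor_cong_def)
qed

lemma tensor_cong_smult_right:
  assumes "x \<in> polys {1, 2}" "y \<in> polys {3..14}"
  shows "Poly_Mapping.single (x, coset_J (Const c * y)) 1 \<sim>\<^sub>T Poly_Mapping.single (x, coset_J y) c"
proof -
  have "Poly_Mapping.single (x, c \<odot>\<^bsub>quot_alg\<^esub> coset_J y) 1 - Poly_Mapping.single (x, coset_J y) c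
      \<in> tensor_relators (poly_alg {1, 2}) quot_alg"
    unfolding tensor_relators_def using assms coset_J_closed by blast
  then show ?thesis
    using free_ideal_relators unfolding coset_J_smult[OF assms(2)] by (auto simp: tensor_cong_def)
qed

lemma tensor_cong_zero_right: "x \<in> polys {1, 2} \<Longrightarrow> Poly_Mapping.single (x, coset_J 0) 1 \<sim>\<^sub>T 0"
  using tensor_cong_smult_right[of x 0 0] by simp

lemma tensor_cong_zero_left: "Y \<in> carrier quot_alg \<Longrightarrow> Poly_Mapping.single (0, Y) 1 \<sim>\<^sub>T 0"
  using tensor_cong_smult_left[of 0 Y 0] by simp

text \<open>The monomials in \<open>a_1, a_2\<close> are a basis of the left factor, so a tensor is
  given by one coset for each of finitely many monomials.\<close>

definition normal_form :: "(nat \<Rightarrow>\<^sub>0 nat) set \<Rightarrow> ((nat \<Rightarrow>\<^sub>0 nat) \<Rightarrow> cpoly) \<Rightarrow> (cpoly \<times> cpoly set) \<Rightarrow>\<^sub>0 complex" where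
  "normal_form K t = (\<Sum>m\<in>K. Poly_Mapping.single (Poly_Mapping.single m 1, coset_J (t m)) 1)"

lemma normal_form_single:
  assumes "x \<in> polys {1, 2}" "y \<in> polys {3..14}"
  shows "Poly_Mapping.single (x, coset_J y) c
    \<sim>\<^sub>T normal_form (Poly_Mapping.keys x) (\<lambda>m. Const (Poly_Mapping.lookup x m) * (Const c * y))"
proof -
  let ?z = "Const c * y"
  have z: "?z \<in> polys {3..14}" using assms(2) by (intro polys_mult polys_Const)
  have "Poly_Mapping.single (\<Sum>m\<in>K. Poly_Mapping.single m (u m), coset_J ?z) 1
      \<sim>\<^sub>T normal_form K (\<lambda>m. Const (u m) * ?z)"
    if "finite K" "\<forall>m\<in>K. Poly_Mapping.keys m \<subseteq> {1, 2}" for K u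
    using that
  proof (induction K rule: finite_induct)
    case empty
    show ?case using tensor_cong_zero_left[OF coset_J_closed[OF z]] by (simp add: normal_form_def)
  next
    case (insert m K)
    have m: "Poly_Mapping.single m a \<in> polys {1, 2}" for a
      using insert.prems by (intro polys_single) simp
    have "Poly_Mapping.single (Poly_Mapping.single m (u m), coset_J ?z) 1
        \<sim>\<^sub>T Poly_Mapping.single (Poly_Mapping.single m 1, coset_J ?z) (u m)"
      using tensor_cong_smult_left[OF m[of 1] coset_J_closed[OF z], of "u m"] by (simp add: mult_single)
    also have "\<dots> \<sim>\<^sub>T Poly_Mapping.single (Poly_Mapping.single m 1, coset_J (Const (u m) * ?z)) 1"
      using tensor_cong_smult_right[OF m[of 1] z] by (rule tensor_cong_sym)
    finally have *: "Poly_Mapping.single (Poly_Mapping.single m (u m), coset_J ?z) 1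
        \<sim>\<^sub>T Poly_Mapping.single (Poly_Mapping.single m 1, coset_J (Const (u m) * ?z)) 1" .
    have "(\<Sum>m\<in>K. Poly_Mapping.single m (u m)) \<in> polys {1, 2}"
      using insert.prems by (intro polys_sum polys_single) simp
    from tensor_cong_add_left[OF m this coset_J_closed[OF z]]
    have "Poly_Mapping.single (\<Sum>m\<in>insert m K. Poly_Mapping.single m (u m), coset_J ?z) 1
        \<sim>\<^sub>T Poly_Mapping.single (Poly_Mapping.single m (u m), coset_J ?z) 1
          + Poly_Mapping.single (\<Sum>m\<in>K. Poly_Mapping.single m (u m), coset_J ?z) 1"
      using insert.hyps by simp
    also have "\<dots> \<sim>\<^sub>T normal_form (insert m K) (\<lambda>m. Const (u m) * ?z)"
      using tensor_cong_add[OF * insert.IH] insert.prems insert.hyps by (simp add: normal_form_def)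
    finally show ?case .
  qed
  from this[of "Poly_Mapping.keys x" "Poly_Mapping.lookup x"]
  have "Poly_Mapping.single (x, coset_J ?z) 1
      \<sim>\<^sub>T normal_form (Poly_Mapping.keys x) (\<lambda>m. Const (Poly_Mapping.lookup x m) * ?z)"
    using assms(1) by (simp add: polys_iff flip: poly_mapping_eq_sum_single)
  then show ?thesis
    by (rule tensor_cong_trans[OF tensor_cong_sym[OF tensor_cong_smult_right[OF assms]]])
qed

text \<open>Brings two normal forms to a common set of monomials. The padding terms pair a monomial
  with the zero coset: they are nonzero in the free space but vanish in the tensor product.\<close>

lemma normal_form_extend:
  assumes "finite L" "K \<subseteq> L" "\<forall>m\<in>L. Poly_Mapping.keys m \<subseteq> {1, 2}"
  shows "normal_form L (\<lambda>m. if m \<in> K then t m else 0) \<sim>\<^sub>T normal_form K t"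
proof -
  let ?s = "\<lambda>m y. Poly_Mapping.single (Poly_Mapping.single m (1::complex), coset_J y) (1::complex)"
  have "normal_form L (\<lambda>m. if m \<in> K then t m else 0)
      \<sim>\<^sub>T (\<Sum>m\<in>L. if m \<in> K then ?s m (t m) else 0)"
    unfolding normal_form_def
    by (rule tensor_cong_sum)
      (simp add: tensor_cong_refl tensor_cong_zero_right polys_single bspec[OF assms(3)] del: One_nat_def)
  also have "(\<Sum>m\<in>L. if m \<in> K then ?s m (t m) else 0) = normal_form K t"
    using assms(1,2) by (simp add: normal_form_def sum.inter_restrict[symmetric] Int_absorb1)
  finally show ?thesis .
qed

lemma normal_form_exists:
  assumes "f \<in> carrier free_alg"
  shows "\<exists>K t. finite K \<and> (\<forall>m\<in>K. Poly_Mapping.keys m \<subseteq> {1, 2}) \<and> (\<forall>m. t m \<in> polys {3..14}) \<and>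
    f \<sim>\<^sub>T normal_form K t"
  using assms
proof (induction f rule: free_induct)
  case zero
  show ?case
    by (intro exI[of _ "{}"] exI[of _ "\<lambda>_. 0"]) (simp add: normal_form_def tensor_cong_refl)
next
  case (single x Y c)
  obtain y where y: "y \<in> polys {3..14}" "Y = coset_J y"
    using quot_alg_cases[OF single(2)] by blast
  show ?case
    using normal_form_single[OF single(1) y(1), of c] single(1) y
    by (intro exI[of _ "Poly_Mapping.keys x"]
        exI[of _ "\<lambda>m. Const (Poly_Mapping.lookup x m) * (Const c * y)"])
      (auto simp: polys_iff[of x] intro!: polys_mult)
next
  case (add f g)
  obtain K t where K: "finite K" "\<forall>m\<in>K. Poly_Mapping.keys m \<subseteq> {1, 2}" "\<forall>m. t m \<in> polys {3..14}"
    "f \<sim>\<^sub>T normal_form K t"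
    using add.IH(1) by (elim exE conjE)
  obtain L s where L: "finite L" "\<forall>m\<in>L. Poly_Mapping.keys m \<subseteq> {1, 2}" "\<forall>m. s m \<in> polys {3..14}"
    "g \<sim>\<^sub>T normal_form L s"
    using add.IH(2) by (elim exE conjE)
  let ?t = "\<lambda>m. if m \<in> K then t m else 0" and ?s = "\<lambda>m. if m \<in> L then s m else 0"
  have fin: "finite (K \<union> L)" "\<forall>m\<in>K \<union> L. Poly_Mapping.keys m \<subseteq> {1, 2}"
    using K L by auto
  have "f \<sim>\<^sub>T normal_form (K \<union> L) ?t"
    by (rule tensor_cong_trans[OF K(4) tensor_cong_sym[OF normal_form_extend[OF fin(1) Un_upper1 fin(2)]]])
  moreover have "g \<sim>\<^sub>T normal_form (K \<union> L) ?s"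
    by (rule tensor_cong_trans[OF L(4) tensor_cong_sym[OF normal_form_extend[OF fin(1) Un_upper2 fin(2)]]])
  ultimately have "f + g \<sim>\<^sub>T normal_form (K \<union> L) ?t + normal_form (K \<union> L) ?s"
    by (rule tensor_cong_add)
  moreover have "normal_form (K \<union> L) (\<lambda>m. ?t m + ?s m) \<sim>\<^sub>T normal_form (K \<union> L) ?t + normal_form (K \<union> L) ?s"
    unfolding normal_form_def sum.distrib[symmetric]
    by (rule tensor_cong_sum, rule tensor_cong_add_right)
      (simp_all add: polys_single bspec[OF fin(2)] K(3) L(3) polys_zero del: One_nat_def)
  ultimately have "f + g \<sim>\<^sub>T normal_form (K \<union> L) (\<lambda>m. ?t m + ?s m)"
    by (rule tensor_cong_trans[OF _ tensor_cong_sym])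
  moreover have "\<forall>m. ?t m + ?s m \<in> polys {3..14}"
    by (simp add: polys_add K(3) L(3))
  ultimately show ?case
    using finite_UnI[OF K(1) L(1)] fin(2)
    by (intro exI[of _ "K \<union> L"] exI[of _ "\<lambda>m. ?t m + ?s m"] conjI)
qed

text \<open>Adding \<open>s / 4\<close> and \<open>t / 4\<close> to all entries of the lists changes
  the traces to \<open>s\<close> and \<open>t\<close> and leaves the centred lists alone.\<close>

lemma trace_fn_prescribed:
  assumes "traceless_list as" "traceless_list bs"
  shows "\<exists>p\<in>Com4. trace_fn 1 p = s \<and> trace_fn 2 p = t \<and> (\<forall>i\<in>{3..14}. trace_fn i p = moment as bs i)"
proof -
  let ?xs = "map (\<lambda>a. a + s / 4) as" and ?ys = "map (\<lambda>b. b + t / 4) bs"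
  have "sum_list (map (\<lambda>a. a + c / 4) as) = c \<and> center (map (\<lambda>a. a + c / 4) as) = as"
    if "traceless_list as" for c as
    using that
  proof (rule traceless_listE)
    fix a1 a2 a3 a4 assume as: "as = [a1, a2, a3, a4]" "a1 + a2 + a3 + a4 = 0"
    have "sum_list (map (\<lambda>a. a + c / 4) as) = (a1 + a2 + a3 + a4) + c"
      unfolding as(1) by (simp add: field_simps)
    then have "sum_list (map (\<lambda>a. a + c / 4) as) = c"
      by (simp only: as(2) add_0)
    then show ?thesis by (simp add: center_def comp_def)
  qed
  then have *: "sum_list ?xs = s" "center ?xs = as" "sum_list ?ys = t" "center ?ys = bs"
    using assms by blast+
  have len: "length ?xs = 4" "length ?ys = 4"
    using assms by (simp_all add: traceless_list_def)
  show ?thesis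
    by (rule bexI[OF _ diag4_Com4[OF len]])
      (use * in \<open>auto simp: trace_fn_diag4[OF len] generator_def\<close>)
qed

lemma tensor_eval_normal_form:
  assumes "\<forall>m. t m \<in> polys {3..14}" "p \<in> Com4"
  shows "tensor_eval (normal_form K t) p = (\<Sum>m\<in>K. monom_val (\<lambda>i. trace_fn i p) m * value_at p (t m))"
  using assms by (simp add: tensor_eval_def normal_form_def tensor_weight_def coset_val_coset_J)

lemma normal_form_kernel:
  assumes K: "finite K" "\<forall>m\<in>K. Poly_Mapping.keys m \<subseteq> {1, 2}" and t: "\<forall>m. t m \<in> polys {3..14}"
    and zero: "\<And>p. p \<in> Com4 \<Longrightarrow> tensor_eval (normal_form K t) p = 0"
  shows "normal_form K t \<sim>\<^sub>T 0"
proof -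
  have "t m \<in> J" if "m \<in> K" for m
  proof (rule J_eq_vanishing)
    show "t m \<in> polys {3..14}" using t by blast
  next
    fix as bs :: "complex list" assume tl: "traceless_list as" "traceless_list bs"
    \<comment> \<open>The centred point is kept fixed while the two traces vary freely, so
      independence of monomials separates the coefficients.\<close>
    have "(\<Sum>m\<in>K. poly_val (moment as bs) (t m) * monom_val a m) = 0" for a
    proof -
      obtain p where p: "p \<in> Com4" "trace_fn 1 p = a 1" "trace_fn 2 p = a 2"
        "\<And>i. i \<in> {3..14} \<Longrightarrow> trace_fn i p = moment as bs i"
        using trace_fn_prescribed[OF tl, of "a 1" "a 2"] by blast
      have "value_at p (t m) = poly_val (moment as bs) (t m)" for m
        using t p(4) by (intro poly_val_cong[of "t m" "{3..14}"]) auto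
      moreover have "monom_val (\<lambda>i. trace_fn i p) m = monom_val a m" if "m \<in> K" for m
        by (rule monom_val_cong) (use K(2) that p(2,3) in blast)
      ultimately show ?thesis
        using zero[OF p(1)] by (simp add: tensor_eval_normal_form[OF t p(1)] mult.commute)
    qed
    from monom_val_independent[OF K(1) this that] show "poly_val (moment as bs) (t m) = 0" .
  qed
  then have "coset_J (t m) = coset_J 0" if "m \<in> K" for m
    using that by (intro coset_J_eqI) simp
  then have "normal_form K t \<sim>\<^sub>T (\<Sum>m\<in>K. 0)"
    unfolding normal_form_def
    by (intro tensor_cong_sum) (simp add: tensor_cong_zero_right polys_single bspec[OF K(2)] del: One_nat_def)
  then show ?thesis by simp
qed

lemma tensor_eval_kernel: "a_kernel free_alg coord_ring_inv_Com4 tensor_eval = free_ideal"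
proof
  interpret ring_hom_ring free_alg coord_ring_inv_Com4 tensor_eval by (rule tensor_eval_hom)
  have eval: "tensor_eval f = (\<lambda>p\<in>Com4. 0)" if "\<And>p. p \<in> Com4 \<Longrightarrow> linear_ext (tensor_weight p) f = 0" for f
    unfolding tensor_eval_def using that by (rule restrict_ext)
  have relators: "tensor_eval r = (\<lambda>p\<in>Com4. 0)" if "r \<in> tensor_relators (poly_alg {1, 2}) quot_alg" for r
  proof (rule eval)
    fix p assume p: "p \<in> Com4"
    have val: "coset_val p (Y \<oplus>\<^bsub>quot_alg\<^esub> Y') = coset_val p Y + coset_val p Y'"
      "coset_val p (c \<odot>\<^bsub>quot_alg\<^esub> Y) = c * coset_val p Y"
      if Y: "Y \<in> carrier quot_alg" "Y' \<in> carrier quot_alg" for Y Y' c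
    proof -
      obtain y where y: "y \<in> polys {3..14}" "Y = coset_J y"
        using quot_alg_cases[OF Y(1)] by blast
      obtain y' where y': "y' \<in> polys {3..14}" "Y' = coset_J y'"
        using quot_alg_cases[OF Y(2)] by blast
      show "coset_val p (Y \<oplus>\<^bsub>quot_alg\<^esub> Y') = coset_val p Y + coset_val p Y'"
        unfolding y(2) y'(2) coset_J_add[OF y(1) y'(1)] coset_val_coset_J[OF p] by simp
      show "coset_val p (c \<odot>\<^bsub>quot_alg\<^esub> Y) = c * coset_val p Y"
        unfolding y(2) coset_J_smult[OF y(1)] coset_val_coset_J[OF p] by simp
    qed
    from that show "linear_ext (tensor_weight p) r = 0"
      unfolding tensor_relators_def Un_iff mem_Collect_eq
    proof (elim disjE exE conjE, goal_cases)
      case (1 x x' Y)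
      show ?case
        unfolding 1(1) by (simp add: tensor_weight_def algebra_simps)
    next
      case (2 x Y Y')
      show ?case
        unfolding 2(1) by (simp add: tensor_weight_def val(1)[OF 2(3,4)] algebra_simps del: alg_quot_simps)
    next
      case (3 c x Y)
      show ?case
        unfolding 3(1) by (simp add: tensor_weight_def)
    next
      case (4 c x Y)
      show ?case
        unfolding 4(1) by (simp add: tensor_weight_def val(2)[OF 4(3,3)] del: alg_quot_simps)
    qed
  qed
  then have "tensor_relators (poly_alg {1, 2}) quot_alg \<subseteq> a_kernel free_alg coord_ring_inv_Com4 tensor_eval"
    using tensor_relators_closed unfolding a_kernel_def' coord_ring_simps by blast
  then show ideal_le: "free_ideal \<subseteq> a_kernel free_alg coord_ring_inv_Com4 tensor_eval"
    unfolding tensor_ideal_def by (rule R.genideal_minimal[OF kernel_is_ideal])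
  show "a_kernel free_alg coord_ring_inv_Com4 tensor_eval \<subseteq> free_ideal"
  proof
    fix f assume "f \<in> a_kernel free_alg coord_ring_inv_Com4 tensor_eval"
    then have f: "f \<in> carrier free_alg" "tensor_eval f = (\<lambda>p\<in>Com4. 0)"
      unfolding a_kernel_def' mem_Collect_eq coord_ring_simps by blast+
    obtain K t where K: "finite K" "\<forall>m\<in>K. Poly_Mapping.keys m \<subseteq> {1, 2}" "\<forall>m. t m \<in> polys {3..14}"
      and nf: "f \<sim>\<^sub>T normal_form K t"
      using normal_form_exists[OF f(1)] by (elim exE conjE)
    \<comment> \<open>The inclusion already shown applies to this difference, so the normal form
      evaluates to zero along with \<open>f\<close>.\<close>
    have "f - normal_form K t \<in> a_kernel free_alg coord_ring_inv_Com4 tensor_eval"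
      using nf ideal_le unfolding tensor_cong_def by (rule rev_subsetD)
    then have diff: "tensor_eval (f - normal_form K t) = (\<lambda>p\<in>Com4. 0)"
      unfolding a_kernel_def' mem_Collect_eq coord_ring_simps by (rule conjunct2)
    have "tensor_eval (normal_form K t) p = 0" if "p \<in> Com4" for p
      using that fun_cong[OF diff, of p] fun_cong[OF f(2), of p]
      by (simp add: tensor_eval_def)
    then have "normal_form K t \<sim>\<^sub>T 0"
      by (rule normal_form_kernel[OF K])
    with nf have "f \<sim>\<^sub>T 0" by (rule tensor_cong_trans)
    then show "f \<in> free_ideal" by (simp add: tensor_cong_def)
  qed
qed

theorem theorem4p1:
  fixes R :: "(complex, cpoly) module" and S :: "(complex, cpoly set) module"
  defines "R \<equiv> poly_alg {1, 2}"
    and "S \<equiv> alg_quot (poly_alg {3..14}) J"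
  shows "\<exists>\<phi> \<in> alg_iso (alg_tensor R S) coord_ring_inv_Com4.
    (\<forall>i\<in>{1, 2}. \<phi> (pure_tensor R S (var i) \<one>\<^bsub>S\<^esub>) = restrict (trace_fn i) Com4) \<and>
    (\<forall>i\<in>{3..14}. \<phi> (pure_tensor R S \<one>\<^bsub>R\<^esub> (J +>\<^bsub>poly_alg {3..14}\<^esub> var i))
                    = restrict (trace_fn i) Com4)"
proof -
  interpret ring_hom_ring free_alg coord_ring_inv_Com4 tensor_eval by (rule tensor_eval_hom)
  interpret sub: abelian_subgroup free_ideal free_alg
    by (rule abelian_subgroupI3[OF ideal.axioms(1)[OF free_ideal_ideal] R.abelian_group_axioms])
  \<comment> \<open>The map of the first isomorphism theorem for \<open>tensor_eval\<close>:
    evaluation is constant on each coset of its kernel. That theorem yields a ring isomorphism;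
    compatibility with scalars is shown separately.\<close>
  define \<phi> where "\<phi> = (\<lambda>X. the_elem (tensor_eval ` X))"
  have coset: "\<phi> (free_ideal +>\<^bsub>free_alg\<^esub> f) = tensor_eval f" if "f \<in> carrier free_alg" for f
    unfolding \<phi>_def by (rule the_elem_simp[OF that, unfolded tensor_eval_kernel])
  have iso: "\<phi> \<in> ring_iso (free_alg Quot free_ideal) coord_ring_inv_Com4"
    unfolding \<phi>_def by (rule FactRing_iso_set[OF tensor_eval_surj, unfolded tensor_eval_kernel])
  have "\<phi> (c \<odot>\<^bsub>alg_tensor R S\<^esub> X) = c \<odot>\<^bsub>coord_ring_inv_Com4\<^esub> \<phi> X"
    if "X \<in> carrier (alg_tensor R S)" for c X
  proof -
    have "X \<in> a_rcosets\<^bsub>free_alg\<^esub> free_ideal"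
      using that unfolding alg_tensor_def R_def S_def alg_quot_simps FactRing_def
      by (simp only: partial_object.simps)
    then obtain f where f: "f \<in> carrier free_alg" "X = free_ideal +>\<^bsub>free_alg\<^esub> f"
      unfolding A_RCOSETS_def' by blast
    define cf where "cf = (\<lambda>f :: (cpoly \<times> cpoly set) \<Rightarrow>\<^sub>0 complex. Poly_Mapping.map ((*) c) f)"
    have keys: "cf g \<in> carrier free_alg" if "g \<in> carrier free_alg" for g
    proof -
      have "Poly_Mapping.keys (cf g) \<subseteq> Poly_Mapping.keys g"
        by (auto simp: cf_def in_keys_iff Poly_Mapping.map.rep_eq when_def)
      then show ?thesis
        using that unfolding free_prod_alg_simps mem_Collect_eq by (rule subset_trans)
    qed
    have eval: "tensor_eval (cf g) = (\<lambda>p\<in>Com4. c * tensor_eval g p)" for g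
    proof -
      have "linear_ext w (cf g) = c * linear_ext w g" for w
        by (subst linear_ext_superset[of "Poly_Mapping.keys g"])
          (auto simp: cf_def in_keys_iff Poly_Mapping.map.rep_eq when_def linear_ext_def sum_distrib_left
            mult.assoc)
      then show ?thesis
        unfolding tensor_eval_def by (intro restrict_ext) simp
    qed
    have smult: "c \<odot>\<^bsub>alg_tensor R S\<^esub> X = (\<Union>g\<in>X. free_ideal +>\<^bsub>free_alg\<^esub> cf g)"
      by (simp add: alg_tensor_def alg_quot_def R_def S_def cf_def)
    \<comment> \<open>Scaling commutes with evaluation, and two elements with the same evaluation
      lie in the same coset of the kernel. So the union defining the scalar multiple is a single
      coset.\<close>
    have "free_ideal +>\<^bsub>free_alg\<^esub> cf g = free_ideal +>\<^bsub>free_alg\<^esub> cf f" if "g \<in> X" for g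
    proof -
      have g: "g \<in> carrier free_alg" "tensor_eval g = tensor_eval f"
        using that unfolding f(2)
        by (rule sub.a_elemrcos_carrier[OF f(1)], rule rcos_imp_homeq[OF f(1), unfolded tensor_eval_kernel])
      have "tensor_eval (cf g) = tensor_eval (cf f)"
        by (simp only: eval g(2))
      from homeq_imp_rcos[OF keys[OF f(1)] keys[OF g(1)] this] show ?thesis
        unfolding tensor_eval_kernel by (rule sub.a_repr_independence'[OF _ keys[OF f(1)], symmetric])
    qed
    moreover have "f \<in> X"
      unfolding f(2) by (rule sub.a_rcos_self[OF f(1)])
    ultimately have "c \<odot>\<^bsub>alg_tensor R S\<^esub> X = free_ideal +>\<^bsub>free_alg\<^esub> cf f"
      unfolding smult by (intro SUP_eq_const) blast+
    then show ?thesis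
      by (simp only: coset[OF keys[OF f(1)]] eval coord_ring_simps f(2) coset[OF f(1)])
  qed
  moreover have "\<phi> \<in> ring_iso (alg_tensor R S) coord_ring_inv_Com4"
    using iso by (simp add: ring_iso_def ring_hom_def alg_tensor_def R_def S_def)
  ultimately have "\<phi> \<in> alg_iso (alg_tensor R S) coord_ring_inv_Com4"
    by (simp add: alg_iso_def)
  moreover have "\<phi> (pure_tensor R S (var i) \<one>\<^bsub>S\<^esub>) = restrict (trace_fn i) Com4" if "i \<in> {1, 2}" for i
  proof -
    have "Poly_Mapping.single (var i, coset_J 1) 1 \<in> carrier free_alg"
      using that coset_J_closed[of 1] by simp
    from coset[OF this] show ?thesis
      unfolding pure_tensor_def R_def S_def coset_J_one tensor_eval_single[OF polys_one]
      by (simp add: restrict_def)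
  qed
  moreover have "\<phi> (pure_tensor R S \<one>\<^bsub>R\<^esub> (J +>\<^bsub>poly_alg {3..14}\<^esub> var i)) = restrict (trace_fn i) Com4"
    if "i \<in> {3..14}" for i
  proof -
    have "Poly_Mapping.single (1, coset_J (var i)) 1 \<in> carrier free_alg"
      using that coset_J_closed[of "var i"] by simp
    from coset[OF this] show ?thesis
      unfolding pure_tensor_def R_def S_def coset_J_def[symmetric] poly_alg_simps
        tensor_eval_single[OF polys_var[OF that]]
      by (simp add: restrict_def)
  qed
  ultimately show ?thesis by blast
qed

end
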